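(* Let $\mathcal B=\bigcup_{m\geq 0}\{\widetilde\chi_m(1),\widetilde\chi_m(21),\widetilde\chi_m(2431)\}$. Let $\tau^{(1)},\tau^{(2)},\ldots$ be a (possibly empty, possibly infinite) list of patterns from $\mathcal B$, and let $\tau'^{(i)}=\operatorname{swl}(\tau^{(i)})$ for all $i$. Then the permutation classes $\operatorname{Av}(132,3412,\tau^{(1)},\tau^{(2)},\ldots)$ and $\operatorname{Av}(312,1342,\tau'^{(1)},\tau'^{(2)},\ldots)$ are strongly fertility Wilf equivalent.
   Context: $S_n$ is the set of permutations of $[n]$ in one-line notation. $\operatorname{Av}(\ldots)$ is the set of normalized permutations avoiding all listed patterns. For $\pi\in S_n$ and $m\ge0$, $\chi_m(\pi)=(n+m-1)\cdots(n+3)(n+1)\,\pi\,(n+2)(n+4)\cdots(n+m)$ if $m$ is even and $(n+m)\cdots(n+3)(n+1)\,\pi\,(n+2)(n+4)\cdots(n+m-1)$ if $m$ is odd. $\operatorname{rot}(\pi)$ is the reverse of the inverse of $\pi$ (plot rotated $90^\circ$ counterclockwise), and $\widetilde\chi_m(\pi)=\operatorname{rot}^{-1}(\chi_m(\operatorname{rot}(\pi)))$. Direct sum $\lambda\oplus\mu$ places $\mu$ above-right of $\lambda$; skew sum $\lambda\ominus\mu$ places $\mu$ below-right of $\lambda$. $\operatorname{swu}$ on $\operatorname{Av}(231)$: fixes the empty permutation; for nonempty $\pi=L\oplus(1\ominus R)$, $\operatorname{swu}(\pi)=(\operatorname{swu}(L)\oplus1)\ominus\operatorname{swu}(R)$.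 For $\pi\in\operatorname{Av}(132)$, $\operatorname{swl}(\pi)=\operatorname{rot}^{-1}(\operatorname{swu}(\operatorname{rot}(\pi)))$. Valid hook configurations: for $\pi=\pi_1\cdots\pi_n$, a descent is $i$ with $\pi_i>\pi_{i+1}$ and $(i,\pi_i)$ is a descent top. A hook from $(i,\pi_i)$ to $(j,\pi_j)$, $i<j$, $\pi_i<\pi_j$, goes vertically up from $(i,\pi_i)$ to height $\pi_j$ then right to $(j,\pi_j)$. If $\pi$ has $k$ descents, a valid hook configuration is a tuple of $k$ hooks such that (1) their southwest endpoints are exactly the descent tops; (2) no point $(r,\pi_r)$ with $i<r<j$ has $\pi_r>\pi_j$ for a hook from $(i,\pi_i)$ to $(j,\pi_j)$; (3) hooks do not intersect or overlap except that the northeast endpoint of one may be the southwest endpoint of another. Configurations include their underlying permutation; $\operatorname{VHC}(A)$ is the set of valid hook configurations of elements of $A$. Each of the $n-k$ points $(r,\pi_r)$ that is not a northeast endpoint gets the color of the hook from $(i,\pi_i)$ to $(j,\pi_j)$ with $i<r<j$ having the lowest horizontal segment, or the sky color if none; counting points per color ($q_0$ for sky, $q_u$ for the $u$-th hook) gives the induced composition $(q_0,\ldots,q_k)$. The type of a configuration is its induced composition sorted nonincreasingly. Classes $\mathcal C,\mathcal C'$ are strongly fertility Wilf equivalent if there is a type-preserving bijection $\operatorname{VHC}(\mathcal C)\to\operatorname{VHC}(\mathcal C')$.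
   Formalization: Each pattern χ̃_m(2431) contains 132, so it lies outside Av(132), the domain of swl, and its τ' is undefined; here such a τ contributes no pattern to the second class. Only the patterns χ̃_m(1) and χ̃_m(21) therefore contribute, and swl fixes them. *)

theory Defs
  imports Complex_Main "HOL-Combinatorics.Multiset_Permutations"
begin

section \<open>Permutations and patterns\<close>

text \<open>
  A permutation of \<open>{1..n}\<close> is the list of its values (one-line notation). Positions are counted
  from 1, so the plot of \<open>\<pi>\<close> consists of the points \<open>(i, entry \<pi> i)\<close>.
\<close>

type_synonym perm = "nat list"

definition entry :: "perm \<Rightarrow> nat \<Rightarrow> nat" where
  "entry \<pi> i = \<pi> ! (i - 1)"

definition is_perm :: "perm \<Rightarrow> bool" where
  "is_perm \<pi> \<longleftrightarrow> \<pi> \<in> permutations_of_set {1..length \<pi>}"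

definition contains :: "perm \<Rightarrow> perm \<Rightarrow> bool" where
  "contains \<pi> \<tau> \<longleftrightarrow>
     (\<exists>f. strict_mono_on {1..length \<tau>} f \<and> f ` {1..length \<tau>} \<subseteq> {1..length \<pi>} \<and>
          (\<forall>i\<in>{1..length \<tau>}. \<forall>j\<in>{1..length \<tau>}.
             entry \<pi> (f i) < entry \<pi> (f j) \<longleftrightarrow> entry \<tau> i < entry \<tau> j))"

definition Av :: "perm set \<Rightarrow> perm set" where
  "Av T = {\<pi>. is_perm \<pi> \<and> (\<forall>\<tau>\<in>T. \<not> contains \<pi> \<tau>)}"

definition direct_sum :: "perm \<Rightarrow> perm \<Rightarrow> perm" where
  "direct_sum \<alpha> \<beta> = \<alpha> @ map (\<lambda>x. x + length \<alpha>) \<beta>"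

definition skew_sum :: "perm \<Rightarrow> perm \<Rightarrow> perm" where
  "skew_sum \<alpha> \<beta> = map (\<lambda>x. x + length \<beta>) \<alpha> @ \<beta>"

definition perm_inverse :: "perm \<Rightarrow> perm" where
  "perm_inverse \<pi> = map (inv_into {1..length \<pi>} (entry \<pi>)) [1..<length \<pi> + 1]"

definition rot :: "perm \<Rightarrow> perm" where
  "rot \<pi> = rev (perm_inverse \<pi>)"

definition rot_inv :: "perm \<Rightarrow> perm" where
  "rot_inv \<pi> = perm_inverse (rev \<pi>)"

definition chi :: "nat \<Rightarrow> perm \<Rightarrow> perm" where
  "chi m \<pi> =
     map (\<lambda>k. length \<pi> + k) (rev (filter odd [1..<m + 1])) @ \<pi> @
     map (\<lambda>k. length \<pi> + k) (filter even [1..<m + 1])"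

definition chi_tilde :: "nat \<Rightarrow> perm \<Rightarrow> perm" where
  "chi_tilde m \<pi> = rot_inv (chi m (rot \<pi>))"

lemma is_perm_iff: "is_perm \<pi> \<longleftrightarrow> distinct \<pi> \<and> set \<pi> = {1..length \<pi>}"
  by (auto simp: is_perm_def permutations_of_set_def)

lemma entry_bij: "is_perm \<pi> \<Longrightarrow> bij_betw (entry \<pi>) {1..length \<pi>} {1..length \<pi>}"
proof -
  assume p: "is_perm \<pi>"
  have "bij_betw (\<lambda>i. i - 1) {1..length \<pi>} {..<length \<pi>}"
    by (rule bij_betw_byWitness[where f' = Suc]) auto
  moreover have "bij_betw ((!) \<pi>) {..<length \<pi>} {1..length \<pi>}"
    using p by (intro bij_betw_nth) (auto simp: is_perm_iff)
  ultimately have "bij_betw ((!) \<pi> \<circ> (\<lambda>i. i - 1)) {1..length \<pi>} {1..length \<pi>}"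
    by (rule bij_betw_trans)
  then show ?thesis
    by (simp add: entry_def[abs_def] o_def)
qed

lemma length_perm_inverse [simp]: "length (perm_inverse \<pi>) = length \<pi>"
  by (simp add: perm_inverse_def del: upt_Suc)

lemma entry_perm_inverse:
  "1 \<le> v \<Longrightarrow> v \<le> length \<pi> \<Longrightarrow> entry (perm_inverse \<pi>) v = inv_into {1..length \<pi>} (entry \<pi>) v"
  by (simp add: perm_inverse_def entry_def del: upt_Suc)

lemma perm_inverse_perm_inverse: "is_perm \<pi> \<Longrightarrow> perm_inverse (perm_inverse \<pi>) = \<pi>"
proof -
  assume p: "is_perm \<pi>"
  note b = entry_bij[OF p]
  let ?A = "{1..length \<pi>}" and ?g = "inv_into {1..length \<pi>} (entry \<pi>)"
  have g: "bij_betw ?g ?A ?A" using b by (rule bij_betw_inv_into)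
  have gi: "inj_on (entry (perm_inverse \<pi>)) ?A"
    using g by (auto simp: bij_betw_def inj_on_def entry_perm_inverse)
  show ?thesis
  proof (rule nth_equalityI)
    show "length (perm_inverse (perm_inverse \<pi>)) = length \<pi>" by simp
    fix i assume "i < length (perm_inverse (perm_inverse \<pi>))"
    then have i: "i < length \<pi>" by simp
    then have iA: "Suc i \<in> ?A" by auto
    have eA: "entry \<pi> (Suc i) \<in> ?A" using b iA by (rule bij_betw_apply)
    have "entry (perm_inverse \<pi>) (entry \<pi> (Suc i)) = Suc i"
      using eA iA b by (simp add: entry_perm_inverse bij_betw_inv_into_left)
    then have "inv_into ?A (entry (perm_inverse \<pi>)) (Suc i) = entry \<pi> (Suc i)"
      using gi eA by (metis inv_into_f_f)
    then have "entry (perm_inverse (perm_inverse \<pi>)) (Suc i) = entry \<pi> (Suc i)"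
      using iA by (simp add: entry_perm_inverse)
    then show "perm_inverse (perm_inverse \<pi>) ! i = \<pi> ! i" by (simp add: entry_def)
  qed
qed

lemma rot_inv_rot: "is_perm \<pi> \<Longrightarrow> rot_inv (rot \<pi>) = \<pi>"
  by (simp add: rot_def rot_inv_def perm_inverse_perm_inverse)

lemma rot_rot_inv: "is_perm \<pi> \<Longrightarrow> rot (rot_inv \<pi>) = \<pi>"
  using perm_inverse_perm_inverse[of "rev \<pi>"]
  by (simp add: rot_def rot_inv_def is_perm_iff)


section \<open>The maps swu and swl\<close>

text \<open>
  A nonempty \<open>\<pi> \<in> Av(231)\<close> has the form \<open>L \<oplus> (1 \<ominus> R)\<close>, where \<open>L\<close> is the part of \<open>\<pi>\<close> before its largest
  entry and \<open>R\<close> is the part after it, lowered by the length of \<open>L\<close>; see \<open>swu_decomposition\<close>.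
  The values of \<open>swu\<close> outside \<open>Av(231)\<close> carry no meaning.
\<close>

function swu :: "perm \<Rightarrow> perm" where
  "swu \<pi> =
     (if \<pi> = [] then []
      else let L = takeWhile (\<lambda>x. x \<noteq> Max (set \<pi>)) \<pi>;
               R = map (\<lambda>x. x - length L) (drop (length L + 1) \<pi>)
           in skew_sum (direct_sum (swu L) [1]) (swu R))"
  by pat_completeness auto
termination
proof (relation "measure length")
  fix \<pi> L :: perm
  assume ne: "\<pi> \<noteq> []" and L: "L = takeWhile (\<lambda>x. x \<noteq> Max (set \<pi>)) \<pi>"
  have "Max (set \<pi>) \<in> set \<pi>" using ne by simp
  then have "L \<noteq> \<pi>" using L by (metis set_takeWhileD)
  moreover have "\<pi> = L @ dropWhile (\<lambda>x. x \<noteq> Max (set \<pi>)) \<pi>" using L by simp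
  ultimately have "length L < length \<pi>"
    by (metis length_append length_greater_0_conv less_add_same_cancel1 self_append_conv)
  then show "(L, \<pi>) \<in> measure length" by simp
qed auto

declare swu.simps [simp del]

lemma swu_Nil: "swu [] = []"
  by (simp add: swu.simps)

lemma swu_decomposition:
  assumes "is_perm L" "is_perm R"
  shows "swu (direct_sum L (skew_sum [1] R)) = skew_sum (direct_sum (swu L) [1]) (swu R)"
proof -
  let ?n = "Suc (length R + length L)"
  let ?p = "direct_sum L (skew_sum [1] R)"
  have p: "?p = L @ ?n # map (\<lambda>x. x + length L) R"
    by (simp add: direct_sum_def skew_sum_def)
  have bL: "x < ?n" if "x \<in> set L" for x
    using that assms(1) by (auto simp: is_perm_iff)
  have bR: "x + length L < ?n" if "x \<in> set R" for x
    using that assms(2) by (auto simp: is_perm_iff)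
  have M: "Max (set ?p) = ?n"
    unfolding p by (rule Max_eqI) (use bL bR in \<open>auto intro: less_imp_le\<close>)
  have T: "takeWhile (\<lambda>x. x \<noteq> ?n) ?p = L"
    unfolding p using bL by (subst takeWhile_append2) auto
  have D: "map (\<lambda>x. x - length L) (drop (length L + 1) ?p) = R"
    unfolding p by (simp add: o_def)
  have ne: "?p \<noteq> []" unfolding p by simp
  show ?thesis
    by (subst swu.simps) (simp only: ne if_False Let_def M T D)
qed

text \<open>
  \<open>swl\<close> is defined only on \<open>Av(132)\<close>, which \<open>rot\<close> maps onto the domain \<open>Av(231)\<close> of \<open>swu\<close>; it is
  therefore a partial function.
\<close>

definition swl :: "perm \<Rightarrow> perm option" where
  "swl \<pi> = (if \<pi> \<in> Av {[1,3,2]} then Some (rot_inv (swu (rot \<pi>))) else None)"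


section \<open>Valid hook configurations\<close>

text \<open>
  A hook of \<open>\<pi>\<close> is the pair \<open>(i, j)\<close> of the positions of its southwest endpoint \<open>(i, \<pi>\<^sub>i)\<close> and its
  northeast endpoint \<open>(j, \<pi>\<^sub>j)\<close>.
\<close>

type_synonym hook = "nat \<times> nat"

definition point :: "perm \<Rightarrow> nat \<Rightarrow> real \<times> real" where
  "point \<pi> i = (real i, real (entry \<pi> i))"

definition is_hook :: "perm \<Rightarrow> hook \<Rightarrow> bool" where
  "is_hook \<pi> = (\<lambda>(i, j). 1 \<le> i \<and> i < j \<and> j \<le> length \<pi> \<and> entry \<pi> i < entry \<pi> j)"

definition hook_path :: "perm \<Rightarrow> hook \<Rightarrow> (real \<times> real) set" where
  "hook_path \<pi> = (\<lambda>(i, j).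
     {real i} \<times> {real (entry \<pi> i)..real (entry \<pi> j)} \<union>
     {real i..real j} \<times> {real (entry \<pi> j)})"

definition descents :: "perm \<Rightarrow> nat set" where
  "descents \<pi> = {i. 1 \<le> i \<and> i < length \<pi> \<and> entry \<pi> i > entry \<pi> (i + 1)}"

text \<open>
  The tuple of hooks is listed from left to right: its \<open>u\<close>-th member starts at the \<open>u\<close>-th descent top.
\<close>

definition valid_hook_configuration :: "perm \<Rightarrow> hook list \<Rightarrow> bool" where
  "valid_hook_configuration \<pi> H \<longleftrightarrow>
     (\<forall>h\<in>set H. is_hook \<pi> h) \<and>
     map fst H = sorted_list_of_set (descents \<pi>) \<and>
     (\<forall>(i, j)\<in>set H. \<forall>r. i < r \<and> r < j \<longrightarrow> \<not> entry \<pi> r > entry \<pi> j) \<and>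
     (\<forall>u<length H. \<forall>v<length H. u \<noteq> v \<longrightarrow>
        hook_path \<pi> (H ! u) \<inter> hook_path \<pi> (H ! v) \<subseteq>
          {point \<pi> (snd (H ! u))} \<inter> {point \<pi> (fst (H ! v))} \<union>
          {point \<pi> (fst (H ! u))} \<inter> {point \<pi> (snd (H ! v))})"

definition VHC :: "perm set \<Rightarrow> (perm \<times> hook list) set" where
  "VHC A = {(\<pi>, H). \<pi> \<in> A \<and> valid_hook_configuration \<pi> H}"

text \<open>
  Colors are \<open>0\<close> (sky) and \<open>1, \<dots>, k\<close>, where \<open>u\<close> is the color of the \<open>u\<close>-th hook \<open>H ! (u - 1)\<close>.
\<close>

definition hook_spans :: "hook \<Rightarrow> nat \<Rightarrow> bool" where
  "hook_spans = (\<lambda>(i, j) r. i < r \<and> r < j)"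

definition has_color :: "perm \<Rightarrow> hook list \<Rightarrow> nat \<Rightarrow> nat \<Rightarrow> bool" where
  "has_color \<pi> H r u \<longleftrightarrow>
     (if u = 0 then \<forall>h\<in>set H. \<not> hook_spans h r
      else u \<le> length H \<and> hook_spans (H ! (u - 1)) r \<and>
           (\<forall>h\<in>set H. hook_spans h r \<longrightarrow> entry \<pi> (snd (H ! (u - 1))) \<le> entry \<pi> (snd h)))"

definition induced_composition :: "perm \<times> hook list \<Rightarrow> nat list" where
  "induced_composition = (\<lambda>(\<pi>, H).
     map (\<lambda>u. card {r \<in> {1..length \<pi>}. r \<notin> snd ` set H \<and> has_color \<pi> H r u})
       [0..<length H + 1])"

definition config_type :: "perm \<times> hook list \<Rightarrow> nat list" where
  "config_type c = rev (sort (induced_composition c))"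

definition strongly_fertility_Wilf_equivalent :: "perm set \<Rightarrow> perm set \<Rightarrow> bool" where
  "strongly_fertility_Wilf_equivalent C C' \<longleftrightarrow>
     (\<exists>f. bij_betw f (VHC C) (VHC C') \<and> (\<forall>c\<in>VHC C. config_type (f c) = config_type c))"

text \<open>
  The permutations \<open>chi_tilde m [2,4,3,1]\<close> contain 132, so \<open>swl\<close> is undefined (\<open>None\<close>) on them.
\<close>

definition pattern_family :: "perm set" where
  "pattern_family = (\<Union>m. {chi_tilde m [1], chi_tilde m [2,1], chi_tilde m [2,4,3,1]})"

end

theory Submission
  imports Defs "HOL-Library.Sublist"
begin

text \<open>
  A nonempty member of \<open>Av(132, 3412)\<close> is either \<open>\<pi> \<ominus> 1\<close> or \<open>\<delta> \<ominus> (\<pi> \<oplus> 1)\<close> with \<open>\<delta>\<close> decreasing of length \<open>k\<close>, and a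
  nonempty member of \<open>Av(312, 1342)\<close> is either \<open>\<pi> \<ominus> 1\<close> or \<open>\<pi> \<oplus> \<epsilon>\<close> with \<open>\<epsilon>\<close> decreasing of length \<open>k + 1\<close>, where
  \<open>\<pi>\<close> is again a member of the class, nonempty in the second alternative. Hence both
  classes are coded by the same words, and permutations with the same word contain the same patterns
  \<open>chi_tilde m [1]\<close> and \<open>chi_tilde m [2,1]\<close>. These patterns are fixed by \<open>swl\<close>, whereas
  \<open>chi_tilde m [2,4,3,1]\<close> contains 132 and imposes no condition on either side.

  Reading a permutation from left to right, hooks open and close like parentheses, and each point that
  closes no hook counts for the innermost open hook. For two permutations with the same word, these
  stack processes differ only in whether the \<open>k\<close> new hooks enter at the bottom or at the top of the
  stack. The distribution of the final multisets of counts is a symmetric function of the stack contents,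
  so it does not depend on the place of entry.
\<close>

section \<open>A symmetric stack machine\<close>

text \<open>A \<open>Low\<close> point lies below everything present, so it closes no hook; it makes
  its predecessor a descent top and is counted at once by the new hook. The leading right-hand point
  of a \<open>High k\<close> step exceeds everything built before it, so every hook opened by
  earlier steps could end there, and noncrossing leaves one choice: end the innermost of them or
  count for it. The decreasing run of the step creates \<open>k\<close> further descents, whose
  hooks can end only at later \<open>High\<close> steps; each starts with count 1, since the lower
  end of its descent is counted immediately.

  No bijection between configurations is written down. For two permutations with the same word the
  multisets of types are equal, and a type-preserving matching is then chosen between the two finite
  sets of configurations.\<close>

text \<open>
  A state is the list of color counts on a stack, top first. \<open>Low\<close> opens a hook; \<open>High k\<close> either counts
  one more point for the top hook or closes it, and then opens \<open>k\<close> hooks, all starting with count 1. The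
  bottom of the stack is the sky, which is never closed.
\<close>

datatype step = Low | High nat

fun runs :: "step list \<Rightarrow> nat list \<Rightarrow> nat multiset multiset" where
  "runs [] cs = (if length cs = 1 then {#{#hd cs#}#} else {#})"
| "runs (Low # ws) cs = runs ws (1 # cs)"
| "runs (High k # ws) cs =
     runs ws (replicate k 1 @ Suc (hd cs) # tl cs) +
     (if tl cs = [] then {#} else image_mset (add_mset (hd cs)) (runs ws (replicate k 1 @ tl cs)))"

text \<open>
  Symmetry in the stack contents alone does not survive a \<open>High\<close> step. The exchange identity in the
  second conjunct is what the swap of the two top counts needs there, and it is itself inductive.
\<close>

lemma runs_symmetric_aux:
  "(\<forall>cs cs'. cs \<noteq> [] \<longrightarrow> mset cs = mset cs' \<longrightarrow> runs ws cs = runs ws cs') \<and>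
   (\<forall>c d cs. runs ws (Suc c # d # cs) + image_mset (add_mset c) (runs ws (d # cs)) =
             runs ws (c # Suc d # cs) + image_mset (add_mset d) (runs ws (c # cs)))"
proof (induction ws)
  case Nil
  show ?case
  proof (intro conjI allI impI)
    fix cs cs' :: "nat list" assume "cs \<noteq> []" "mset cs = mset cs'"
    then have "length cs = length cs'" by (metis size_mset)
    with \<open>mset cs = mset cs'\<close> show "runs [] cs = runs [] cs'"
      by (cases cs; cases cs') auto
  next
    fix c d :: nat and cs :: "nat list"
    show "runs [] (Suc c # d # cs) + image_mset (add_mset c) (runs [] (d # cs)) =
          runs [] (c # Suc d # cs) + image_mset (add_mset d) (runs [] (c # cs))"
      by (simp add: add_mset_commute)
  qed
next
  case (Cons w ws)
  have sym: "runs ws cs = runs ws cs'" if "cs \<noteq> []" "mset cs = mset cs'" for cs cs'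
    using Cons.IH that by blast
  have ex: "runs ws (Suc c # d # cs) + image_mset (add_mset c) (runs ws (d # cs)) =
            runs ws (c # Suc d # cs) + image_mset (add_mset d) (runs ws (c # cs))" for c d cs
    using Cons.IH by blast
  show ?case
  proof (cases w)
    case Low
    show ?thesis
    proof (intro conjI allI impI)
      fix cs cs' :: "nat list" assume "cs \<noteq> []" "mset cs = mset cs'"
      then show "runs (w # ws) cs = runs (w # ws) cs'"
        using Low sym[of "1 # cs" "1 # cs'"] by simp
    next
      fix c d :: nat and cs :: "nat list"
      show "runs (w # ws) (Suc c # d # cs) + image_mset (add_mset c) (runs (w # ws) (d # cs)) =
            runs (w # ws) (c # Suc d # cs) + image_mset (add_mset d) (runs (w # ws) (c # cs))"
        using Low ex[of c d "1 # cs"]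
          sym[of "1 # Suc c # d # cs" "Suc c # d # 1 # cs"] sym[of "1 # d # cs" "d # 1 # cs"]
          sym[of "1 # c # Suc d # cs" "c # Suc d # 1 # cs"] sym[of "1 # c # cs" "c # 1 # cs"]
        by simp
    qed
  next
    case (High k)
    let ?r = "replicate k (1::nat)"
    show ?thesis
    proof (intro conjI allI impI)
      fix cs cs' :: "nat list" assume ne: "cs \<noteq> []" and eq: "mset cs = mset cs'"
      then have ne': "cs' \<noteq> []" by auto
      obtain c ds d es where cs: "cs = c # ds" and cs': "cs' = d # es"
        using ne ne' by (meson neq_Nil_conv)
      show "runs (w # ws) cs = runs (w # ws) cs'"
      proof (cases "c = d")
        case True
        then have e: "mset ds = mset es" using eq cs cs' by simp
        moreover have "ds = [] \<longleftrightarrow> es = []" using e by (metis mset_zero_iff)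
        moreover have "runs ws (?r @ Suc c # ds) = runs ws (?r @ Suc c # es)"
          using e by (intro sym) auto
        moreover have "ds \<noteq> [] \<Longrightarrow> runs ws (?r @ ds) = runs ws (?r @ es)"
          using e by (intro sym) auto
        ultimately show ?thesis using High True cs cs' by auto
      next
        case False
        \<comment> \<open>The stacks consist of \<open>c\<close>, \<open>d\<close> and a common rest
          \<open>fs\<close>, with different tops. Their counting and closing branches are then
          exactly the two sides of the exchange identity for \<open>c\<close> and
          \<open>d\<close>.\<close>
        have "d \<in># mset ds" using eq cs cs' False
          by (metis insert_noteq_member mset.simps(2))
        then obtain fs where fs: "mset ds = mset (d # fs)"
          by (metis ex_mset mset.simps(2) multi_member_split)
        then have fs': "mset es = mset (c # fs)"
          using eq cs cs' by (metis add_mset_commute add_mset_add_mset_same_iff mset.simps(2))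
        have "ds \<noteq> []" "es \<noteq> []" using fs fs' by auto
        moreover have "runs ws (?r @ Suc c # ds) = runs ws (Suc c # d # fs @ ?r)"
          "runs ws (?r @ ds) = runs ws (d # fs @ ?r)"
          "runs ws (?r @ Suc d # es) = runs ws (c # Suc d # fs @ ?r)"
          "runs ws (?r @ es) = runs ws (c # fs @ ?r)"
          using fs fs' \<open>ds \<noteq> []\<close> \<open>es \<noteq> []\<close> by (intro sym; simp add: ac_simps)+
        ultimately show ?thesis
          using High cs cs' ex[of c d "fs @ ?r"] by simp
      qed
    next
      fix c d :: nat and cs :: "nat list"
      \<comment> \<open>Both sides expand into four terms. The term that removes \<open>c\<close>
        and then \<open>d\<close> and the term that removes \<open>c\<close> and raises
        \<open>d\<close> occur on both sides; what remains is the exchange identity for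
        \<open>Suc c\<close> and \<open>d\<close>.\<close>
      have s: "runs ws (?r @ Suc (Suc c) # d # cs) = runs ws (Suc (Suc c) # d # ?r @ cs)"
        "runs ws (?r @ Suc c # Suc d # cs) = runs ws (Suc c # Suc d # ?r @ cs)"
        "runs ws (?r @ d # cs) = runs ws (d # ?r @ cs)"
        "runs ws (?r @ Suc c # cs) = runs ws (Suc c # ?r @ cs)"
        by (intro sym; simp)+
      show "runs (w # ws) (Suc c # d # cs) + image_mset (add_mset c) (runs (w # ws) (d # cs)) =
            runs (w # ws) (c # Suc d # cs) + image_mset (add_mset d) (runs (w # ws) (c # cs))"
        using ex[of "Suc c" d "?r @ cs"]
        by (auto simp: High s ac_simps image_mset.compositionality o_def add_mset_commute simp del: One_nat_def)
    qed
  qed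
qed

lemma runs_symmetric: "cs \<noteq> [] \<Longrightarrow> mset cs = mset cs' \<Longrightarrow> runs ws cs = runs ws cs'"
  using runs_symmetric_aux by blast

section \<open>Types of valid hook configurations\<close>

text \<open>Entries are distinct, so nothing above the northeast endpoint means strictly below it;
  the instance \<open>q = i\<close> is the height condition on the hook itself.\<close>

definition fits :: "perm \<Rightarrow> nat \<Rightarrow> nat \<Rightarrow> bool" where
  "fits \<pi> i j \<longleftrightarrow> 1 \<le> i \<and> i < j \<and> j \<le> length \<pi> \<and> (\<forall>q. i \<le> q \<and> q < j \<longrightarrow> entry \<pi> q < entry \<pi> j)"

text \<open>Noncrossing in terms of positions. For hooks that fit, it also forbids a common
  northeast endpoint; \<open>j = i'\<close> is the permitted contact.\<close>

definition nested :: "hook set \<Rightarrow> bool" where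
  "nested P \<longleftrightarrow> (\<forall>(i, j)\<in>P. \<forall>(i', j')\<in>P. i < i' \<longrightarrow> j' < j \<or> j \<le> i')"

text \<open>
  The sets of hooks that can still end at position \<open>r\<close> or later, when exactly the hooks starting in
  \<open>S\<close> are open before \<open>r\<close>.
\<close>

definition completions :: "perm \<Rightarrow> nat \<Rightarrow> nat set \<Rightarrow> hook set set" where
  "completions \<pi> r S = {P. fst ` P = S \<union> {d \<in> descents \<pi>. r \<le> d} \<and> inj_on fst P \<and>
     (\<forall>(i, j)\<in>P. r \<le> j \<and> fits \<pi> i j) \<and> nested P}"

text \<open>Hooks are identified by the positions of their southwest endpoints, and the sky by \<open>0\<close>.\<close>

definition color :: "hook set \<Rightarrow> nat \<Rightarrow> nat" where
  "color P q = Max (insert 0 {i. \<exists>j. (i, j) \<in> P \<and> i < q \<and> q < j})"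

definition color_count :: "perm \<Rightarrow> nat \<Rightarrow> hook set \<Rightarrow> nat \<Rightarrow> nat" where
  "color_count \<pi> r P i = card {q \<in> {r..length \<pi>}. q \<notin> snd ` P \<and> color P q = i}"

text \<open>The accumulator \<open>c\<close> holds the counts collected before position
  \<open>r\<close>. Hooks closed before \<open>r\<close> are no longer in \<open>P\<close>; their
  counts are added back one at a time when the recursion closes them.\<close>

definition completion_types :: "perm \<Rightarrow> nat \<Rightarrow> nat list \<Rightarrow> (nat \<Rightarrow> nat) \<Rightarrow> nat multiset multiset" where
  "completion_types \<pi> r st c =
     image_mset (\<lambda>P. image_mset (\<lambda>i. c i + color_count \<pi> r P i) (mset_set (insert 0 (fst ` P))))
       (mset_set (completions \<pi> r (set st)))"

section \<open>Scanning completions from left to right\<close>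

lemma entry_inj:
  "is_perm \<pi> \<Longrightarrow> i \<in> {1..length \<pi>} \<Longrightarrow> j \<in> {1..length \<pi>} \<Longrightarrow> entry \<pi> i = entry \<pi> j \<Longrightarrow> i = j"
  using entry_bij[of \<pi>] by (metis bij_betw_def inj_onD)

lemma finite_descents [simp]: "finite (descents \<pi>)"
  by (rule finite_subset[of _ "{..<length \<pi>}"]) (auto simp: descents_def)

lemma completions_subset:
  assumes "P \<in> completions \<pi> r S"
  shows "P \<subseteq> {..length \<pi>} \<times> {..length \<pi>}"
proof -
  have "\<forall>(i, j)\<in>P. fits \<pi> i j" using assms unfolding completions_def by blast
  then show ?thesis by (force simp: fits_def)
qed

lemma finite_completions [simp]: "finite (completions \<pi> r S)"
  by (rule finite_subset[of _ "Pow ({..length \<pi>} \<times> {..length \<pi>})"]) (use completions_subset in blast, simp)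

lemma completions_finite: "P \<in> completions \<pi> r S \<Longrightarrow> finite P"
  using completions_subset finite_subset by (metis finite_SigmaI finite_atMost)

lemma completion_types_end:
  "completion_types \<pi> (Suc (length \<pi>)) st c = (if st = [] then {#{#c 0#}#} else {#})"
proof -
  have "P \<in> completions \<pi> (Suc (length \<pi>)) (set st) \<longleftrightarrow> P = {} \<and> st = []" for P
  proof
    assume P: "P \<in> completions \<pi> (Suc (length \<pi>)) (set st)"
    then have "\<forall>(i, j)\<in>P. Suc (length \<pi>) \<le> j \<and> fits \<pi> i j" unfolding completions_def by blast
    then have "P = {}" unfolding fits_def by (metis (no_types, lifting) all_not_in_conv case_prodE not_less_eq_eq)
    with P show "P = {} \<and> st = []" unfolding completions_def by simp
  next
    have "{d \<in> descents \<pi>. Suc (length \<pi>) \<le> d} = {}" by (auto simp: descents_def)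
    then show "P \<in> completions \<pi> (Suc (length \<pi>)) (set st)" if "P = {} \<and> st = []"
      using that by (simp add: completions_def nested_def)
  qed
  then have "completions \<pi> (Suc (length \<pi>)) (set st) = {P. P = {} \<and> st = []}" by blast
  then show ?thesis
    by (cases "st = []") (simp_all add: completion_types_def color_count_def)
qed

lemma color_count_Suc:
  assumes "r \<le> length \<pi>"
  shows "color_count \<pi> r P i =
    (if r \<notin> snd ` P \<and> color P r = i then 1 else 0) + color_count \<pi> (Suc r) P i"
proof -
  have "{r..length \<pi>} = insert r {Suc r..length \<pi>}" using assms by auto
  then have "{q \<in> {r..length \<pi>}. q \<notin> snd ` P \<and> color P q = i} =
        (if r \<notin> snd ` P \<and> color P r = i then {r} else {}) \<union>
        {q \<in> {Suc r..length \<pi>}. q \<notin> snd ` P \<and> color P q = i}"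
    by auto
  then show ?thesis
    unfolding color_count_def by simp
qed

text \<open>
  The scan keeps the positions of the open hooks on a stack, the innermost one on top. Low hook that
  is closed at \<open>r\<close> must be the top one, since otherwise the top hook would cross it.
\<close>

lemma completions_skip:
  assumes "\<forall>i\<in>set st. i < r"
  shows "{P \<in> completions \<pi> r (set st). r \<notin> snd ` P} =
         completions \<pi> (Suc r) (set ((if r \<in> descents \<pi> then [r] else []) @ st))"
    proof -
  have s: "set st \<union> {d \<in> descents \<pi>. r \<le> d} =
      set ((if r \<in> descents \<pi> then [r] else []) @ st) \<union> {d \<in> descents \<pi>. Suc r \<le> d}"
    by (auto simp: Suc_le_eq le_eq_less_or_eq)
  have key: "(\<forall>(i, j)\<in>P. r \<le> j \<and> fits \<pi> i j) \<and> r \<notin> snd ` P \<longleftrightarrow> (\<forall>(i, j)\<in>P. Suc r \<le> j \<and> fits \<pi> i j)" for P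
  proof -
    have "(r \<le> j \<and> r \<noteq> j) = (Suc r \<le> j)" for j by auto
    moreover have "r \<notin> snd ` P \<longleftrightarrow> (\<forall>(i, j)\<in>P. r \<noteq> j)" by force
    ultimately show ?thesis by blast
  qed
  show ?thesis
    unfolding completions_def s by (rule set_eqI, unfold mem_Collect_eq) (simp only: key[symmetric] conj_ac)
qed

lemma completions_close:
  assumes st: "\<forall>i\<in>set st. 1 \<le> i \<and> i < r" "sorted_wrt (>) st"
  shows "{P \<in> completions \<pi> r (set st). r \<in> snd ` P} =
         (if st \<noteq> [] \<and> fits \<pi> (hd st) r then
           insert (hd st, r) `
             completions \<pi> (Suc r) (set ((if r \<in> descents \<pi> then [r] else []) @ tl st))
          else {})"
proof (rule set_eqI)
  let ?push = "\<lambda>st. (if r \<in> descents \<pi> then [r] else []) @ st"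
  fix P
  show "P \<in> {P \<in> completions \<pi> r (set st). r \<in> snd ` P} \<longleftrightarrow>
    P \<in> (if st \<noteq> [] \<and> fits \<pi> (hd st) r then
           insert (hd st, r) ` completions \<pi> (Suc r) (set (?push (tl st))) else {})"
  proof
    assume P: "P \<in> {P \<in> completions \<pi> r (set st). r \<in> snd ` P}"
    then obtain i where i: "(i, r) \<in> P" by auto
    have fstP: "fst ` P = set st \<union> {d \<in> descents \<pi>. r \<le> d}" and inj: "inj_on fst P"
      and fit: "\<And>i j. (i, j) \<in> P \<Longrightarrow> r \<le> j \<and> fits \<pi> i j"
      and nest: "\<And>i j i' j'. (i, j) \<in> P \<Longrightarrow> (i', j') \<in> P \<Longrightarrow> i < i' \<Longrightarrow> j' < j \<or> j \<le> i'"
      using P by (auto simp: completions_def nested_def)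
    have ir: "i < r" "fits \<pi> i r" using fit[OF i] by (auto simp: fits_def)
    have "i \<in> fst ` P" using i by force
    then have ist: "i \<in> set st" using fstP ir by auto
    then obtain a st' where a: "st = a # st'" by (cases st) auto
    have "a \<in> fst ` P" using fstP a by auto
    then obtain b where b: "(a, b) \<in> P" by auto
    have ia: "i = a"
    proof (rule ccontr)
      assume "i \<noteq> a"
      then have "i < a" using ist a st(2) by auto
      then show False using nest[OF i b] fit[OF b] st(1) a by auto
    qed
    let ?Q = "P - {(a, r)}"
    have PQ: "P = insert (a, r) ?Q" using i ia by auto
    have "j = r" if "(a, j) \<in> P" for j
      using inj_onD[OF inj _ that i] ia by simp
    then have fstQ: "fst ` ?Q = fst ` P - {a}" by force
    have ast: "a \<notin> set st'" "a < r" using st a by auto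
    have "fst ` ?Q = set (?push st') \<union> {d \<in> descents \<pi>. Suc r \<le> d}"
      unfolding fstQ fstP using a ast by (auto simp: Suc_le_eq le_eq_less_or_eq)
    moreover have "Suc r \<le> j \<and> fits \<pi> i' j" if "(i', j) \<in> ?Q" for i' j
    proof -
      have j: "(i', j) \<in> P" "r \<le> j" "fits \<pi> i' j" using that fit by auto
      \<comment> \<open>Nested hooks have distinct ends, so \<open>(a, r)\<close> is the only hook
        ending at \<open>r\<close>.\<close>
      have "j \<noteq> r"
      proof
        assume "j = r"
        then have "i' \<noteq> a" using that by auto
        moreover have "i' < r" using j \<open>j = r\<close> by (auto simp: fits_def)
        ultimately show False
          using nest[OF j(1), of a r] nest[OF _ j(1), of a r] i ia ast \<open>j = r\<close> by (cases "i' < a") auto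
      qed
      then show ?thesis using j by auto
    qed
    moreover have "inj_on fst ?Q" using inj by (rule inj_on_subset) auto
    moreover have "nested ?Q" using nest unfolding nested_def by blast
    ultimately have "?Q \<in> completions \<pi> (Suc r) (set (?push st'))"
      by (auto simp: completions_def)
    with PQ have "P \<in> insert (a, r) ` completions \<pi> (Suc r) (set (?push st'))" by (rule image_eqI)
    moreover have "fits \<pi> a r" using ia ir by simp
    ultimately show "P \<in> (if st \<noteq> [] \<and> fits \<pi> (hd st) r then
           insert (hd st, r) ` completions \<pi> (Suc r) (set (?push (tl st))) else {})"
      by (simp only: a list.sel list.distinct not_False_eq_True simp_thms if_True)
  next
    assume R: "P \<in> (if st \<noteq> [] \<and> fits \<pi> (hd st) r then
           insert (hd st, r) ` completions \<pi> (Suc r) (set (?push (tl st))) else {})"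
    then obtain a st' where a: "st = a # st'" by (cases st) auto
    from R a obtain Q where PQ: "P = insert (a, r) Q" and ar: "fits \<pi> a r"
      and Q: "Q \<in> completions \<pi> (Suc r) (set (?push st'))"
      by (auto split: if_splits)
    have fstQ: "fst ` Q = set (?push st') \<union> {d \<in> descents \<pi>. Suc r \<le> d}" and inj: "inj_on fst Q"
      and fit: "\<And>i j. (i, j) \<in> Q \<Longrightarrow> Suc r \<le> j \<and> fits \<pi> i j"
      and nest: "nested Q"
      using Q unfolding completions_def by auto
    have ast: "a \<notin> set st'" "a < r" using st a by auto
    have "a \<notin> fst ` Q" unfolding fstQ using ast by auto
    then have "inj_on fst P" using inj PQ by (auto simp: inj_on_insert)
    moreover have "fst ` P = set st \<union> {d \<in> descents \<pi>. r \<le> d}"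
      unfolding PQ image_insert fstQ using a ast
      by (auto simp: Suc_le_eq le_eq_less_or_eq)
    moreover have "nested P"
    proof -
      \<comment> \<open>No hook of \<open>Q\<close> starts strictly between \<open>a\<close> and
        \<open>r\<close>, because \<open>a\<close> is the last open start, and none ends before
        \<open>Suc r\<close>. Hence each hook of \<open>Q\<close> either surrounds
        \<open>(a, r)\<close> or starts after it has ended.\<close>
      have Q1: "i < a \<or> r \<le> i" if "(i, j) \<in> Q" for i j
      proof -
        have "i \<in> fst ` Q" using that by force
        then show ?thesis unfolding fstQ using st a by (auto split: if_splits)
      qed
      have Q2: "Suc r \<le> j" if "(i, j) \<in> Q" for i j using fit that by auto
      have "j' < j \<or> j \<le> i'" if "(i, j) \<in> P" "(i', j') \<in> P" "i < i'" for i j i' j'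
      proof (cases "(i, j) \<in> Q \<and> (i', j') \<in> Q")
        case True
        then show ?thesis using nest \<open>i < i'\<close> unfolding nested_def by blast
      next
        case False
        then consider "i = a" "j = r" "(i', j') \<in> Q" | "i' = a" "j' = r" "(i, j) \<in> Q"
          using PQ \<open>(i, j) \<in> P\<close> \<open>(i', j') \<in> P\<close> \<open>i < i'\<close> by auto
        then show ?thesis
        proof cases
          case 1
          then show ?thesis using \<open>i < i'\<close> Q1[of i' j'] by simp
        next
          case 2
          then show ?thesis using Q2[of i j] by simp
        qed
      qed
      then show ?thesis unfolding nested_def by blast
    qed
    moreover have "\<forall>(i, j)\<in>P. r \<le> j \<and> fits \<pi> i j" using PQ ar fit by force
    ultimately show "P \<in> {P \<in> completions \<pi> r (set st). r \<in> snd ` P}"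
      using PQ unfolding completions_def by auto
  qed
qed

text \<open>If no hook ends at \<open>r\<close>, all open hooks span \<open>r\<close>, and the
  innermost is on top. The appended 0 yields the sky for an empty stack.\<close>

lemma color_top:
  assumes st: "\<forall>i\<in>set st. 1 \<le> i \<and> i < r" "sorted_wrt (>) st"
    and P: "P \<in> completions \<pi> r (set st)" "r \<notin> snd ` P"
  shows "color P r = hd (st @ [0])"
proof -
  have fstP: "fst ` P = set st \<union> {d \<in> descents \<pi>. r \<le> d}"
    and fit: "\<And>i j. (i, j) \<in> P \<Longrightarrow> r \<le> j" using P by (auto simp: completions_def)
  have "{i. \<exists>j. (i, j) \<in> P \<and> i < r \<and> r < j} = set st"
  proof (intro set_eqI iffI)
    fix i assume "i \<in> {i. \<exists>j. (i, j) \<in> P \<and> i < r \<and> r < j}"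
    then have "i \<in> fst ` P" "i < r" by force+
    then show "i \<in> set st" unfolding fstP by auto
  next
    fix i assume i: "i \<in> set st"
    then have "i \<in> fst ` P" unfolding fstP by auto
    then obtain j where j: "(i, j) \<in> P" by auto
    then have "r \<noteq> j" using P(2) by force
    then show "i \<in> {i. \<exists>j. (i, j) \<in> P \<and> i < r \<and> r < j}"
      using j fit[OF j] st(1) i by auto
  qed
  then have "color P r = Max (insert 0 (set st))" by (simp add: color_def)
  also have "\<dots> = hd (st @ [0])"
    using st by (cases st) (auto intro!: Max_eqI)
  finally show ?thesis .
qed

text \<open>Completions are split according to whether a hook ends at \<open>r\<close>. If none
  does, the point counts for the top color \<open>t\<close>; otherwise the top hook ends and
  contributes its final count \<open>c t\<close>. In both cases a descent at \<open>r\<close> then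
  opens a new hook.\<close>

lemma completion_types_step:
  assumes r: "1 \<le> r" "r \<le> length \<pi>"
    and st: "\<forall>i\<in>set st. 1 \<le> i \<and> i < r" "sorted_wrt (>) st"
  defines "push \<equiv> \<lambda>st. (if r \<in> descents \<pi> then [r] else []) @ st"
  shows "completion_types \<pi> r st c =
    (let t = hd (st @ [0]) in
       completion_types \<pi> (Suc r) (push st) (c(t := Suc (c t))) +
       (if st \<noteq> [] \<and> fits \<pi> t r
        then image_mset (add_mset (c t)) (completion_types \<pi> (Suc r) (push (tl st)) c)
        else {#}))"
proof -
  define t where "t = hd (st @ [0])"
  let ?T = "\<lambda>r c P. image_mset (\<lambda>i. c i + color_count \<pi> r P i) (mset_set (insert 0 (fst ` P)))"
  let ?C = "completions \<pi> r (set st)"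
  have "?C = {P \<in> ?C. r \<notin> snd ` P} \<union> {P \<in> ?C. r \<in> snd ` P}" by auto
  then have "mset_set ?C = mset_set {P \<in> ?C. r \<notin> snd ` P} + mset_set {P \<in> ?C. r \<in> snd ` P}"
    by (metis (mono_tags, lifting) mset_set_Union disjoint_iff finite_Un finite_completions mem_Collect_eq)
  then have split: "completion_types \<pi> r st c =
      image_mset (?T r c) (mset_set {P \<in> ?C. r \<notin> snd ` P}) +
      image_mset (?T r c) (mset_set {P \<in> ?C. r \<in> snd ` P})"
    by (simp add: completion_types_def)
  have T: "?T r c P = ?T (Suc r) (c(t := Suc (c t))) P" if "P \<in> {P \<in> ?C. r \<notin> snd ` P}" for P
  proof -
    have "color P r = t" using color_top[OF st] that t_def by auto
    then show ?thesis
      using that by (intro image_mset_cong) (auto simp: color_count_Suc[OF r(2)])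
  qed
  have "\<forall>i\<in>set st. i < r" using st(1) by blast
  note skip = completions_skip[OF this, of \<pi>]
  have 1: "image_mset (?T r c) (mset_set {P \<in> ?C. r \<notin> snd ` P}) =
      completion_types \<pi> (Suc r) (push st) (c(t := Suc (c t)))"
    unfolding completion_types_def push_def skip[symmetric]
    by (rule image_mset_cong, rule T) auto
  have 2: "image_mset (?T r c) (mset_set {P \<in> ?C. r \<in> snd ` P}) =
      (if st \<noteq> [] \<and> fits \<pi> t r
        then image_mset (add_mset (c t)) (completion_types \<pi> (Suc r) (push (tl st)) c)
        else {#})"
  proof (cases "st \<noteq> [] \<and> fits \<pi> t r")
    case False
    then have "{P \<in> ?C. r \<in> snd ` P} = {}"
      unfolding completions_close[OF st] by (auto simp: t_def)
    then show ?thesis using False by (simp only: if_False) simp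
  next
    case True
    let ?D = "completions \<pi> (Suc r) (set (push (tl st)))"
    have t: "t = hd st" "t \<in> set st" using True by (auto simp: t_def)
    then have tr: "t < r" "1 \<le> t" using st by auto
    have tt: "t \<notin> set (tl st)" using t st(2) True by (cases st) auto
    have tQ: "t \<notin> fst ` Q" if "Q \<in> ?D" for Q
      using that tr tt by (auto simp: completions_def push_def)
    have C: "{P \<in> ?C. r \<in> snd ` P} = insert (t, r) ` ?D"
      unfolding completions_close[OF st] push_def using True t by auto
    have inj: "inj_on (insert (t, r)) ?D"
      by (rule inj_onI) (metis tQ fst_conv image_eqI insert_ident)
    have T: "?T r c (insert (t, r) Q) = add_mset (c t) (?T (Suc r) c Q)" if Q: "Q \<in> ?D" for Q
    proof -
      have col: "color (insert (t, r) Q) q = color Q q" if "Suc r \<le> q" for q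
      proof -
        have "{i. \<exists>j. (i, j) \<in> insert (t, r) Q \<and> i < q \<and> q < j} = {i. \<exists>j. (i, j) \<in> Q \<and> i < q \<and> q < j}"
          using that by auto
        then show ?thesis by (simp add: color_def)
      qed
      have cc: "color_count \<pi> r (insert (t, r) Q) i = color_count \<pi> (Suc r) Q i" for i
      proof -
        have "color_count \<pi> r (insert (t, r) Q) i = color_count \<pi> (Suc r) (insert (t, r) Q) i"
          using color_count_Suc[OF r(2), of "insert (t, r) Q"] by simp
        also have "\<dots> = color_count \<pi> (Suc r) Q i"
          unfolding color_count_def by (rule arg_cong[of _ _ card]) (auto simp: col)
        finally show ?thesis .
      qed
      \<comment> \<open>A closed hook gains no later points, so its entry in the type is frozen at
        \<open>c t\<close>.\<close>
      have "color_count \<pi> (Suc r) Q t = 0"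
      proof -
        have "color Q q \<noteq> t" for q
        proof -
          have "finite {i. \<exists>j. (i, j) \<in> Q \<and> i < q \<and> q < j}"
            by (rule finite_subset[of _ "{..<q}"]) auto
          then have "color Q q \<in> insert 0 {i. \<exists>j. (i, j) \<in> Q \<and> i < q \<and> q < j}"
            unfolding color_def by (intro Max_in) auto
          also have "\<dots> \<subseteq> insert 0 (fst ` Q)" by force
          finally show ?thesis using tQ[OF Q] tr by auto
        qed
        then show ?thesis by (simp add: color_count_def)
      qed
      moreover have "finite (fst ` Q)" using completions_finite[OF Q] by simp
      moreover have "t \<notin> insert 0 (fst ` Q)" using tQ[OF Q] tr by auto
      ultimately show ?thesis
        by (simp add: cc insert_commute[of 0 t])
    qed
    have "image_mset (?T r c) (mset_set (insert (t, r) ` ?D)) =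
        image_mset (\<lambda>Q. ?T r c (insert (t, r) Q)) (mset_set ?D)"
      by (simp add: image_mset_mset_set[OF inj, symmetric] image_mset.compositionality o_def)
    also have "\<dots> = image_mset (\<lambda>Q. add_mset (c t) (?T (Suc r) c Q)) (mset_set ?D)"
      by (intro image_mset_cong T) simp
    also have "\<dots> = image_mset (add_mset (c t)) (completion_types \<pi> (Suc r) (push (tl st)) c)"
      by (simp add: completion_types_def image_mset.compositionality o_def)
    finally show ?thesis using True C by simp
  qed
  show ?thesis
    unfolding split 1 2 by (cases st) (simp_all add: Let_def t_def)
qed

text \<open>
  In \<open>scan\<close>, an open hook is represented by the maximum of the entries since its southwest endpoint,
  which decides whether it may be closed, and the number of points with its color so far. The sky is the
  bottom of the stack, with a first component that no entry exceeds.
\<close>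

definition push :: "nat \<Rightarrow> nat list \<Rightarrow> (nat \<times> nat) list \<Rightarrow> (nat \<times> nat) list" where
  "push x xs st = (if xs \<noteq> [] \<and> hd xs < x then (x, 0) # st else st)"

definition raise :: "nat \<Rightarrow> (nat \<times> nat) list \<Rightarrow> (nat \<times> nat) list" where
  "raise x st = map (\<lambda>(m, c). (max m x, c)) st"

fun scan :: "nat list \<Rightarrow> (nat \<times> nat) list \<Rightarrow> nat multiset multiset" where
  "scan [] st = (if length st = 1 then {#{#snd (hd st)#}#} else {#})"
| "scan (x # xs) st =
     scan xs (push x xs (raise x ((fst (hd st), Suc (snd (hd st))) # tl st))) +
     (if fst (hd st) < x
      then image_mset (add_mset (snd (hd st))) (scan xs (push x xs (raise x (tl st)))) else {#})"

text \<open>A hook from \<open>i\<close> may end at \<open>r\<close> exactly when the entry at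
  \<open>r\<close> exceeds the maximum over \<open>{i..<r}\<close>, so positions can be replaced by
  running maxima. The hypothesis on \<open>c\<close> matches the count 0 with which
  \<open>push\<close> opens a hook.\<close>

lemma completion_types_scan:
  assumes p: "is_perm \<pi>" and r: "1 \<le> r" "r \<le> Suc (length \<pi>)"
    and st: "\<forall>i\<in>set st. 1 \<le> i \<and> i < r" "sorted_wrt (>) st" and c: "\<forall>d\<ge>r. c d = 0"
  shows "completion_types \<pi> r st c =
    scan (drop (r - 1) \<pi>)
      (map (\<lambda>i. (Max (entry \<pi> ` {i..<r}), c i)) st @ [(Suc (length \<pi>), c 0)])"
  using r(2,1) st c
proof (induction r arbitrary: st c rule: inc_induct)
  case base
  show ?case by (auto simp: completion_types_end)
next
  case (step r)
  let ?n = "length \<pi>"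
  let ?f = "\<lambda>r c i. (Max (entry \<pi> ` {i..<r}), c i)"
  let ?s = "\<lambda>r c st. map (?f r c) st @ [(Suc ?n, c (0::nat))]"
  let ?x = "entry \<pi> r" and ?xs = "drop r \<pi>"
  let ?push = "\<lambda>st. (if r \<in> descents \<pi> then [r] else []) @ st"
  have r: "1 \<le> r" "r \<le> ?n" using step by auto
  have drop: "drop (r - 1) \<pi> = ?x # ?xs"
    using r by (simp add: entry_def Cons_nth_drop_Suc flip: Cons_nth_drop_Suc)
  have xn: "?x \<le> ?n"
    using bij_betw_apply[OF entry_bij[OF p], of r] r by auto
  have desc: "r \<in> descents \<pi> \<longleftrightarrow> ?xs \<noteq> [] \<and> hd ?xs < ?x"
    using r by (auto simp: descents_def entry_def hd_drop_conv_nth)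
  have raise: "raise ?x (?s r c st) = ?s (Suc r) c st"
    if "\<forall>i\<in>set st. 1 \<le> i \<and> i < r" for c st
  proof -
    have "Max (entry \<pi> ` {i..<Suc r}) = max (Max (entry \<pi> ` {i..<r})) ?x" if "i < r" for i
    proof -
      have "{i..<Suc r} = insert r {i..<r}" using that by auto
      then show ?thesis using that by (simp add: max.commute)
    qed
    then show ?thesis using that xn by (auto simp: raise_def)
  qed
  have psh: "push ?x ?xs (?s (Suc r) c st) = ?s (Suc r) c (?push st)" if "c r = 0" for c st
    using that by (simp add: push_def desc)
  have IH: "completion_types \<pi> (Suc r) (?push st) c = scan ?xs (push ?x ?xs (raise ?x (?s r c st)))"
    if st: "\<forall>i\<in>set st. 1 \<le> i \<and> i < r" "sorted_wrt (>) st" and c: "\<forall>d\<ge>r. c d = 0" for st c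
  proof -
    have "completion_types \<pi> (Suc r) (?push st) c = scan (drop (Suc r - 1) \<pi>) (?s (Suc r) c (?push st))"
    proof (rule step.IH)
      show "1 \<le> Suc r" by simp
      show "\<forall>i\<in>set (?push st). 1 \<le> i \<and> i < Suc r" using st r by auto
      show "sorted_wrt (>) (?push st)" using st by auto
      show "\<forall>d\<ge>Suc r. c d = 0" using c by auto
    qed
    then show ?thesis using c by (simp add: raise[OF st(1)] psh)
  qed
  define t where "t = hd (st @ [0])"
  have t: "t < r" using step.prems r by (cases st) (auto simp: t_def)
  have c': "\<forall>d\<ge>r. (c(t := Suc (c t))) d = 0" using step.prems t by auto
  have 1: "?s r (c(t := Suc (c t))) st = (fst (hd (?s r c st)), Suc (snd (hd (?s r c st)))) # tl (?s r c st)"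
    using step.prems by (cases st) (auto simp: t_def)
  have 2: "st \<noteq> [] \<and> fits \<pi> t r \<longleftrightarrow> fst (hd (?s r c st)) < ?x"
  proof (cases st)
    case Nil
    then show ?thesis using xn by simp
  next
    case (Cons a st')
    then have "t = a" "1 \<le> a" "a < r" using step.prems by (auto simp: t_def)
    then show ?thesis using Cons r by (auto simp: fits_def)
  qed
  have 3: "st \<noteq> [] \<Longrightarrow> tl (?s r c st) = ?s r c (tl st) \<and> snd (hd (?s r c st)) = c t"
    by (cases st) (auto simp: t_def)
  have tl: "\<forall>i\<in>set (tl st). 1 \<le> i \<and> i < r" "sorted_wrt (>) (tl st)"
    using step.prems by (cases st; auto)+
  have "completion_types \<pi> r st c =
      completion_types \<pi> (Suc r) (?push st) (c(t := Suc (c t))) +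
       (if st \<noteq> [] \<and> fits \<pi> t r
        then image_mset (add_mset (c t)) (completion_types \<pi> (Suc r) (?push (tl st)) c)
        else {#})"
    using completion_types_step[OF r step.prems(2,3)] unfolding Let_def t_def .
  also have "\<dots> = scan (?x # ?xs) (?s r c st)"
    unfolding IH[OF step.prems(2,3) c'] IH[OF tl step.prems(4)] scan.simps 1
    using 2 3 by auto
  finally show ?case unfolding drop .
qed

section \<open>Geometric hook configurations as nested sets of hooks\<close>

text \<open>Everything on the later hook has abscissa at least \<open>i' > i\<close>, so a common
  point lies on the horizontal segment of the earlier hook, at the height of \<open>j\<close>. If
  \<open>j' < j\<close>, the later hook stays strictly below that height; otherwise only
  \<open>j = i'\<close> is left.\<close>

lemma hook_paths_disjoint:
  assumes "fits \<pi> i j" "fits \<pi> i' j'" "i < i'" "j' < j \<or> j \<le> i'"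
  shows "hook_path \<pi> (i, j) \<inter> hook_path \<pi> (i', j') \<subseteq> {point \<pi> j} \<inter> {point \<pi> i'}"
proof
  fix z assume z: "z \<in> hook_path \<pi> (i, j) \<inter> hook_path \<pi> (i', j')"
  obtain x y where xy: "z = (x, y)" by (cases z)
  have ij: "i < j" "i' < j'" "entry \<pi> i < entry \<pi> j" "entry \<pi> i' < entry \<pi> j'"
    using assms by (auto simp: fits_def)
  have 1: "y \<le> entry \<pi> j'" "real i' \<le> x"
    using z xy ij by (auto simp: hook_path_def)
  then have 2: "y = entry \<pi> j" "x \<le> j"
    using z xy ij assms(3) by (auto simp: hook_path_def)
  have "\<not> j' < j"
  proof
    assume "j' < j"
    then have "entry \<pi> j' < entry \<pi> j"
      using assms ij by (simp add: fits_def)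
    then show False using 1 2 by simp
  qed
  then have "j \<le> i'" using assms by simp
  then have "j = i'" "x = j" using 1 2 by auto
  then show "z \<in> {point \<pi> j} \<inter> {point \<pi> i'}" using 2 xy by (auto simp: point_def)
qed

lemma valid_hook_configuration_iff:
  assumes p: "is_perm \<pi>"
  shows "valid_hook_configuration \<pi> H \<longleftrightarrow>
    map fst H = sorted_list_of_set (descents \<pi>) \<and> set H \<in> completions \<pi> 1 {}"
proof
  assume v: "valid_hook_configuration \<pi> H"
  then have fstH: "map fst H = sorted_list_of_set (descents \<pi>)"
    and hook: "\<And>i j. (i, j) \<in> set H \<Longrightarrow> is_hook \<pi> (i, j)"
    and below: "\<And>i j r. (i, j) \<in> set H \<Longrightarrow> i < r \<Longrightarrow> r < j \<Longrightarrow> \<not> entry \<pi> r > entry \<pi> j"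
    and cross: "\<And>u v. u < length H \<Longrightarrow> v < length H \<Longrightarrow> u \<noteq> v \<Longrightarrow>
        hook_path \<pi> (H ! u) \<inter> hook_path \<pi> (H ! v) \<subseteq>
          {point \<pi> (snd (H ! u))} \<inter> {point \<pi> (fst (H ! v))} \<union>
          {point \<pi> (fst (H ! u))} \<inter> {point \<pi> (snd (H ! v))}"
    unfolding valid_hook_configuration_def by blast+
  have dist: "distinct (map fst H)" unfolding fstH by simp
  have fit: "fits \<pi> i j" if h: "(i, j) \<in> set H" for i j
  proof -
    have ij: "1 \<le> i" "i < j" "j \<le> length \<pi>" "entry \<pi> i < entry \<pi> j"
      using hook[OF h] by (auto simp: is_hook_def)
    have "entry \<pi> q < entry \<pi> j" if q: "i \<le> q" "q < j" for q
    proof (cases "q = i")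
      case False
      then have "\<not> entry \<pi> q > entry \<pi> j" using below[OF h] q by auto
      moreover have "entry \<pi> q \<noteq> entry \<pi> j"
        using entry_inj[OF p, of q j] q ij by auto
      ultimately show ?thesis by auto
    qed (use ij in simp)
    then show ?thesis using ij by (auto simp: fits_def)
  qed
  have "j' < j \<or> j \<le> i'" if h: "(i, j) \<in> set H" "(i', j') \<in> set H" "i < i'" for i j i' j'
  proof (rule ccontr)
    assume neg: "\<not> (j' < j \<or> j \<le> i')"
    obtain u v where uv: "u < length H" "v < length H" "H ! u = (i, j)" "H ! v = (i', j')"
      using h by (metis in_set_conv_nth)
    have f: "fits \<pi> i j" "fits \<pi> i' j'" using fit h by auto
    \<comment> \<open>A violation means \<open>i < i' < j \<le> j'\<close>. Then the vertical
      segment at \<open>i'\<close> reaches the height of \<open>j\<close> and crosses the horizontal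
      segment of the earlier hook.\<close>
    have "entry \<pi> j \<le> entry \<pi> j'"
      using f neg by (cases "j = j'") (auto simp: fits_def intro: less_imp_le)
    moreover have "entry \<pi> i' < entry \<pi> j" using f neg h(3) by (auto simp: fits_def)
    ultimately have "(real i', real (entry \<pi> j)) \<in> hook_path \<pi> (i, j) \<inter> hook_path \<pi> (i', j')"
      using neg h(3) by (auto simp: hook_path_def)
    moreover have "u \<noteq> v" using uv h(3) by auto
    ultimately show False using cross[OF uv(1,2)] uv h(3) neg by (auto simp: point_def)
  qed
  then have "nested (set H)" by (auto simp: nested_def)
  moreover have "fst ` set H = descents \<pi>" using fstH by (metis finite_descents set_map set_sorted_list_of_set)
  moreover have "inj_on fst (set H)" using dist by (simp add: distinct_map)
  moreover have "{d \<in> descents \<pi>. 1 \<le> d} = descents \<pi>" by (auto simp: descents_def)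
  moreover have "1 \<le> j \<and> fits \<pi> i j" if "(i, j) \<in> set H" for i j
    using fit[OF that] by (simp add: fits_def)
  then have "\<forall>(i, j)\<in>set H. 1 \<le> j \<and> fits \<pi> i j" by blast
  ultimately show "map fst H = sorted_list_of_set (descents \<pi>) \<and> set H \<in> completions \<pi> 1 {}"
    using fstH by (simp add: completions_def)
next
  assume R: "map fst H = sorted_list_of_set (descents \<pi>) \<and> set H \<in> completions \<pi> 1 {}"
  then have fstH: "map fst H = sorted_list_of_set (descents \<pi>)"
    and fit: "\<And>i j. (i, j) \<in> set H \<Longrightarrow> fits \<pi> i j"
    and nest: "\<And>i j i' j'. (i, j) \<in> set H \<Longrightarrow> (i', j') \<in> set H \<Longrightarrow> i < i' \<Longrightarrow> j' < j \<or> j \<le> i'"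
    unfolding completions_def nested_def by blast+
  have dist: "distinct (map fst H)" unfolding fstH by simp
  have hook: "is_hook \<pi> h" if "h \<in> set H" for h
    using fit[of "fst h" "snd h"] that by (auto simp: is_hook_def fits_def split: prod.splits)
  have below: "\<not> entry \<pi> r > entry \<pi> j" if "(i, j) \<in> set H" "i < r" "r < j" for i j r
    using fit[OF that(1)] that by (auto simp: fits_def dest!: spec[of _ r])
  have cross: "hook_path \<pi> (H ! u) \<inter> hook_path \<pi> (H ! v) \<subseteq>
          {point \<pi> (snd (H ! u))} \<inter> {point \<pi> (fst (H ! v))} \<union>
          {point \<pi> (fst (H ! u))} \<inter> {point \<pi> (snd (H ! v))}"
    if uv: "u < length H" "v < length H" "u \<noteq> v" for u v
  proof -
    obtain i j i' j' where h: "H ! u = (i, j)" "H ! v = (i', j')" by (metis surj_pair)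
    then have H: "(i, j) \<in> set H" "(i', j') \<in> set H" using uv by (metis nth_mem)+
    have "i \<noteq> i'" using dist uv h nth_eq_iff_index_eq[OF dist, of u v] by auto
    then consider "i < i'" | "i' < i" by linarith
    then show ?thesis
    proof cases
      case 1
      then show ?thesis
        using hook_paths_disjoint[OF fit[OF H(1)] fit[OF H(2)] 1 nest[OF H 1]] h by auto
    next
      case 2
      then show ?thesis
        using hook_paths_disjoint[OF fit[OF H(2)] fit[OF H(1)] 2 nest[OF H(2,1) 2]] h by auto
    qed
  qed
  show "valid_hook_configuration \<pi> H"
    unfolding valid_hook_configuration_def using hook fstH below cross by auto
qed

text \<open>Among nested hooks spanning \<open>r\<close>, the one that starts last ends first, and
  by \<open>fits\<close> an earlier end is lower. So the lowest horizontal segment belongs to the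
  largest start, which is what \<open>color\<close> selects. The prepended 0 stands for the
  sky.\<close>

lemma has_color_iff:
  assumes P: "set H \<in> completions \<pi> 1 {}" and u: "u \<le> length H"
  shows "has_color \<pi> H r u \<longleftrightarrow> color (set H) r = (0 # map fst H) ! u"
proof -
  have inj: "inj_on fst (set H)" and fit: "\<And>i j. (i, j) \<in> set H \<Longrightarrow> fits \<pi> i j"
    and nest: "\<And>i j i' j'. (i, j) \<in> set H \<Longrightarrow> (i', j') \<in> set H \<Longrightarrow> i < i' \<Longrightarrow> j' < j \<or> j \<le> i'"
    using P unfolding completions_def nested_def by blast+
  let ?S = "{i. \<exists>j. (i, j) \<in> set H \<and> i < r \<and> r < j}"
  have fin: "finite ?S" by (rule finite_subset[of _ "{..<r}"]) auto
  have pos: "1 \<le> i" if "(i, j) \<in> set H" for i j using fit[OF that] by (simp add: fits_def)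
  show ?thesis
  proof (cases u)
    case 0
    have "has_color \<pi> H r u \<longleftrightarrow> ?S = {}"
      using 0 by (auto simp: has_color_def hook_spans_def)
    also have "\<dots> \<longleftrightarrow> color (set H) r = 0"
    proof
      assume "color (set H) r = 0"
      then have "Max (insert 0 ?S) = 0" by (simp add: color_def)
      then have "i \<le> 0" if "i \<in> ?S" for i
        using Max_ge[of "insert 0 ?S" i] fin that by simp
      then show "?S = {}" using pos by fastforce
    next
      assume "?S = {}"
      then show "color (set H) r = 0" by (simp only: color_def) simp
    qed
    finally show ?thesis using 0 by simp
  next
    case (Suc w)
    obtain i j where h: "H ! w = (i, j)" by (cases "H ! w")
    then have ij: "(i, j) \<in> set H" using u Suc by (metis Suc_le_lessD nth_mem)
    have "color (set H) r = i \<longleftrightarrow> i < r \<and> r < j \<and> (\<forall>i'\<in>?S. i' \<le> i)"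
    proof
      assume c: "color (set H) r = i"
      then have "i \<in> insert 0 ?S" using Max_in[of "insert 0 ?S"] fin by (simp add: color_def)
      then have "i \<in> ?S" using pos[OF ij] by auto
      then obtain j' where j': "(i, j') \<in> set H" "i < r" "r < j'" by auto
      then have "j' = j" using inj_onD[OF inj _ j'(1) ij] by simp
      moreover have "\<forall>i'\<in>?S. i' \<le> i"
        using c Max_ge[of "insert 0 ?S"] fin by (auto simp: color_def)
      ultimately show "i < r \<and> r < j \<and> (\<forall>i'\<in>?S. i' \<le> i)" using j' by auto
    next
      assume "i < r \<and> r < j \<and> (\<forall>i'\<in>?S. i' \<le> i)"
      then show "color (set H) r = i"
        unfolding color_def using ij fin by (intro Max_eqI) auto
    qed
    also have "\<dots> \<longleftrightarrow> i < r \<and> r < j \<and> (\<forall>h\<in>set H. hook_spans h r \<longrightarrow> entry \<pi> j \<le> entry \<pi> (snd h))"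
    proof (intro conj_cong refl iffI ballI impI)
      fix h assume b: "i < r" "r < j" "\<forall>i'\<in>?S. i' \<le> i" "h \<in> set H" "hook_spans h r"
      obtain i' j' where h': "h = (i', j')" by (cases h)
      then have i'j': "(i', j') \<in> set H" "i' < r" "r < j'" using b by (auto simp: hook_spans_def)
      then have "i' \<le> i" using b by auto
      then consider "i' = i" | "i' < i" by linarith
      then show "entry \<pi> j \<le> entry \<pi> (snd h)"
      proof cases
        case 1
        then show ?thesis using inj_onD[OF inj _ i'j'(1) ij] h' by simp
      next
        case 2
        then have "j < j'" using nest[OF i'j'(1) ij 2] b i'j' by auto
        then show ?thesis using fit[OF i'j'(1)] b i'j' h' by (auto simp: fits_def intro: less_imp_le)
      qed
    next
      fix i' assume b: "i < r" "r < j" "i' \<in> ?S"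
        "\<forall>h\<in>set H. hook_spans h r \<longrightarrow> entry \<pi> j \<le> entry \<pi> (snd h)"
      then obtain j' where j': "(i', j') \<in> set H" "i' < r" "r < j'" by auto
      show "i' \<le> i"
      proof (rule ccontr)
        assume "\<not> i' \<le> i"
        then have "j' < j" using nest[OF ij j'(1)] b j' by auto
        then have "entry \<pi> j' < entry \<pi> j" using fit[OF ij] b j' by (auto simp: fits_def)
        moreover have "entry \<pi> j \<le> entry \<pi> j'" using b(4) j' by (force simp: hook_spans_def)
        ultimately show False by simp
      qed
    qed
    also have "\<dots> \<longleftrightarrow> has_color \<pi> H r u"
      using u Suc h by (auto simp: has_color_def hook_spans_def)
    finally show ?thesis using Suc h u by auto
  qed
qed

text \<open>The order of the tuple is forced by the descents, so a configuration is determined by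
  its set of hooks, and these sets are the completions from position 1 with an empty stack. The scan
  therefore starts with the sky alone, with count 0.\<close>

lemma VHC_types:
  assumes p: "is_perm \<pi>"
  shows "image_mset (\<lambda>H. mset (induced_composition (\<pi>, H))) (mset_set {H. valid_hook_configuration \<pi> H}) =
    scan \<pi> [(Suc (length \<pi>), 0)]"
    and "finite {H. valid_hook_configuration \<pi> H}"
proof -
  let ?V = "{H. valid_hook_configuration \<pi> H}" and ?D = "descents \<pi>"
  let ?C = "completions \<pi> 1 {}"
  have "{d \<in> ?D. 1 \<le> d} = ?D" by (auto simp: descents_def)
  then have fstP: "fst ` P = ?D" "inj_on fst P" if "P \<in> ?C" for P
    using that by (auto simp: completions_def)
  have inj: "inj_on set ?V"
  proof (rule inj_onI)
    fix H H' assume H: "H \<in> ?V" "H' \<in> ?V" and eq: "set H = set H'"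
    then have f: "map fst H = map fst H'" and "set H \<in> ?C"
      using valid_hook_configuration_iff[OF p] by auto
    then have "inj_on fst (set H \<union> set H')" using fstP(2) eq by auto
    then show "H = H'" using f by (rule map_inj_on[rotated])
  qed
  have img: "set ` ?V = ?C"
  proof (intro set_eqI iffI)
    fix P assume P: "P \<in> ?C"
    \<comment> \<open>The tuple is recovered by listing, for each descent in order, the unique hook
      of \<open>P\<close> that starts there.\<close>
    let ?H = "map (inv_into P fst) (sorted_list_of_set ?D)"
    have "set ?H = P"
      using inv_into_image_cancel[OF fstP(2)[OF P] subset_refl] fstP(1)[OF P] by simp
    moreover have "fst (inv_into P fst d) = d" if "d \<in> ?D" for d
      by (rule f_inv_into_f) (simp only: fstP(1)[OF P] that)
    then have "map fst ?H = sorted_list_of_set ?D"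
      unfolding map_map by (intro map_idI) simp
    ultimately show "P \<in> set ` ?V"
      using P valid_hook_configuration_iff[OF p, of ?H] by (metis image_eqI mem_Collect_eq)
  qed (auto simp: valid_hook_configuration_iff[OF p])
  show "finite ?V" using img inj by (metis finite_completions finite_imageD)
  have ty: "mset (induced_composition (\<pi>, H)) =
      image_mset (\<lambda>i. 0 + color_count \<pi> 1 (set H) i) (mset_set (insert 0 (fst ` set H)))"
    if "H \<in> ?V" for H
  proof -
    have H: "map fst H = sorted_list_of_set ?D" "set H \<in> ?C"
      using that valid_hook_configuration_iff[OF p] by auto
    have "induced_composition (\<pi>, H) = map (color_count \<pi> 1 (set H)) (0 # map fst H)"
    proof (rule nth_equalityI)
      show "length (induced_composition (\<pi>, H)) = length (map (color_count \<pi> 1 (set H)) (0 # map fst H))"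
        by (simp add: induced_composition_def)
      fix u assume "u < length (induced_composition (\<pi>, H))"
      then have u: "u \<le> length H" by (simp add: induced_composition_def)
      then have "induced_composition (\<pi>, H) ! u = color_count \<pi> 1 (set H) ((0 # map fst H) ! u)"
        using has_color_iff[OF H(2) u]
        by (simp add: induced_composition_def color_count_def nth_append del: upt_Suc)
      then show "induced_composition (\<pi>, H) ! u = map (color_count \<pi> 1 (set H)) (0 # map fst H) ! u"
        using u by (subst nth_map) auto
    qed
    moreover have "distinct (0 # map fst H)" unfolding H by (auto simp: descents_def)
    then have "mset (0 # map fst H) = mset_set (set (0 # map fst H))"
      by (metis mset_set_set)
    ultimately show ?thesis
      by (metis (no_types, lifting) add_0 image_mset_cong list.set_map list.simps(15) mset_map)
  qed
  have "image_mset (\<lambda>H. mset (induced_composition (\<pi>, H))) (mset_set ?V) =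
      image_mset (\<lambda>H. image_mset (\<lambda>i. 0 + color_count \<pi> 1 (set H) i) (mset_set (insert 0 (fst ` set H)))) (mset_set ?V)"
    by (intro image_mset_cong ty) (metis \<open>finite ?V\<close> elem_mset_set)
  also have "\<dots> = completion_types \<pi> 1 [] (\<lambda>_. 0)"
    unfolding completion_types_def list.set img[symmetric] image_mset_mset_set[OF inj, symmetric]
    by (simp add: image_mset.compositionality o_def)
  also have "\<dots> = scan \<pi> [(Suc (length \<pi>), 0)]"
    using completion_types_scan[OF p, of 1 "[]" "\<lambda>_. 0"] by simp
  finally show "image_mset (\<lambda>H. mset (induced_composition (\<pi>, H))) (mset_set ?V) = scan \<pi> [(Suc (length \<pi>), 0)]" .
qed

section \<open>The two families of permutations\<close>

definition decreasing :: "nat \<Rightarrow> perm" where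
  "decreasing k = rev [1..<Suc k]"

text \<open>
  The members of both classes are built from \<open>[1]\<close> by adding points. The latest step is the
  head of the list of steps.
\<close>

fun perm132 :: "step list \<Rightarrow> perm" where
  "perm132 [] = [1]"
| "perm132 (Low # s) = skew_sum (perm132 s) [1]"
| "perm132 (High k # s) = skew_sum (decreasing k) (direct_sum (perm132 s) [1])"

fun perm312 :: "step list \<Rightarrow> perm" where
  "perm312 [] = [1]"
| "perm312 (Low # s) = skew_sum (perm312 s) [1]"
| "perm312 (High k # s) = direct_sum (perm312 s) (decreasing (Suc k))"

lemma is_perm_direct_sum: "is_perm \<alpha> \<Longrightarrow> is_perm \<beta> \<Longrightarrow> is_perm (direct_sum \<alpha> \<beta>)"
proof -
  assume p: "is_perm \<alpha>" "is_perm \<beta>"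
  have "set (map (\<lambda>x. x + length \<alpha>) \<beta>) = {length \<alpha> + 1..length \<alpha> + length \<beta>}"
    using p image_add_atLeastAtMost[of "length \<alpha>" 1 "length \<beta>"] by (simp add: is_perm_iff add.commute)
  then show ?thesis
    using p by (auto simp: is_perm_iff direct_sum_def distinct_map inj_on_def)
qed

lemma is_perm_skew_sum: "is_perm \<alpha> \<Longrightarrow> is_perm \<beta> \<Longrightarrow> is_perm (skew_sum \<alpha> \<beta>)"
proof -
  assume p: "is_perm \<alpha>" "is_perm \<beta>"
  have "set (map (\<lambda>x. x + length \<beta>) \<alpha>) = {length \<beta> + 1..length \<alpha> + length \<beta>}"
    using p image_add_atLeastAtMost[of "length \<beta>" 1 "length \<alpha>"] by (simp add: is_perm_iff add.commute)
  then show ?thesis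
    using p by (auto simp: is_perm_iff skew_sum_def distinct_map inj_on_def)
qed

lemma length_decreasing [simp]: "length (decreasing k) = k"
  by (simp add: decreasing_def)

lemma is_perm_decreasing: "is_perm (decreasing k)"
  by (auto simp: decreasing_def is_perm_iff)

lemma sorted_decreasing: "sorted_wrt (>) (decreasing k)"
  by (simp add: decreasing_def sorted_wrt_rev del: upt_Suc)

lemma is_perm_single: "is_perm [1]"
  by (auto simp: is_perm_iff)

lemma is_perm_perm132: "is_perm (perm132 s)"
  by (induction s rule: perm132.induct)
     (auto intro!: is_perm_skew_sum is_perm_direct_sum is_perm_decreasing is_perm_single simp del: One_nat_def)

lemma is_perm_perm312: "is_perm (perm312 s)"
  by (induction s rule: perm312.induct)
     (auto intro!: is_perm_skew_sum is_perm_direct_sum is_perm_decreasing is_perm_single simp del: One_nat_def)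

text \<open>
  \<open>grows1 X us ws ys\<close>: the entries \<open>ys\<close> are added by the steps \<open>ws\<close> to the right of points with heights in
  \<open>X\<close>. The list \<open>us\<close> contains the points that these same steps add on the far left, nearest first; they
  are already on the stack of the scan, but none of their hooks may be closed before the step that
  adds them.
\<close>

inductive grows1 :: "nat set \<Rightarrow> nat list \<Rightarrow> step list \<Rightarrow> nat list \<Rightarrow> bool" where
  "grows1 X [] [] []"
| "\<forall>x\<in>X \<union> set us. v < x \<Longrightarrow> grows1 (insert v X) us ws ys \<Longrightarrow> grows1 X us (Low # ws) (v # ys)"
| "length us = k \<Longrightarrow> \<forall>x\<in>X. x < b \<Longrightarrow> \<forall>x\<in>set us \<union> set us'. b < x \<Longrightarrow>
   grows1 (insert b (X \<union> set us)) us' ws ys \<Longrightarrow> grows1 X (us @ us') (High k # ws) (b # ys)"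

text \<open>Nothing is added on the left here, so no pending list is carried. The entries
  \<open>b # bs\<close> are the whole decreasing block of \<open>k + 1\<close> points.\<close>

inductive grows2 :: "nat set \<Rightarrow> step list \<Rightarrow> nat list \<Rightarrow> bool" where
  "grows2 X [] []"
| "\<forall>x\<in>X. v < x \<Longrightarrow> grows2 (insert v X) ws ys \<Longrightarrow> grows2 X (Low # ws) (v # ys)"
| "length bs = k \<Longrightarrow> sorted_wrt (>) (b # bs) \<Longrightarrow> \<forall>x\<in>X. \<forall>y\<in>set (b # bs). x < y \<Longrightarrow>
   grows2 (X \<union> set (b # bs)) ws ys \<Longrightarrow> grows2 X (High k # ws) (b # bs @ ys)"


text \<open>The recursion of \<open>perm132\<close> adds its newest step outermost, while the scan
  reads the oldest step first. The rules consume a word from its front, so extension at the back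
  needs lemmas of its own. In \<open>grows1_High\<close> the pending points \<open>vs\<close> go to
  the end of \<open>us\<close>, being the farthest to the left.\<close>

lemma grows1_Low:
  "grows1 X us ws ys \<Longrightarrow> \<forall>x\<in>X \<union> set us \<union> set ys. v < x \<Longrightarrow> grows1 X us (ws @ [Low]) (ys @ [v])"
  by (induction rule: grows1.induct) (auto intro!: grows1.intros)

lemma grows1_High:
  "grows1 X us ws ys \<Longrightarrow> \<forall>x\<in>X \<union> set us \<union> set ys. x < b \<Longrightarrow> \<forall>x\<in>set vs. b < x \<Longrightarrow>
   grows1 X (us @ vs) (ws @ [High (length vs)]) (ys @ [b])"
proof (induction rule: grows1.induct)
  case (1 X)
  have "grows1 X (vs @ []) (High (length vs) # []) (b # [])"
    using 1 by (intro grows1.intros) auto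
  then show ?case by simp
next
  case (2 X us v ws ys)
  then have "v < b" by auto
  then have "\<forall>x\<in>set vs. v < x" using "2.prems"(2) by fastforce
  with 2 show ?case by (auto intro!: grows1.intros)
next
  case (3 us k X b' us' ws ys)
  then have "b' < b" by auto
  with 3 have "\<forall>x\<in>set us \<union> set (us' @ vs). b' < x" by fastforce
  moreover have "grows1 (insert b' (X \<union> set us)) (us' @ vs) (ws @ [High (length vs)]) (ys @ [b])"
    using 3 by auto
  ultimately have "grows1 X (us @ (us' @ vs)) (High k # (ws @ [High (length vs)])) (b' # (ys @ [b]))"
    using 3 by (intro grows1.intros) auto
  then show ?case by simp
qed

lemma grows1_map:
  "grows1 X us ws ys \<Longrightarrow> strict_mono f \<Longrightarrow> grows1 (f ` X) (map f us) ws (map f ys)"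
proof (induction rule: grows1.induct)
  case (3 us k X b us' ws ys)
  then have "grows1 (f ` X) (map f us @ map f us') (High k # ws) (f b # map f ys)"
    by (intro grows1.intros) (auto simp: strict_mono_less image_Un)
  then show ?case by simp
qed (auto intro!: grows1.intros simp: strict_mono_less)

lemma grows2_Low:
  "grows2 X ws ys \<Longrightarrow> \<forall>x\<in>X \<union> set ys. v < x \<Longrightarrow> grows2 X (ws @ [Low]) (ys @ [v])"
proof (induction rule: grows2.induct)
  case (3 bs k b X ws ys)
  then have "grows2 (X \<union> set (b # bs)) (ws @ [Low]) (ys @ [v])" by auto
  then have "grows2 X (High k # (ws @ [Low])) (b # bs @ (ys @ [v]))"
    by (rule grows2.intros(3)[OF 3(1-3)])
  then show ?case by simp
qed (auto intro!: grows2.intros)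

lemma grows2_High:
  "grows2 X ws ys \<Longrightarrow> \<forall>x\<in>X \<union> set ys. \<forall>y\<in>set (c # cs). x < y \<Longrightarrow> sorted_wrt (>) (c # cs) \<Longrightarrow>
   grows2 X (ws @ [High (length cs)]) (ys @ c # cs)"
proof (induction rule: grows2.induct)
  case (1 X)
  have "grows2 X (High (length cs) # []) (c # cs @ [])"
    using 1 by (intro grows2.intros) auto
  then show ?case by simp
next
  case (2 X v ws ys)
  then show ?case by (auto intro!: grows2.intros)
next
  case (3 bs k b X ws ys)
  then have "grows2 (X \<union> set (b # bs)) (ws @ [High (length cs)]) (ys @ c # cs)" by auto
  then have "grows2 X (High k # (ws @ [High (length cs)])) (b # bs @ (ys @ c # cs))"
    by (rule grows2.intros(3)[OF 3(1-3)])
  then show ?case by simp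
qed

lemma grows2_map:
  "grows2 X ws ys \<Longrightarrow> strict_mono f \<Longrightarrow> grows2 (f ` X) ws (map f ys)"
proof (induction rule: grows2.induct)
  case (3 bs k b X ws ys)
  then have "grows2 (f ` X) (High k # ws) (f b # map f bs @ map f ys)"
    by (intro grows2.intros) (auto simp: strict_mono_less image_Un sorted_wrt_map)
  then show ?case by simp
qed (auto intro!: grows2.intros simp: strict_mono_less)

lemma strict_mono_shift: "strict_mono (\<lambda>x. x + n :: nat)"
  by (simp add: strict_mono_def)

text \<open>Here \<open>z\<close> is the point of the empty word. Only the decreasing runs of
  \<open>High\<close> steps stand to its left, each above and left of the earlier ones, so this part
  decreases down to \<open>z\<close>.\<close>

lemma perm132_grows:
  "\<exists>us z ys. perm132 s = rev us @ z # ys \<and> sorted_wrt (<) (z # us) \<and> grows1 {z} us (rev s) ys"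
proof (induction s rule: perm132.induct)
  case 1
  have "perm132 [] = rev [] @ 1 # [] \<and> sorted_wrt (<) [1::nat] \<and> grows1 {1} [] (rev []) []"
    by (auto intro: grows1.intros)
  then show ?case by blast
next
  case (2 s)
  then obtain us z ys where s: "perm132 s = rev us @ z # ys" "sorted_wrt (<) (z # us)"
    "grows1 {z} us (rev s) ys" by blast
  let ?f = "\<lambda>x. x + 1 :: nat"
  have pos: "0 < x" if "x \<in> set (rev us @ z # ys)" for x
    using is_perm_perm132[of s] that unfolding s(1) is_perm_iff by auto
  have "perm132 (Low # s) = rev (map ?f us) @ ?f z # (map ?f ys @ [1])"
    by (simp add: s skew_sum_def rev_map)
  moreover have "sorted_wrt (<) (?f z # map ?f us)" using s by (auto simp: sorted_wrt_map)
  moreover have "grows1 {?f z} (map ?f us) (rev (Low # s)) (map ?f ys @ [1])"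
    using grows1_Low[OF grows1_map[OF s(3) strict_mono_shift[of 1]], of 1] pos by auto
  ultimately show ?case by blast
next
  case (3 k s)
  then obtain us z ys where s: "perm132 s = rev us @ z # ys" "sorted_wrt (<) (z # us)"
    "grows1 {z} us (rev s) ys" by blast
  let ?n = "length (perm132 s)"
  let ?vs = "rev (map (\<lambda>x. x + Suc ?n) (decreasing k))"
  have le: "x \<le> ?n" if "x \<in> set (rev us @ z # ys)" for x
    using is_perm_perm132[of s] that unfolding s(1)[symmetric] is_perm_iff by auto
  have vs: "Suc ?n < x" if "x \<in> set ?vs" for x
    using that by (auto simp: decreasing_def)
  have "perm132 (High k # s) = rev (us @ ?vs) @ z # (ys @ [Suc ?n])"
    by (simp add: s(1) skew_sum_def direct_sum_def)
  moreover have "sorted_wrt (<) ?vs"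
    using sorted_decreasing[of k] by (simp add: sorted_wrt_rev sorted_wrt_map)
  then have "sorted_wrt (<) (z # us @ ?vs)"
    using s(2) le vs by (fastforce simp: sorted_wrt_append)
  moreover have "grows1 {z} (us @ ?vs) (rev (High k # s)) (ys @ [Suc ?n])"
    using grows1_High[OF s(3), of "Suc ?n" ?vs] le vs by (fastforce simp: less_Suc_eq_le)
  ultimately show ?case by blast
qed

lemma perm312_grows: "\<exists>z ys. perm312 s = z # ys \<and> grows2 {z} (rev s) ys"
proof (induction s rule: perm312.induct)
  case 1
  then show ?case by (auto intro: grows2.intros)
next
  case (2 s)
  then obtain z ys where s: "perm312 s = z # ys" "grows2 {z} (rev s) ys" by blast
  let ?f = "\<lambda>x. x + 1 :: nat"
  have pos: "0 < x" if "x \<in> set (z # ys)" for x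
    using is_perm_perm312[of s] that unfolding s(1) is_perm_iff by auto
  have "perm312 (Low # s) = ?f z # (map ?f ys @ [1])" by (simp add: s skew_sum_def)
  moreover have "grows2 {?f z} (rev (Low # s)) (map ?f ys @ [1])"
    using grows2_Low[OF grows2_map[OF s(2) strict_mono_shift[of 1]], of 1] pos by auto
  ultimately show ?case by blast
next
  case (3 k s)
  then obtain z ys where s: "perm312 s = z # ys" "grows2 {z} (rev s) ys" by blast
  let ?n = "length (perm312 s)"
  obtain c cs where c: "map (\<lambda>x. x + ?n) (decreasing (Suc k)) = c # cs"
    by (cases "map (\<lambda>x. x + ?n) (decreasing (Suc k))") (auto simp: decreasing_def)
  then have len: "length cs = k" by (metis length_map length_decreasing length_Cons Suc_inject)
  have le: "x \<le> ?n" if "x \<in> set (z # ys)" for x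
    using is_perm_perm312[of s] that unfolding s(1)[symmetric] is_perm_iff by auto
  have gt: "?n < x" if "x \<in> set (c # cs)" for x
    using that unfolding c[symmetric] by (auto simp: decreasing_def)
  have "sorted_wrt (>) (c # cs)"
    unfolding c[symmetric] using sorted_decreasing[of "Suc k"] by (simp add: sorted_wrt_map)
  moreover have "x < y" if "x \<in> {z} \<union> set ys" "y \<in> set (c # cs)" for x y
    using le[of x] gt[of y] that by auto
  then have "\<forall>x\<in>{z} \<union> set ys. \<forall>y\<in>set (c # cs). x < y" by blast
  ultimately have "grows2 {z} (rev (High k # s)) (ys @ c # cs)"
    using grows2_High[OF s(2), of c cs] len by simp
  moreover have "perm312 (High k # s) = z # (ys @ c # cs)"
    by (simp add: s(1)[symmetric] direct_sum_def c del: append_Cons)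
  ultimately show ?case by blast
qed

section \<open>Evaluating the scan on the two families\<close>

lemma push_Nil [simp]: "push x [] st = st"
  by (simp add: push_def)

lemma push_Cons [simp]: "push x (y # xs) st = (if y < x then (x, 0) # st else st)"
  by (simp add: push_def)

lemma raise_ge: "\<forall>t\<in>set st. x \<le> fst t \<Longrightarrow> raise x st = st"
  by (induction st) (auto simp: raise_def max_absorb1)

lemma raise_append: "raise x (st @ st') = raise x st @ raise x st'"
  by (simp add: raise_def)

lemma raise_le: "\<forall>t\<in>set st. fst t \<le> x \<Longrightarrow> raise x st = map (\<lambda>t. (x, snd t)) st"
  by (induction st) (auto simp: raise_def max_absorb2)

text \<open>No running maximum on the stack is exceeded along a decreasing run, so nothing closes.
  Every entry but the last opens a hook, which counts exactly its successor; whether the last entry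
  opens one depends on \<open>ys\<close> and is left to \<open>push\<close>.\<close>

lemma scan_decreasing:
  "sorted_wrt (>) (b # bs) \<Longrightarrow> \<forall>t\<in>set st. b \<le> fst t \<Longrightarrow>
   scan (bs @ ys) (push b (bs @ ys) st) =
   scan ys (push (last (b # bs)) ys (rev (map (\<lambda>x. (x, 1)) (butlast (b # bs))) @ st))"
proof (induction bs arbitrary: b st)
  case Nil
  then show ?case by simp
next
  case (Cons c bs)
  then have cb: "c < b" by simp
  then have r: "raise c ((b, 1) # st) = (b, 1) # st"
    using Cons.prems by (intro raise_ge) auto
  have "scan ((c # bs) @ ys) (push b ((c # bs) @ ys) st) = scan (bs @ ys) (push c (bs @ ys) ((b, 1) # st))"
    using cb r by simp
  also have "\<dots> = scan ys (push (last (c # bs)) ys (rev (map (\<lambda>x. (x, 1)) (butlast (c # bs))) @ ((b, 1) # st)))"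
    using Cons.prems by (intro Cons.IH) auto
  finally show ?case by simp
qed

text \<open>The running maxima in \<open>st\<close> belong to \<open>X\<close>, above every
  \<open>Low\<close> point to come and below every \<open>High\<close> point to come. All
  comparisons are thus decided by the kind of the step, and only the counts remain. The sky
  \<open>(m, c)\<close> is kept apart because it never closes.\<close>

lemma scan_grows2:
  assumes "grows2 X ws ys" "z \<in> X" "\<forall>t\<in>set st. fst t \<in> X" "\<forall>x\<in>X \<union> set ys. x \<le> m"
  shows "scan ys (push z ys (st @ [(m, c)])) = runs ws (map snd st @ [c])"
  using assms
proof (induction arbitrary: z st c rule: grows2.induct)
  case (1 X)
  then show ?case by (cases st) auto
next
  case (2 X v ws ys)
  have vz: "v < z" using 2 by auto
  have vm: "v \<le> m" using "2.prems"(3) by simp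
  have stv: "v < fst t" if "t \<in> set st" for t using 2(1) "2.prems"(2) that by blast
  have r: "raise v ((z, 1) # st @ [(m, c)]) = (z, 1) # st @ [(m, c)]"
    by (rule raise_ge) (use stv vz vm in \<open>auto intro: less_imp_le\<close>)
  have "scan (v # ys) (push z (v # ys) (st @ [(m, c)])) = scan ys (push v ys (((z, 1) # st) @ [(m, c)]))"
    using vz r by simp
  also have "\<dots> = runs ws (map snd ((z, 1) # st) @ [c])"
    using 2 by (intro "2.IH") auto
  finally show ?case by simp
next
  case (3 bs k b X ws ys)
  have bm: "b \<le> m" using 3 by auto
  have zb: "z < b" using 3 by auto
  have stb: "fst t < b" if "t \<in> set st" for t using 3 that by auto
  \<comment> \<open>Counting for the top hook and closing it lead into the same block with different
    stacks, so \<open>K\<close> is stated for an arbitrary stack and sky count.\<close>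
  have K: "scan (bs @ ys) (push b (bs @ ys) (raise b (st @ [(m, c)]))) =
      runs ws (replicate k 1 @ map snd st @ [c])"
    if "\<forall>t\<in>set st. fst t < b" for st c
  proof -
    let ?st = "map (\<lambda>t. (b, snd t)) st"
    let ?bs = "rev (map (\<lambda>x. (x, 1 :: nat)) (butlast (b # bs)))"
    have "raise b (st @ [(m, c)]) = ?st @ [(m, c)]"
      using raise_le[of st b] that bm by (simp add: raise_append raise_ge less_imp_le)
    then have "scan (bs @ ys) (push b (bs @ ys) (raise b (st @ [(m, c)]))) =
        scan ys (push (last (b # bs)) ys (?bs @ (?st @ [(m, c)])))"
      using scan_decreasing[OF 3(2), of "?st @ [(m, c)]" ys] bm by auto
    also have "\<dots> = scan ys (push (last (b # bs)) ys ((?bs @ ?st) @ [(m, c)]))" by simp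
    also have "\<dots> = runs ws (map snd (?bs @ ?st) @ [c])"
    proof (rule "3.IH")
      show "last (b # bs) \<in> X \<union> set (b # bs)" using last_in_set[of "b # bs"] by blast
      show "\<forall>t\<in>set (?bs @ ?st). fst t \<in> X \<union> set (b # bs)" by (auto dest: in_set_butlastD)
      show "\<forall>x\<in>X \<union> set (b # bs) \<union> set ys. x \<le> m" using 3 by auto
    qed
    also have "map snd ?bs = replicate k 1"
      using 3(1) by (simp add: o_def rev_map map_replicate_const del: butlast.simps)
    then have "map snd (?bs @ ?st) @ [c] = replicate k 1 @ map snd st @ [c]"
      unfolding map_append by (simp only:) (simp add: o_def)
    finally show ?thesis .
  qed
  have push: "push z (b # bs @ ys) (st @ [(m, c)]) = st @ [(m, c)]" using zb by simp
  show ?case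
  proof (cases st)
    case Nil
    then show ?thesis unfolding push using K[of "[]" "Suc c"] bm by simp
  next
    case (Cons t st')
    then show ?thesis
      unfolding push using K[of "(fst t, Suc (snd t)) # st'" c] K[of st' c] stb by simp
  qed
qed

text \<open>
  The scan of \<open>perm132\<close> makes the \<open>k\<close> hooks of a \<open>High k\<close> step available at the bottom of the stack, that
  of \<open>perm312\<close> at the top. This is where the symmetry of \<open>runs\<close> enters.
\<close>

lemma scan_grows1:
  assumes "grows1 X us ws ys" "z \<in> X" "\<forall>t\<in>set st. fst t \<in> X" "\<forall>x\<in>X \<union> set us \<union> set ys. x \<le> m"
    and "map fst rs = us @ [m]" "map snd rs = c # replicate (length us) 1"
  shows "scan ys (push z ys (st @ rs)) = runs ws (map snd st @ [c])"
  using assms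
proof (induction arbitrary: z st c rs rule: grows1.induct)
  case (1 X)
  then obtain r where "rs = [r]" "snd r = c" by (cases rs) auto
  then show ?case by (cases st) auto
next
  case (2 X us v ws ys)
  have vz: "v < z" using 2 by auto
  have vm: "v \<le> m" using "2.prems"(3) by simp
  have stv: "v < fst t" if "t \<in> set st" for t using 2(1) "2.prems"(2) that by blast
  have rsv: "v \<le> fst t" if "t \<in> set rs" for t
  proof -
    have "fst t \<in> set us \<union> {m}" using that arg_cong[OF "2.prems"(4), of set] by auto
    then show ?thesis using 2(1) vm by (auto intro: less_imp_le)
  qed
  have r: "raise v ((z, 1) # st @ rs) = (z, 1) # st @ rs"
    by (rule raise_ge) (use stv vz rsv in \<open>auto intro: less_imp_le\<close>)
  have "scan (v # ys) (push z (v # ys) (st @ rs)) = scan ys (push v ys (((z, 1) # st) @ rs))"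
    using vz r by simp
  also have "\<dots> = runs ws (map snd ((z, 1) # st) @ [c])"
    using 2 by (intro "2.IH") auto
  finally show ?case by simp
next
  case (3 us k X b us' ws ys)
  have bm: "b \<le> m" using 3 by auto
  have zb: "z < b" using 3 by auto
  have stb: "fst t < b" if "t \<in> set st" for t using 3 that by auto
  have rsb: "b \<le> fst t" if "t \<in> set rs" "map fst rs = us @ us' @ [m]" for t rs
  proof -
    have "fst t \<in> set us \<union> set us' \<union> {m}" using arg_cong[OF that(2), of set] that(1) by auto
    then show ?thesis using 3(3) bm by (auto intro: less_imp_le)
  qed
  \<comment> \<open>The nearest pending hook plays the part of the sky: it cannot close yet and
    collects the count \<open>c\<close>, while the pending hooks below it and the true sky still
    have count 1. When the \<open>k\<close> nearest ones are released, the next entry of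
    \<open>rs\<close> becomes the bottom, and the counts below \<open>st\<close> read
    \<open>c\<close> followed by \<open>k\<close> ones.\<close>
  have K: "scan ys (push b ys (raise b (st @ rs))) = runs ws (replicate k 1 @ map snd st @ [c])"
    if st: "\<forall>t\<in>set st. fst t < b" and rs: "map fst rs = us @ us' @ [m]"
      "map snd rs = c # replicate (length us + length us') 1" for st c rs
  proof -
    let ?st = "map (\<lambda>t. (b, snd t)) st"
    have "raise b (st @ rs) = (?st @ take k rs) @ drop k rs"
      using raise_le[of st b] raise_ge[of rs b] st rsb[OF _ rs(1)] by (simp add: raise_append less_imp_le)
    then have "scan ys (push b ys (raise b (st @ rs))) = scan ys (push b ys ((?st @ take k rs) @ drop k rs))"
      by simp
    also have "\<dots> = runs ws (map snd (?st @ take k rs) @ [snd (rs ! k)])"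
    proof (rule "3.IH")
      have "map fst (take k rs) = us" using rs 3(1) by (simp flip: take_map)
      then have "fst t \<in> set us" if "t \<in> set (take k rs)" for t
        using that by (metis image_eqI set_map)
      then show "\<forall>t\<in>set (?st @ take k rs). fst t \<in> insert b (X \<union> set us)" by auto
      show "\<forall>x\<in>insert b (X \<union> set us) \<union> set us' \<union> set ys. x \<le> m" using 3 by auto
      show "map fst (drop k rs) = us' @ [m]" using rs 3(1) by (simp flip: drop_map)
      have "k < length rs" using arg_cong[OF rs(1), of length] 3(1) by simp
      then show "map snd (drop k rs) = snd (rs ! k) # replicate (length us') 1"
        using rs(2) 3(1) by (simp add: drop_map[symmetric] flip: Cons_nth_drop_Suc)
    qed simp
    also have "map snd (?st @ take k rs) @ [snd (rs ! k)] = map snd st @ c # replicate k 1"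
    proof -
      have k: "k < length rs" using arg_cong[OF rs(1), of length] 3(1) by simp
      then have "map snd (take k rs) @ [snd (rs ! k)] = take (Suc k) (map snd rs)"
        by (simp add: take_Suc_conv_app_nth flip: take_map)
      also have "\<dots> = c # replicate k 1" using 3(1) by (simp add: rs(2))
      finally show ?thesis by (simp add: o_def)
    qed
    \<comment> \<open>The released ones stand below \<open>c\<close> and \<open>st\<close>, whereas
      a \<open>High k\<close> step of the machine puts them on top.\<close>
    also have "runs ws (map snd st @ c # replicate k 1) = runs ws (replicate k 1 @ map snd st @ [c])"
      by (rule runs_symmetric) auto
    finally show ?thesis .
  qed
  have push: "push z (b # ys) (st @ rs) = st @ rs" using zb by simp
  have rs: "map fst rs = us @ us' @ [m]" "map snd rs = c # replicate (length us + length us') 1"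
    using "3.prems" by auto
  show ?case
  proof (cases st)
    case Nil
    obtain r rs' where r: "rs = r # rs'" using rs(2) by (cases rs) auto
    have "b \<le> fst r" using rsb[OF _ rs(1)] r by simp
    moreover have "snd r = c" using rs(2) r by simp
    ultimately show ?thesis
      unfolding push using K[of "[]" "(fst r, Suc (snd r)) # rs'" "Suc c"] rs Nil r by simp
  next
    case (Cons t st')
    then show ?thesis
      unfolding push using K[of "(fst t, Suc (snd t)) # st'" rs c] K[of st' rs c] rs stb by simp
  qed
qed

text \<open>Reading the initial run down to \<open>z\<close> puts all left-hand hooks on the stack,
  the nearest on top, each with count 1. The sky has count 1 from the first entry, so
  \<open>scan_grows1\<close> applies with \<open>c = 1\<close>.\<close>

lemma scan_perm132: "scan (perm132 s) [(Suc (length (perm132 s)), 0)] = runs (rev s) [1]"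
proof -
  obtain us z ys where s: "perm132 s = rev us @ z # ys" "sorted_wrt (<) (z # us)"
    "grows1 {z} us (rev s) ys" using perm132_grows by blast
  obtain b bs where b: "rev us @ [z] = b # bs" by (cases "rev us @ [z]") auto
  have dec: "sorted_wrt (>) (b # bs)"
    using s(2) unfolding b[symmetric] by (simp add: sorted_wrt_append sorted_wrt_rev)
  let ?m = "Suc (length (perm132 s))"
  have le: "x \<le> ?m" if "x \<in> set (perm132 s)" for x
    using is_perm_perm132[of s] that unfolding is_perm_iff by auto
  have s': "perm132 s = b # bs @ ys" using s(1) b by (metis append_Cons append_assoc append_Nil)
  have bm: "b \<le> ?m" using le s' by simp
  have bl: "butlast (b # bs) = rev us" "last (b # bs) = z" unfolding b[symmetric] by simp_all
  have "scan (perm132 s) [(?m, 0)] = scan (bs @ ys) (push b (bs @ ys) [(?m, 1)])"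
    using bm by (simp add: s' raise_def)
  also have "\<dots> = scan ys (push z ys ([] @ (map (\<lambda>x. (x, 1)) us @ [(?m, 1)])))"
    using scan_decreasing[OF dec, of "[(?m, 1)]" ys] bm unfolding bl by (simp add: rev_map)
  also have "\<dots> = runs (rev s) (map snd ([] :: (nat \<times> nat) list) @ [1])"
    by (rule scan_grows1[OF s(3)]) (use le in \<open>auto simp: s(1) o_def map_replicate_const replicate_append_same\<close>)
  finally show ?thesis by simp
qed

lemma scan_perm312: "scan (perm312 s) [(Suc (length (perm312 s)), 0)] = runs (rev s) [1]"
proof -
  obtain z ys where s: "perm312 s = z # ys" "grows2 {z} (rev s) ys" using perm312_grows by blast
  let ?m = "Suc (length (perm312 s))"
  have le: "x \<le> ?m" if "x \<in> set (perm312 s)" for x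
    using is_perm_perm312[of s] that unfolding is_perm_iff by auto
  have "scan (perm312 s) [(?m, 0)] = scan ys (push z ys ([] @ [(?m, 1)]))"
    using le[of z] by (simp add: s(1) raise_def)
  also have "\<dots> = runs (rev s) (map snd ([] :: (nat \<times> nat) list) @ [1])"
    by (rule scan_grows2[OF s(2)]) (use le in \<open>auto simp: s(1)\<close>)
  finally show ?thesis by simp
qed

section \<open>Pattern containment\<close>

definition similar :: "nat list \<Rightarrow> nat list \<Rightarrow> bool" where
  "similar xs ys \<longleftrightarrow> length xs = length ys \<and>
     (\<forall>i<length ys. \<forall>j<length ys. xs ! i < xs ! j \<longleftrightarrow> ys ! i < ys ! j)"

text \<open>Formulated for lists that need not be normalized, so that pieces and shifted copies of a
  permutation can be searched directly.\<close>

definition occurs :: "perm \<Rightarrow> nat list \<Rightarrow> bool" where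
  "occurs \<tau> xs \<longleftrightarrow> (\<exists>ys. subseq ys xs \<and> similar ys \<tau>)"

lemma contains_iff_occurs: "contains \<pi> \<tau> \<longleftrightarrow> occurs \<tau> \<pi>"
proof
  let ?m = "length \<tau>" and ?n = "length \<pi>"
  assume "contains \<pi> \<tau>"
  then obtain f where f: "strict_mono_on {1..?m} f" "f ` {1..?m} \<subseteq> {1..?n}"
    and ord: "\<forall>i\<in>{1..?m}. \<forall>j\<in>{1..?m}. entry \<pi> (f i) < entry \<pi> (f j) \<longleftrightarrow> entry \<tau> i < entry \<tau> j"
    unfolding contains_def by blast
  let ?is = "map f [1..<Suc ?m]"
  have "sorted_wrt (<) ?is"
    using f(1) by (auto simp: sorted_wrt_iff_nth_less strict_mono_on_def simp del: upt_Suc)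
  moreover have "set ?is \<subseteq> set [1..<Suc ?n]" using f(2) by (simp only: set_map set_upt atLeastLessThanSuc_atLeastAtMost)
  moreover have "sorted_wrt (\<le>) [1..<Suc ?n]" by (simp del: upt_Suc)
  ultimately have "subseq ?is [1..<Suc ?n]"
    using sorted_subset_imp_subseq by blast
  then have "subseq (map (entry \<pi>) ?is) (map (entry \<pi>) [1..<Suc ?n])" by (rule subseq_map)
  also have "map (entry \<pi>) [1..<Suc ?n] = \<pi>"
    by (rule nth_equalityI) (auto simp: entry_def simp del: upt_Suc)
  moreover have "similar (map (entry \<pi>) ?is) \<tau>"
    unfolding similar_def
  proof (intro conjI allI impI)
    fix i j assume ij: "i < ?m" "j < ?m"
    then have "entry \<pi> (f (Suc i)) < entry \<pi> (f (Suc j)) \<longleftrightarrow> entry \<tau> (Suc i) < entry \<tau> (Suc j)"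
      using ord by simp
    then show "(map (entry \<pi>) ?is ! i < map (entry \<pi>) ?is ! j) = (\<tau> ! i < \<tau> ! j)"
      using ij by (simp add: entry_def del: upt_Suc)
  qed (simp del: upt_Suc)
  ultimately show "occurs \<tau> \<pi>" unfolding occurs_def by metis
next
  let ?m = "length \<tau>" and ?n = "length \<pi>"
  assume "occurs \<tau> \<pi>"
  then obtain ys where ys: "subseq ys \<pi>" "similar ys \<tau>" unfolding occurs_def by blast
  obtain N where "ys = nths \<pi> N" using ys(1) by (auto simp: subseq_conv_nths)
  then have N: "ys = map ((!) \<pi>) (nths [0..<?n] N)"
    by (metis map_nth nths_map)
  let ?is = "nths [0..<?n] N"
  have inc: "sorted_wrt (<) ?is" by (simp add: strict_sorted_iff sorted_nths)
  have len: "length ?is = ?m" using ys(2) N by (simp add: similar_def)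
  have lt: "i < ?n" if "i \<in> set ?is" for i using that by (auto dest: in_set_nthsD)
  show "contains \<pi> \<tau>"
    unfolding contains_def
  proof (intro exI conjI ballI)
    let ?f = "\<lambda>i. Suc (?is ! (i - 1))"
    show "strict_mono_on {1..?m} ?f"
      using inc len by (auto simp: strict_mono_on_def sorted_wrt_iff_nth_less)
    show "?f ` {1..?m} \<subseteq> {1..?n}" using lt len by (auto simp: Suc_le_eq)
    fix i j assume "i \<in> {1..?m}" "j \<in> {1..?m}"
    then have ij: "i - 1 < ?m" "j - 1 < ?m" by auto
    then have "ys ! (i - 1) < ys ! (j - 1) \<longleftrightarrow> \<tau> ! (i - 1) < \<tau> ! (j - 1)"
      using ys(2) by (simp add: similar_def)
    then show "(entry \<pi> (?f i) < entry \<pi> (?f j)) = (entry \<tau> i < entry \<tau> j)"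
      using ij len by (simp add: entry_def N)
  qed
qed

lemma similar_Nil [simp]: "similar xs [] \<longleftrightarrow> xs = []"
  by (simp add: similar_def)

lemma similar_Nil_left [simp]: "similar [] ys \<longleftrightarrow> ys = []"
  by (auto simp: similar_def)

lemma similar_Cons [simp]:
  "similar (x # xs) (y # ys) \<longleftrightarrow>
     similar xs ys \<and> list_all2 (\<lambda>a b. (a < x \<longleftrightarrow> b < y) \<and> (x < a \<longleftrightarrow> y < b)) xs ys"
  unfolding similar_def list_all2_conv_all_nth by (auto simp: All_less_Suc2)

lemma similar_snoc:
  "similar (xs @ [x]) (ys @ [y]) \<longleftrightarrow>
     similar xs ys \<and> list_all2 (\<lambda>a b. (a < x \<longleftrightarrow> b < y) \<and> (x < a \<longleftrightarrow> y < b)) xs ys"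
proof (cases "length xs = length ys")
  case True
  then show ?thesis
    by (simp add: similar_def list_all2_conv_all_nth All_less_Suc nth_append cong: conj_cong imp_cong) blast
qed (simp add: similar_def)

lemma similar_refl: "similar xs xs"
  by (simp add: similar_def)

lemma similar_map:
  assumes "strict_mono f"
  shows "similar (map f xs) ys \<longleftrightarrow> similar xs ys"
proof -
  have "f a < f b \<longleftrightarrow> a < b" for a b using assms by (rule strict_mono_less)
  then show ?thesis unfolding similar_def length_map by (simp cong: conj_cong)
qed

lemma contains_trans:
  assumes "contains \<pi> \<sigma>" "contains \<sigma> \<tau>"
  shows "contains \<pi> \<tau>"
proof -
  obtain f where f: "strict_mono_on {1..length \<sigma>} f" "f ` {1..length \<sigma>} \<subseteq> {1..length \<pi>}"
    and fo: "\<forall>i\<in>{1..length \<sigma>}. \<forall>j\<in>{1..length \<sigma>}.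
      entry \<pi> (f i) < entry \<pi> (f j) \<longleftrightarrow> entry \<sigma> i < entry \<sigma> j"
    using assms(1) unfolding contains_def by blast
  obtain g where g: "strict_mono_on {1..length \<tau>} g" "g ` {1..length \<tau>} \<subseteq> {1..length \<sigma>}"
    and go: "\<forall>i\<in>{1..length \<tau>}. \<forall>j\<in>{1..length \<tau>}.
      entry \<sigma> (g i) < entry \<sigma> (g j) \<longleftrightarrow> entry \<tau> i < entry \<tau> j"
    using assms(2) unfolding contains_def by blast
  have gin: "g i \<in> {1..length \<sigma>}" if "i \<in> {1..length \<tau>}" for i using g(2) that by blast
  have "strict_mono_on {1..length \<tau>} (f \<circ> g)"
    using f(1) g(1) gin unfolding strict_mono_on_def by (metis comp_apply)
  moreover have "(f \<circ> g) ` {1..length \<tau>} \<subseteq> {1..length \<pi>}" using f(2) gin by fastforce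
  moreover have "\<forall>i\<in>{1..length \<tau>}. \<forall>j\<in>{1..length \<tau>}.
      entry \<pi> ((f \<circ> g) i) < entry \<pi> ((f \<circ> g) j) \<longleftrightarrow> entry \<tau> i < entry \<tau> j"
    using fo go gin by simp
  ultimately show ?thesis unfolding contains_def by blast
qed

lemma occurs_mono: "occurs \<tau> xs \<Longrightarrow> subseq xs ys \<Longrightarrow> occurs \<tau> ys"
  unfolding occurs_def using subseq_order.trans by blast

lemma occurs_map: "strict_mono f \<Longrightarrow> occurs \<tau> (map f xs) \<longleftrightarrow> occurs \<tau> xs"
proof
  assume f: "strict_mono f"
  assume "occurs \<tau> (map f xs)"
  then obtain ys where ys: "subseq ys (map f xs)" "similar ys \<tau>" unfolding occurs_def by blast
  then obtain zs where "ys = map f zs" "subseq zs xs"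
    by (auto simp: subseq_conv_nths nths_map)
  then show "occurs \<tau> xs" using ys similar_map[OF f] unfolding occurs_def by blast
next
  assume f: "strict_mono f"
  assume "occurs \<tau> xs"
  then show "occurs \<tau> (map f xs)"
    using subseq_map[of _ xs f] similar_map[OF f] unfolding occurs_def by blast
qed

lemma subseq_snoc_iff:
  "subseq (ys @ [y]) (xs @ [x]) \<longleftrightarrow> subseq (ys @ [y]) xs \<or> y = x \<and> subseq ys xs"
proof
  assume "subseq (ys @ [y]) (xs @ [x])"
  then obtain us vs where "ys @ [y] = us @ vs" "subseq us xs" "subseq vs [x]"
    by (rule subseq_appendE)
  moreover have "length vs \<le> 1" using list_emb_length[OF \<open>subseq vs [x]\<close>] by simp
  ultimately show "subseq (ys @ [y]) xs \<or> y = x \<and> subseq ys xs"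
    by (cases vs rule: rev_cases) (auto simp: subseq_singleton_left)
next
  assume "subseq (ys @ [y]) xs \<or> y = x \<and> subseq ys xs"
  then show "subseq (ys @ [y]) (xs @ [x])" by (auto intro: subseq_rev_drop_many)
qed

lemma subseq_decreasing: "subseq ys xs \<Longrightarrow> sorted_wrt (>) xs \<Longrightarrow> sorted_wrt (>) (ys :: nat list)"
  by (induction rule: list_emb.induct) (auto dest: list_emb_set)

lemma subseq_set: "subseq ys xs \<Longrightarrow> set ys \<subseteq> set xs"
  by (auto simp: subseq_conv_nths dest: in_set_nthsD)

section \<open>Patterns ending in their maximum or minimum\<close>

lemma similar_direct_sum_1:
  assumes "is_perm Y"
  shows "similar ys (direct_sum Y [1]) \<longleftrightarrow> (\<exists>xs x. ys = xs @ [x] \<and> similar xs Y \<and> (\<forall>a\<in>set xs. a < x))"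
proof -
  have Y: "Y ! i < Suc (length Y)" if "i < length Y" for i
    using assms that nth_mem[OF that] by (auto simp: is_perm_iff less_Suc_eq_le)
  have "list_all2 (\<lambda>a b. (a < x \<longleftrightarrow> b < Suc (length Y)) \<and> (x < a \<longleftrightarrow> Suc (length Y) < b)) xs Y \<longleftrightarrow>
      (\<forall>a\<in>set xs. a < x)" if "similar xs Y" for xs x
  proof -
    have "length xs = length Y" using that by (simp add: similar_def)
    then show ?thesis
      using Y unfolding list_all2_conv_all_nth all_set_conv_all_nth by (auto dest: less_asym)
  qed
  moreover have "ys = [] \<Longrightarrow> \<not> similar ys (direct_sum Y [1])"
    by (simp add: direct_sum_def)
  ultimately show ?thesis
    by (cases ys rule: rev_cases) (auto simp: direct_sum_def similar_snoc)
qed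

lemma similar_skew_sum_1:
  assumes "is_perm Y"
  shows "similar ys (skew_sum Y [1]) \<longleftrightarrow> (\<exists>xs x. ys = xs @ [x] \<and> similar xs Y \<and> (\<forall>a\<in>set xs. x < a))"
proof -
  have Y: "0 < Y ! i" if "i < length Y" for i
    using assms that nth_mem[OF that] by (auto simp: is_perm_iff)
  have "list_all2 (\<lambda>a b. (a < x \<longleftrightarrow> Suc b < 1) \<and> (x < a \<longleftrightarrow> 1 < Suc b)) xs Y \<longleftrightarrow>
      (\<forall>a\<in>set xs. x < a)" if "similar xs Y" for xs x
  proof -
    have "length xs = length Y" using that by (simp add: similar_def)
    then show ?thesis
      using Y unfolding list_all2_conv_all_nth all_set_conv_all_nth by (auto dest: less_asym)
  qed
  moreover have "similar xs (map Suc Y) \<longleftrightarrow> similar xs Y" for xs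
    by (auto simp: similar_def)
  moreover have "ys = [] \<Longrightarrow> \<not> similar ys (skew_sum Y [1])"
    by (simp add: skew_sum_def)
  ultimately show ?thesis
    by (cases ys rule: rev_cases) (auto simp: skew_sum_def similar_snoc list_all2_map2)
qed

lemma occurs_direct_sum_1:
  "is_perm Y \<Longrightarrow> occurs (direct_sum Y [1]) xs \<longleftrightarrow>
    (\<exists>ys y. subseq (ys @ [y]) xs \<and> similar ys Y \<and> (\<forall>a\<in>set ys. a < y))"
  unfolding occurs_def by (auto simp: similar_direct_sum_1 simp del: One_nat_def)

lemma occurs_skew_sum_1:
  "is_perm Y \<Longrightarrow> occurs (skew_sum Y [1]) xs \<longleftrightarrow>
    (\<exists>ys y. subseq (ys @ [y]) xs \<and> similar ys Y \<and> (\<forall>a\<in>set ys. y < a))"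
  unfolding occurs_def by (auto simp: similar_skew_sum_1 simp del: One_nat_def)

lemma subseq_snocD: "subseq (ys @ [y]) xs \<Longrightarrow> subseq ys xs \<and> y \<in> set xs"
  using subseq_set[of "ys @ [y]" xs] subseq_order.trans[of ys "ys @ [y]" xs] by auto

text \<open>A new maximum at the end completes every copy of \<open>Y\<close>; in
  \<open>occurs_skew_snoc_min\<close> a new minimum does.\<close>

lemma occurs_direct_snoc_max:
  assumes "is_perm Y" "\<forall>x\<in>set xs. x < v"
  shows "occurs (direct_sum Y [1]) (xs @ [v]) \<longleftrightarrow> occurs Y xs"
proof
  assume "occurs (direct_sum Y [1]) (xs @ [v])"
  then obtain ys y where "subseq (ys @ [y]) xs \<or> y = v \<and> subseq ys xs" "similar ys Y"
    unfolding occurs_direct_sum_1[OF assms(1)] subseq_snoc_iff by blast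
  moreover from this(1) have "subseq ys xs" using subseq_snocD[of ys y xs] by auto
  ultimately show "occurs Y xs" unfolding occurs_def by blast
next
  assume "occurs Y xs"
  then obtain ys where ys: "subseq ys xs" "similar ys Y" unfolding occurs_def by blast
  then have "subseq (ys @ [v]) (xs @ [v])" by simp
  moreover have "\<forall>a\<in>set ys. a < v" using assms(2) subseq_set[OF ys(1)] by auto
  ultimately show "occurs (direct_sum Y [1]) (xs @ [v])"
    unfolding occurs_direct_sum_1[OF assms(1)] using ys(2) by blast
qed

lemma occurs_skew_snoc_min:
  assumes "is_perm Y" "\<forall>x\<in>set xs. v < x"
  shows "occurs (skew_sum Y [1]) (xs @ [v]) \<longleftrightarrow> occurs Y xs"
proof
  assume "occurs (skew_sum Y [1]) (xs @ [v])"
  then obtain ys y where "subseq (ys @ [y]) xs \<or> y = v \<and> subseq ys xs" "similar ys Y"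
    unfolding occurs_skew_sum_1[OF assms(1)] subseq_snoc_iff by blast
  moreover from this(1) have "subseq ys xs" using subseq_snocD[of ys y xs] by auto
  ultimately show "occurs Y xs" unfolding occurs_def by blast
next
  assume "occurs Y xs"
  then obtain ys where ys: "subseq ys xs" "similar ys Y" unfolding occurs_def by blast
  then have "subseq (ys @ [v]) (xs @ [v])" by simp
  moreover have "\<forall>a\<in>set ys. v < a" using assms(2) subseq_set[OF ys(1)] by auto
  ultimately show "occurs (skew_sum Y [1]) (xs @ [v])"
    unfolding occurs_skew_sum_1[OF assms(1)] using ys(2) by blast
qed

lemma similar_nonempty: "similar ys Y \<Longrightarrow> Y \<noteq> [] \<Longrightarrow> \<exists>a. a \<in> set ys"
  by (cases ys) auto

text \<open>The last letter of the pattern exceeds some other letter, as \<open>Y\<close> is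
  nonempty, so a new minimum cannot play it. \<open>occurs_skew_snoc_max\<close> is the
  dual.\<close>

lemma occurs_direct_snoc_min:
  assumes "is_perm Y" "Y \<noteq> []" "\<forall>x\<in>set xs. v < x"
  shows "occurs (direct_sum Y [1]) (xs @ [v]) \<longleftrightarrow> occurs (direct_sum Y [1]) xs"
proof
  assume "occurs (direct_sum Y [1]) (xs @ [v])"
  then obtain ys y where y: "subseq (ys @ [y]) (xs @ [v])" "similar ys Y" "\<forall>a\<in>set ys. a < y"
    unfolding occurs_direct_sum_1[OF assms(1)] by blast
  obtain a where a: "a \<in> set ys" using similar_nonempty[OF y(2) assms(2)] by blast
  have "subseq (ys @ [y]) xs"
  proof (rule ccontr)
    assume "\<not> subseq (ys @ [y]) xs"
    then have "y = v" "subseq ys xs" using y(1) by (auto simp: subseq_snoc_iff)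
    then show False using a y(3) assms(3) subseq_set[of ys xs] by fastforce
  qed
  then show "occurs (direct_sum Y [1]) xs"
    using y unfolding occurs_direct_sum_1[OF assms(1)] by blast
qed (auto intro: occurs_mono)

lemma occurs_skew_snoc_max:
  assumes "is_perm Y" "Y \<noteq> []" "\<forall>x\<in>set xs. x < v"
  shows "occurs (skew_sum Y [1]) (xs @ [v]) \<longleftrightarrow> occurs (skew_sum Y [1]) xs"
proof
  assume "occurs (skew_sum Y [1]) (xs @ [v])"
  then obtain ys y where y: "subseq (ys @ [y]) (xs @ [v])" "similar ys Y" "\<forall>a\<in>set ys. y < a"
    unfolding occurs_skew_sum_1[OF assms(1)] by blast
  obtain a where a: "a \<in> set ys" using similar_nonempty[OF y(2) assms(2)] by blast
  have "subseq (ys @ [y]) xs"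
  proof (rule ccontr)
    assume "\<not> subseq (ys @ [y]) xs"
    then have "y = v" "subseq ys xs" using y(1) by (auto simp: subseq_snoc_iff)
    then show False using a y(3) assms(3) subseq_set[of ys xs] by fastforce
  qed
  then show "occurs (skew_sum Y [1]) xs"
    using y unfolding occurs_skew_sum_1[OF assms(1)] by blast
qed (auto intro: occurs_mono)

text \<open>If a copy began in \<open>D\<close>, its last letter, being larger than the first, would
  lie in \<open>D\<close> as well. The whole copy would then decrease.\<close>

lemma occurs_direct_decreasing_append:
  assumes Y: "is_perm Y" "Y \<noteq> []" and D: "sorted_wrt (>) D" "\<forall>d\<in>set D. \<forall>q\<in>set Q. q < d"
  shows "occurs (direct_sum Y [1]) (D @ Q) \<longleftrightarrow> occurs (direct_sum Y [1]) Q"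
proof
  assume "occurs (direct_sum Y [1]) (D @ Q)"
  then obtain ys y where y: "subseq (ys @ [y]) (D @ Q)" "similar ys Y" "\<forall>a\<in>set ys. a < y"
    unfolding occurs_direct_sum_1[OF Y(1)] by blast
  obtain a zs where ys: "ys = a # zs" using y(2) Y(2) by (cases ys) auto
  from y(1) obtain us vs where uv: "ys @ [y] = us @ vs" "subseq us D" "subseq vs Q"
    by (rule subseq_appendE)
  have "us = []"
  proof (rule ccontr)
    assume "us \<noteq> []"
    then obtain us' where us: "us = a # us'" using uv(1) ys by (cases us) auto
    then have aD: "a \<in> set D" using subseq_set[OF uv(2)] by auto
    have "y \<notin> set Q" using D(2) aD y(3) ys by fastforce
    then have "vs = []" using uv(1) subseq_set[OF uv(3)] by (cases vs rule: rev_cases) auto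
    then have "sorted_wrt (>) (ys @ [y])" using uv subseq_decreasing[OF uv(2) D(1)] by simp
    then show False using ys y(3) by auto
  qed
  then show "occurs (direct_sum Y [1]) Q"
    using uv y unfolding occurs_direct_sum_1[OF Y(1)] by auto
qed (auto intro: occurs_mono)

text \<open>The previous argument applies to the last but one letter \<open>z\<close>, which exceeds
  the first letter; only the very last letter could fall into \<open>Q\<close>.\<close>

lemma occurs_skew_decreasing_append:
  assumes Z: "is_perm Z" "Z \<noteq> []" and D: "sorted_wrt (>) D" "\<forall>d\<in>set D. \<forall>q\<in>set Q. q < d"
  shows "occurs (skew_sum (direct_sum Z [1]) [1]) (D @ Q) \<longleftrightarrow>
         occurs (skew_sum (direct_sum Z [1]) [1]) Q"
proof
  have Z1: "is_perm (direct_sum Z [1])" by (rule is_perm_direct_sum[OF Z(1) is_perm_single])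
  assume "occurs (skew_sum (direct_sum Z [1]) [1]) (D @ Q)"
  then obtain ys y where y: "subseq (ys @ [y]) (D @ Q)" "similar ys (direct_sum Z [1])"
    "\<forall>a\<in>set ys. y < a"
    unfolding occurs_skew_sum_1[OF Z1] by blast
  then obtain zs z where zs: "ys = zs @ [z]" "similar zs Z" "\<forall>a\<in>set zs. a < z"
    using similar_direct_sum_1[OF Z(1)] by blast
  obtain a ws where ws: "zs = a # ws" using zs(2) Z(2) by (cases zs) auto
  from y(1) obtain us vs where uv: "ys @ [y] = us @ vs" "subseq us D" "subseq vs Q"
    by (rule subseq_appendE)
  have "us = []"
  proof (rule ccontr)
    assume "us \<noteq> []"
    then obtain us' where us: "us = a # us'" using uv(1) ws zs(1) by (cases us) auto
    then have aD: "a \<in> set D" using subseq_set[OF uv(2)] by auto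
    have zQ: "z \<notin> set Q" using D(2) aD zs(3) ws by fastforce
    have "length vs \<le> 1"
    proof (rule ccontr)
      assume "\<not> length vs \<le> 1"
      then obtain vs' p q where "vs = vs' @ [p, q]"
        by (cases vs rule: rev_cases; cases "butlast vs" rule: rev_cases) auto
      then have "p = z" using uv(1) zs(1) by simp
      then show False using zQ \<open>vs = vs' @ [p, q]\<close> subseq_set[OF uv(3)] by auto
    qed
    then obtain us'' where "us = zs @ z # us''"
      using uv(1) zs(1) by (cases vs rule: rev_cases) auto
    then have "sorted_wrt (>) (zs @ z # us'')" using subseq_decreasing[OF uv(2) D(1)] by simp
    then show False using ws zs(3) by auto
  qed
  then show "occurs (skew_sum (direct_sum Z [1]) [1]) Q"
    using uv y unfolding occurs_skew_sum_1[OF Z1] by auto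
qed (auto intro: occurs_mono)

text \<open>Two letters of a copy in \<open>D\<close> would contradict that the last letter is the
  largest, so deleting it leaves a copy of \<open>Y\<close> in \<open>Q\<close>. Conversely, any
  point of \<open>D\<close> can be the last letter.\<close>

lemma occurs_direct_append_decreasing:
  assumes Y: "is_perm Y" "Y \<noteq> []" and D: "sorted_wrt (>) D" "\<forall>d\<in>set D. \<forall>q\<in>set Q. q < d" "D \<noteq> []"
  shows "occurs (direct_sum Y [1]) (Q @ D) \<longleftrightarrow> occurs Y Q"
proof
  assume "occurs (direct_sum Y [1]) (Q @ D)"
  then obtain ys y where y: "subseq (ys @ [y]) (Q @ D)" "similar ys Y" "\<forall>a\<in>set ys. a < y"
    unfolding occurs_direct_sum_1[OF Y(1)] by blast
  from y(1) obtain us vs where uv: "ys @ [y] = us @ vs" "subseq us Q" "subseq vs D"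
    by (rule subseq_appendE)
  have "length vs \<le> 1"
  proof (rule ccontr)
    assume "\<not> length vs \<le> 1"
    then obtain vs' p q where vs: "vs = vs' @ [p, q]"
      by (cases vs rule: rev_cases; cases "butlast vs" rule: rev_cases) auto
    then have "q = y" "p \<in> set ys" using uv(1) by (auto simp: append_eq_append_conv2 Cons_eq_append_conv)
    moreover have "sorted_wrt (>) vs" using subseq_decreasing[OF uv(3) D(1)] .
    ultimately show False using vs y(3) by (auto simp: sorted_wrt_append)
  qed
  then have "subseq ys us"
    using uv(1) by (cases vs rule: rev_cases) auto
  then show "occurs Y Q" using y(2) uv(2) subseq_order.trans unfolding occurs_def by blast
next
  assume "occurs Y Q"
  then obtain ys where ys: "subseq ys Q" "similar ys Y" unfolding occurs_def by blast
  obtain d D' where d: "D = d # D'" using D(3) by (cases D) auto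
  have "subseq (ys @ [d]) (Q @ D)"
    unfolding d using ys(1) by (intro list_emb_append_mono) auto
  moreover have "\<forall>a\<in>set ys. a < d" using subseq_set[OF ys(1)] D(2) d by auto
  ultimately show "occurs (direct_sum Y [1]) (Q @ D)"
    unfolding occurs_direct_sum_1[OF Y(1)] using ys(2) by blast
qed

text \<open>If the last letter, the minimum of the copy, lay in \<open>D\<close>, all letters would
  be too large for \<open>Q\<close>. The copy would lie in \<open>D\<close>, although its first
  letter is smaller than \<open>z\<close>.\<close>

lemma occurs_skew_append_decreasing:
  assumes Z: "is_perm Z" "Z \<noteq> []" and D: "sorted_wrt (>) D" "\<forall>d\<in>set D. \<forall>q\<in>set Q. q < d"
  shows "occurs (skew_sum (direct_sum Z [1]) [1]) (Q @ D) \<longleftrightarrow>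
         occurs (skew_sum (direct_sum Z [1]) [1]) Q"
proof
  have Z1: "is_perm (direct_sum Z [1])" by (rule is_perm_direct_sum[OF Z(1) is_perm_single])
  assume "occurs (skew_sum (direct_sum Z [1]) [1]) (Q @ D)"
  then obtain ys y where y: "subseq (ys @ [y]) (Q @ D)" "similar ys (direct_sum Z [1])"
    "\<forall>a\<in>set ys. y < a"
    unfolding occurs_skew_sum_1[OF Z1] by blast
  then obtain zs z where zs: "ys = zs @ [z]" "similar zs Z" "\<forall>a\<in>set zs. a < z"
    using similar_direct_sum_1[OF Z(1)] by blast
  obtain a ws where ws: "zs = a # ws" using zs(2) Z(2) by (cases zs) auto
  from y(1) obtain us vs where uv: "ys @ [y] = us @ vs" "subseq us Q" "subseq vs D"
    by (rule subseq_appendE)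
  have "vs = []"
  proof (rule ccontr)
    assume "vs \<noteq> []"
    then have "y \<in> set D" using uv(1) subseq_set[OF uv(3)] by (cases vs rule: rev_cases) auto
    then have "set ys \<inter> set Q = {}" using D(2) y(3) by fastforce
    then have "us = []"
      using uv(1) subseq_set[OF uv(2)] zs(1) ws by (cases us) auto
    then have "sorted_wrt (>) (ys @ [y])" using uv subseq_decreasing[OF uv(3) D(1)] by simp
    then show False using zs ws by (auto simp: sorted_wrt_append)
  qed
  then show "occurs (skew_sum (direct_sum Z [1]) [1]) Q"
    using uv y unfolding occurs_skew_sum_1[OF Z1] by auto
qed (auto intro: occurs_mono)

lemma occurs_21: "occurs [2, 1] xs \<longleftrightarrow> (\<exists>a b. subseq [a, b] xs \<and> b < a)"
proof -
  have sim: "similar ys [2, 1] \<longleftrightarrow> (\<exists>a b. ys = [a, b] \<and> b < a)" for ys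
    by (cases ys; cases "tl ys") (auto simp: list_all2_Cons2)
  show ?thesis unfolding occurs_def sim by auto
qed

lemma occurs_1: "occurs [1] xs \<longleftrightarrow> xs \<noteq> []"
proof -
  have sim: "similar ys [1] \<longleftrightarrow> (\<exists>a. ys = [a])" for ys
    by (cases ys) (auto simp: list_all2_Cons2)
  show ?thesis unfolding occurs_def sim by (cases xs) (auto simp: subseq_singleton_left)
qed

section \<open>Structure of the two classes\<close>

lemma similar_Cons_right:
  "similar xs (y # ys) \<longleftrightarrow> (\<exists>x xs'. xs = x # xs' \<and> similar xs' ys \<and>
     list_all2 (\<lambda>a b. (a < x \<longleftrightarrow> b < y) \<and> (x < a \<longleftrightarrow> y < b)) xs' ys)"
  by (cases xs) auto

lemma occurs_132: "occurs [1, 3, 2] xs \<longleftrightarrow> (\<exists>a b c. subseq [a, b, c] xs \<and> a < c \<and> c < b)"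
proof -
  have sim: "similar ys [1, 3, 2] \<longleftrightarrow> (\<exists>a b c. ys = [a, b, c] \<and> a < c \<and> c < b)" for ys
    by (auto simp: similar_Cons_right list_all2_Cons2)
  show ?thesis unfolding occurs_def sim by auto
qed

lemma occurs_312: "occurs [3, 1, 2] xs \<longleftrightarrow> (\<exists>a b c. subseq [c, a, b] xs \<and> a < b \<and> b < c)"
proof -
  have sim: "similar ys [3, 1, 2] \<longleftrightarrow> (\<exists>a b c. ys = [c, a, b] \<and> a < b \<and> b < c)" for ys
    by (auto simp: similar_Cons_right list_all2_Cons2)
  show ?thesis unfolding occurs_def sim by auto
qed

lemma occurs_3412:
  "occurs [3, 4, 1, 2] xs \<longleftrightarrow> (\<exists>a b c d. subseq [c, d, a, b] xs \<and> a < b \<and> b < c \<and> c < d)"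
proof -
  have sim: "similar ys [3, 4, 1, 2] \<longleftrightarrow> (\<exists>a b c d. ys = [c, d, a, b] \<and> a < b \<and> b < c \<and> c < d)" for ys
    by (auto simp: similar_Cons_right list_all2_Cons2)
  show ?thesis unfolding occurs_def sim by auto
qed

lemma occurs_1342:
  "occurs [1, 3, 4, 2] xs \<longleftrightarrow> (\<exists>a b c d. subseq [a, c, d, b] xs \<and> a < b \<and> b < c \<and> c < d)"
proof -
  have sim: "similar ys [1, 3, 4, 2] \<longleftrightarrow> (\<exists>a b c d. ys = [a, c, d, b] \<and> a < b \<and> b < c \<and> c < d)" for ys
    by (auto simp: similar_Cons_right list_all2_Cons2)
  show ?thesis unfolding occurs_def sim by auto
qed

text \<open>In each of 132, 3412, 312 and 1342 the last letter lies strictly between two earlier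
  ones, so a new extreme value at the end cannot play it.\<close>

lemma occurs_132_snoc:
  assumes "occurs [1, 3, 2] (xs @ [v])" "(\<forall>x\<in>set xs. v < x) \<or> (\<forall>x\<in>set xs. x < v)"
  shows "occurs [1, 3, 2] xs"
proof -
  obtain a b c where abc: "subseq ([a, b] @ [c]) (xs @ [v])" "a < c" "c < b"
    using assms(1) unfolding occurs_132 by auto
  have "subseq ([a, b] @ [c]) xs"
  proof (rule ccontr)
    assume "\<not> subseq ([a, b] @ [c]) xs"
    then have "c = v" "subseq [a, b] xs" using abc(1) unfolding subseq_snoc_iff by auto
    then show False using abc assms(2) subseq_set[of "[a, b]" xs] by fastforce
  qed
  then show ?thesis using abc unfolding occurs_132 by auto
qed

lemma occurs_3412_snoc:
  assumes "occurs [3, 4, 1, 2] (xs @ [v])" "(\<forall>x\<in>set xs. v < x) \<or> (\<forall>x\<in>set xs. x < v)"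
  shows "occurs [3, 4, 1, 2] xs"
proof -
  obtain a b c d where abc: "subseq ([c, d, a] @ [b]) (xs @ [v])" "a < b" "b < c" "c < d"
    using assms(1) unfolding occurs_3412 by auto
  have "subseq ([c, d, a] @ [b]) xs"
  proof (rule ccontr)
    assume "\<not> subseq ([c, d, a] @ [b]) xs"
    then have "b = v" "subseq [c, d, a] xs" using abc(1) unfolding subseq_snoc_iff by auto
    then show False using abc assms(2) subseq_set[of "[c, d, a]" xs] by fastforce
  qed
  then show ?thesis using abc unfolding occurs_3412 by auto
qed

lemma occurs_312_snoc:
  assumes "occurs [3, 1, 2] (xs @ [v])" "\<forall>x\<in>set xs. v < x"
  shows "occurs [3, 1, 2] xs"
proof -
  obtain a b c where abc: "subseq ([c, a] @ [b]) (xs @ [v])" "a < b" "b < c"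
    using assms(1) unfolding occurs_312 by auto
  have "subseq ([c, a] @ [b]) xs"
  proof (rule ccontr)
    assume "\<not> subseq ([c, a] @ [b]) xs"
    then have "b = v" "subseq [c, a] xs" using abc(1) unfolding subseq_snoc_iff by auto
    then show False using abc assms(2) subseq_set[of "[c, a]" xs] by fastforce
  qed
  then show ?thesis using abc unfolding occurs_312 by auto
qed

lemma occurs_1342_snoc:
  assumes "occurs [1, 3, 4, 2] (xs @ [v])" "\<forall>x\<in>set xs. v < x"
  shows "occurs [1, 3, 4, 2] xs"
proof -
  obtain a b c d where abc: "subseq ([a, c, d] @ [b]) (xs @ [v])" "a < b" "b < c" "c < d"
    using assms(1) unfolding occurs_1342 by auto
  have "subseq ([a, c, d] @ [b]) xs"
  proof (rule ccontr)
    assume "\<not> subseq ([a, c, d] @ [b]) xs"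
    then have "b = v" "subseq [a, c, d] xs" using abc(1) unfolding subseq_snoc_iff by auto
    then show False using abc assms(2) subseq_set[of "[a, c, d]" xs] by fastforce
  qed
  then show ?thesis using abc unfolding occurs_1342 by auto
qed

lemma append_eq_3:
  "[a, b, c] = us @ vs \<Longrightarrow> us = [] \<and> vs = [a, b, c] \<or> us = [a] \<and> vs = [b, c] \<or>
    us = [a, b] \<and> vs = [c] \<or> us = [a, b, c] \<and> vs = []"
  by (cases us; cases "tl us"; cases "tl (tl us)") auto

lemma append_eq_4:
  "[a, b, c, d] = us @ vs \<Longrightarrow> us = [] \<and> vs = [a, b, c, d] \<or> us = [a] \<and> vs = [b, c, d] \<or>
    us = [a, b] \<and> vs = [c, d] \<or> us = [a, b, c] \<and> vs = [d] \<or> us = [a, b, c, d] \<and> vs = []"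
  by (cases us; cases "tl us"; cases "tl (tl us)"; cases "tl (tl (tl us))") auto

context
  fixes D Q :: "nat list"
  assumes D: "sorted_wrt (>) D" "\<forall>d\<in>set D. \<forall>q\<in>set Q. q < d"
begin

text \<open>In 132 and in 3412 some later letter exceeds the first. If the first letter lay in
  \<open>D\<close>, that letter would have to lie in \<open>D\<close> too, where later entries are
  smaller.\<close>

lemma occurs_132_decreasing_append:
  assumes "occurs [1, 3, 2] (D @ Q)"
  shows "occurs [1, 3, 2] Q"
proof -
  obtain a b c where abc: "subseq [a, b, c] (D @ Q)" "a < c" "c < b"
    using assms unfolding occurs_132 by auto
  from abc(1) obtain us vs where uv: "[a, b, c] = us @ vs" "subseq us D" "subseq vs Q"
    by (rule subseq_appendE)
  note sub = subseq_set[OF uv(2)] subseq_set[OF uv(3)]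
  have dec: "sorted_wrt (>) us" using subseq_decreasing[OF uv(2) D(1)] .
  consider "us = []" "vs = [a, b, c]"
    | "us = [a]" "vs = [b, c]"
    | "us = [a, b]" "vs = [c]"
    | "us = [a, b, c]" "vs = []"
    using append_eq_3[OF uv(1)] by blast
  then have "us = []"
  proof cases
    case 1
    then show ?thesis by simp
  next
    case 2
    then have "c < a" using D(2) sub by simp
    then show ?thesis using abc by simp
  next
    case 3
    then have "c < a" using D(2) sub by simp
    then show ?thesis using abc by simp
  next
    case 4
    then show ?thesis using dec abc by simp
  qed
  then show ?thesis using uv abc unfolding occurs_132 by auto
qed

lemma occurs_3412_decreasing_append:
  assumes "occurs [3, 4, 1, 2] (D @ Q)"
  shows "occurs [3, 4, 1, 2] Q"
proof -
  obtain a b c d where abc: "subseq [c, d, a, b] (D @ Q)" "a < b" "b < c" "c < d"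
    using assms unfolding occurs_3412 by auto
  from abc(1) obtain us vs where uv: "[c, d, a, b] = us @ vs" "subseq us D" "subseq vs Q"
    by (rule subseq_appendE)
  note sub = subseq_set[OF uv(2)] subseq_set[OF uv(3)]
  have dec: "sorted_wrt (>) us" using subseq_decreasing[OF uv(2) D(1)] .
  consider "us = []" "vs = [c, d, a, b]"
    | "us = [c]" "vs = [d, a, b]"
    | "us = [c, d]" "vs = [a, b]"
    | "us = [c, d, a]" "vs = [b]"
    | "us = [c, d, a, b]" "vs = []"
    using append_eq_4[OF uv(1)] by blast
  then have "us = []"
  proof cases
    case 1
    then show ?thesis by simp
  next
    case 2
    then have "d < c" using D(2) sub by simp
    then show ?thesis using abc by simp
  next
    case 3
    then show ?thesis using dec abc by simp
  next
    case 4
    then show ?thesis using dec abc by simp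
  next
    case 5
    then show ?thesis using dec abc by simp
  qed
  then show ?thesis using uv abc unfolding occurs_3412 by auto
qed

text \<open>In 312 and in 1342 some letter before the last is larger than it, and an ascent occurs
  from that letter on. If the last letter lay in \<open>D\<close>, the larger one would too, and the
  ascent would fall into \<open>D\<close>.\<close>

lemma occurs_312_append_decreasing:
  assumes "occurs [3, 1, 2] (Q @ D)"
  shows "occurs [3, 1, 2] Q"
proof -
  obtain a b c where abc: "subseq [c, a, b] (Q @ D)" "a < b" "b < c"
    using assms unfolding occurs_312 by auto
  from abc(1) obtain us vs where uv: "[c, a, b] = us @ vs" "subseq us Q" "subseq vs D"
    by (rule subseq_appendE)
  note sub = subseq_set[OF uv(2)] subseq_set[OF uv(3)]
  have dec: "sorted_wrt (>) vs" using subseq_decreasing[OF uv(3) D(1)] .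
  consider "us = []" "vs = [c, a, b]"
    | "us = [c]" "vs = [a, b]"
    | "us = [c, a]" "vs = [b]"
    | "us = [c, a, b]" "vs = []"
    using append_eq_3[OF uv(1)] by blast
  then have "vs = []"
  proof cases
    case 1
    then show ?thesis using dec abc by simp
  next
    case 2
    then have "c < b" using D(2) sub by simp
    then show ?thesis using abc by simp
  next
    case 3
    then have "c < b" using D(2) sub by simp
    then show ?thesis using abc by simp
  next
    case 4
    then show ?thesis by simp
  qed
  then show ?thesis using uv abc unfolding occurs_312 by auto
qed

lemma occurs_1342_append_decreasing:
  assumes "occurs [1, 3, 4, 2] (Q @ D)"
  shows "occurs [1, 3, 4, 2] Q"
proof -
  obtain a b c d where abc: "subseq [a, c, d, b] (Q @ D)" "a < b" "b < c" "c < d"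
    using assms unfolding occurs_1342 by auto
  from abc(1) obtain us vs where uv: "[a, c, d, b] = us @ vs" "subseq us Q" "subseq vs D"
    by (rule subseq_appendE)
  note sub = subseq_set[OF uv(2)] subseq_set[OF uv(3)]
  have dec: "sorted_wrt (>) vs" using subseq_decreasing[OF uv(3) D(1)] .
  consider "us = []" "vs = [a, c, d, b]"
    | "us = [a]" "vs = [c, d, b]"
    | "us = [a, c]" "vs = [d, b]"
    | "us = [a, c, d]" "vs = [b]"
    | "us = [a, c, d, b]" "vs = []"
    using append_eq_4[OF uv(1)] by blast
  then have "vs = []"
  proof cases
    case 1
    then show ?thesis using dec abc by simp
  next
    case 2
    then show ?thesis using dec abc by simp
  next
    case 3
    then have "c < b" using D(2) sub by simp
    then show ?thesis using abc by simp
  next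
    case 4
    then have "c < b" using D(2) sub by simp
    then show ?thesis using abc by simp
  next
    case 5
    then show ?thesis by simp
  qed
  then show ?thesis using uv abc unfolding occurs_1342 by auto
qed

end

lemma perm_le: "is_perm \<pi> \<Longrightarrow> x \<in> set \<pi> \<Longrightarrow> 1 \<le> x \<and> x \<le> length \<pi>"
  by (auto simp: is_perm_iff)

lemma skew_sum_1: "skew_sum \<pi> [1] = map (\<lambda>x. x + 1) \<pi> @ [1]"
  by (simp add: skew_sum_def)

lemma direct_sum_1: "direct_sum \<pi> [1] = \<pi> @ [Suc (length \<pi>)]"
  by (simp add: direct_sum_def)

lemma perm132_High: "perm132 (High k # s) =
    map (\<lambda>x. x + Suc (length (perm132 s))) (decreasing k) @ (perm132 s @ [Suc (length (perm132 s))])"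
  by (simp add: skew_sum_def direct_sum_def)

lemma perm312_High: "perm312 (High k # s) =
    perm312 s @ map (\<lambda>x. x + length (perm312 s)) (decreasing (Suc k))"
  by (simp add: direct_sum_def)

lemma decreasing_shift:
  "sorted_wrt (>) (map (\<lambda>x. x + m) (decreasing k))"
  "\<And>d. d \<in> set (map (\<lambda>x. x + m) (decreasing k)) \<Longrightarrow> m < d"
  using sorted_decreasing[of k] by (auto simp: sorted_wrt_map decreasing_def)

lemma perm132_avoids: "\<not> occurs [1, 3, 2] (perm132 s) \<and> \<not> occurs [3, 4, 1, 2] (perm132 s)"
proof (induction s rule: perm132.induct)
  case 1
  have "length ys \<le> 1" if "subseq ys (perm132 [])" for ys using list_emb_length[OF that] by simp
  then show ?case unfolding occurs_132 occurs_3412 by fastforce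
next
  case (2 s)
  let ?xs = "map (\<lambda>x. x + 1) (perm132 s)"
  have "\<forall>x\<in>set ?xs. 1 < x" using perm_le[OF is_perm_perm132[of s]] by fastforce
  then show ?case
    using 2 occurs_132_snoc[of ?xs 1] occurs_3412_snoc[of ?xs 1]
    unfolding perm132.simps skew_sum_1 occurs_map[OF strict_mono_shift] by blast
next
  case (3 k s)
  let ?n = "length (perm132 s)"
  have le: "\<forall>x\<in>set (perm132 s). x < Suc ?n" using perm_le[OF is_perm_perm132[of s]] by fastforce
  have D: "\<forall>d\<in>set (map (\<lambda>x. x + Suc ?n) (decreasing k)). \<forall>q\<in>set (perm132 s @ [Suc ?n]). q < d"
    using le decreasing_shift(2)[of _ "Suc ?n" k] by fastforce
  show ?case
    unfolding perm132_High
    using 3 occurs_132_decreasing_append[OF decreasing_shift(1) D]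
      occurs_3412_decreasing_append[OF decreasing_shift(1) D]
      occurs_132_snoc[of "perm132 s" "Suc ?n"] occurs_3412_snoc[of "perm132 s" "Suc ?n"] le by blast
qed

lemma perm312_avoids: "\<not> occurs [3, 1, 2] (perm312 s) \<and> \<not> occurs [1, 3, 4, 2] (perm312 s)"
proof (induction s rule: perm312.induct)
  case 1
  have "length ys \<le> 1" if "subseq ys (perm312 [])" for ys using list_emb_length[OF that] by simp
  then show ?case unfolding occurs_312 occurs_1342 by fastforce
next
  case (2 s)
  let ?xs = "map (\<lambda>x. x + 1) (perm312 s)"
  have "\<forall>x\<in>set ?xs. 1 < x" using perm_le[OF is_perm_perm312[of s]] by fastforce
  then show ?case
    using 2 occurs_312_snoc[of ?xs 1] occurs_1342_snoc[of ?xs 1]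
    unfolding perm312.simps skew_sum_1 occurs_map[OF strict_mono_shift] by blast
next
  case (3 k s)
  let ?n = "length (perm312 s)"
  have D: "\<forall>d\<in>set (map (\<lambda>x. x + ?n) (decreasing (Suc k))). \<forall>q\<in>set (perm312 s). q < d"
    using perm_le[OF is_perm_perm312[of s]] decreasing_shift(2)[of _ ?n "Suc k"]
    by (meson le_less_trans)
  show ?case
    unfolding perm312_High
    using 3 occurs_312_append_decreasing[OF decreasing_shift(1) D]
      occurs_1342_append_decreasing[OF decreasing_shift(1) D] by blast
qed

section \<open>Unique coding of the nonempty members by words\<close>

lemma filter_partition:
  assumes "\<And>a b. subseq [a, b] xs \<Longrightarrow> \<not> (P b \<and> Q a)" "\<And>x. x \<in> set xs \<Longrightarrow> Q x \<longleftrightarrow> \<not> P x"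
  shows "xs = filter P xs @ filter Q xs"
  using assms
proof (induction xs)
  case (Cons x xs)
  have "xs = filter P xs @ filter Q xs"
  proof (rule Cons.IH)
    show "\<not> (P b \<and> Q a)" if "subseq [a, b] xs" for a b
      by (rule Cons.prems(1)) (rule list_emb_Cons[OF that])
  qed (use Cons.prems(2) in simp)
  moreover have "\<not> P b" if "Q x" "b \<in> set xs" for b
    using Cons.prems(1)[of x b] that by (auto simp: subseq_singleton_left)
  then have "Q x \<Longrightarrow> filter P xs = []" by (simp add: filter_empty_conv)
  ultimately show ?case using Cons.prems(2)[of x] by (cases "P x") auto
qed simp

lemma decreasingI: "(\<And>x y. subseq [x, y] xs \<Longrightarrow> y < x) \<Longrightarrow> sorted_wrt (>) (xs :: nat list)"
proof (induction xs)
  case (Cons x xs)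
  have "y < x" if "y \<in> set xs" for y
    using Cons.prems[of x y] that by (simp add: subseq_singleton_left)
  moreover have "sorted_wrt (>) xs"
    by (rule Cons.IH, rule Cons.prems, rule list_emb_Cons)
  ultimately show ?case by simp
qed simp

lemma decreasing_unique:
  assumes "sorted_wrt (>) xs" "set xs = {Suc m..m + k}"
  shows "xs = map (\<lambda>x. x + m) (decreasing k)"
proof -
  have "set (map (\<lambda>x. x + m) (decreasing k)) = set xs"
    using image_add_atLeastAtMost[of m 1 k] assms(2) by (simp add: decreasing_def atLeastLessThanSuc_atLeastAtMost add.commute del: upt_Suc)
  then have "rev xs = rev (map (\<lambda>x. x + m) (decreasing k))"
    using assms(1) decreasing_shift(1)[of m k]
    by (intro strict_sorted_equal) (simp_all add: sorted_wrt_rev)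
  then show ?thesis by simp
qed

lemma perm_last_1:
  assumes "is_perm (xs @ [1])"
  shows "\<exists>\<sigma>. is_perm \<sigma> \<and> xs = map (\<lambda>x. x + 1) \<sigma> \<and> xs @ [1] = skew_sum \<sigma> [1]"
proof -
  let ?s = "map (\<lambda>x. x - 1) xs"
  have d: "distinct xs" "1 \<notin> set xs" and s: "insert 1 (set xs) = {1..Suc (length xs)}"
    using assms by (auto simp: is_perm_iff)
  have pos: "x \<in> {2..Suc (length xs)}" if "x \<in> set xs" for x
  proof -
    have "x \<in> {1..Suc (length xs)}" "x \<noteq> 1" using s d(2) that by auto
    then show ?thesis by auto
  qed
  have xs: "map (\<lambda>x. x + 1) ?s = xs"
    unfolding map_map by (rule map_idI) (use pos in fastforce)
  have "is_perm ?s"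
  proof -
    have "set xs = {1..Suc (length xs)} - {1}" using s d(2) by auto
    also have "\<dots> = {Suc 1..Suc (length xs)}" by auto
    also have "\<dots> = Suc ` {1..length xs}" by (simp only: image_Suc_atLeastAtMost)
    finally have "set ?s = (\<lambda>x. x - 1) ` Suc ` {1..length xs}" by (simp only: set_map)
    moreover have "(\<lambda>x. x - 1) ` Suc ` {1..length xs} = {1..length xs}" unfolding image_image by simp
    ultimately have "set ?s = {1..length ?s}" by (simp only: length_map)
    moreover have "distinct ?s" using d(1) xs by (metis distinct_map)
    ultimately show ?thesis by (simp add: is_perm_iff)
  qed
  then show ?thesis unfolding skew_sum_1 using xs by metis
qed

lemma perm_last:
  assumes "is_perm (xs @ [v])"
  shows "set (filter (\<lambda>x. x < v) xs) = {1..v - 1}" "set (filter (\<lambda>x. v < x) xs) = {Suc v..Suc (length xs)}"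
    "distinct xs" "v \<notin> set xs" "1 \<le> v" "v \<le> Suc (length xs)"
proof -
  have d: "distinct xs" "v \<notin> set xs" and s: "insert v (set xs) = {1..Suc (length xs)}"
    using assms by (auto simp: is_perm_iff)
  have S: "set xs = {1..Suc (length xs)} - {v}" and v: "v \<in> {1..Suc (length xs)}"
    using s d by auto
  show "set (filter (\<lambda>x. x < v) xs) = {1..v - 1}" unfolding set_filter S using v by auto
  show "set (filter (\<lambda>x. v < x) xs) = {Suc v..Suc (length xs)}" unfolding set_filter S using v by auto
  show "distinct xs" "v \<notin> set xs" using d .
  show "1 \<le> v" "v \<le> Suc (length xs)" using v by simp_all
qed

text \<open>The decomposition is read at the last entry \<open>v\<close>. If \<open>v = 1\<close>,
  the last step is \<open>Low\<close>. Otherwise avoiding 132 puts the entries above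
  \<open>v\<close> before those below it, and avoiding 3412 makes the former decreasing: an ascent
  among them followed by 1 and \<open>v\<close> would be a copy.\<close>

lemma perm132_surj:
  "is_perm \<pi> \<Longrightarrow> \<pi> \<noteq> [] \<Longrightarrow> \<not> occurs [1, 3, 2] \<pi> \<Longrightarrow> \<not> occurs [3, 4, 1, 2] \<pi> \<Longrightarrow> \<exists>s. \<pi> = perm132 s"
proof (induction "length \<pi>" arbitrary: \<pi> rule: less_induct)
  case less
  obtain xs v where \<pi>: "\<pi> = xs @ [v]" using less.prems(2) by (cases \<pi> rule: rev_cases) auto
  note p = perm_last[OF less.prems(1)[unfolded \<pi>]]
  let ?small = "filter (\<lambda>x. x < v) xs" and ?big = "filter (\<lambda>x. v < x) xs"
  show ?case
  proof (cases "v = 1")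
    case True
    then obtain \<sigma> where \<sigma>: "is_perm \<sigma>" "xs = map (\<lambda>x. x + 1) \<sigma>" "\<pi> = skew_sum \<sigma> [1]"
      using perm_last_1[of xs] less.prems(1) \<pi> by auto
    show ?thesis
    proof (cases "\<sigma> = []")
      case True
      then have "\<pi> = perm132 []" using \<sigma> by (simp add: skew_sum_def)
      then show ?thesis by blast
    next
      case False
      have "occurs \<tau> \<pi>" if "occurs \<tau> \<sigma>" for \<tau>
      proof -
        have "occurs \<tau> xs" unfolding \<sigma>(2) using that occurs_map[OF strict_mono_shift] by blast
        then show ?thesis unfolding \<pi> by (rule occurs_mono) (simp add: subseq_rev_drop_many)
      qed
      moreover have "length \<sigma> < length \<pi>" by (simp add: \<sigma>(3) skew_sum_def)
      ultimately have "\<exists>s. \<sigma> = perm132 s"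
        using less.hyps[of \<sigma>] \<sigma>(1) False less.prems(3,4) by blast
      then show ?thesis using \<sigma>(3) by (metis perm132.simps(2))
    qed
  next
    case False
    have "xs = ?big @ ?small"
    proof (rule filter_partition)
      fix a b assume ab: "subseq [a, b] xs"
      show "\<not> (v < b \<and> a < v)"
      proof
        assume "v < b \<and> a < v"
        moreover have "subseq ([a, b] @ [v]) (xs @ [v])" using ab by (simp only: subseq_append)
        ultimately show False using less.prems(3) unfolding \<pi> occurs_132 by auto
      qed
    qed (use p(4) in \<open>metis linorder_neqE_nat less_asym\<close>)
    then have \<pi>': "\<pi> = ?big @ (?small @ [v])" unfolding \<pi> by simp
    have len: "length ?small = v - 1"
      using p(1) distinct_card[of ?small] p(3) by simp
    have "1 \<in> set ?small" unfolding p(1) using p(5) False by auto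
    then have one: "subseq [1] ?small" by (simp only: subseq_singleton_left)
    have "sorted_wrt (>) ?big"
    proof (rule decreasingI)
      fix x y assume xy: "subseq [x, y] ?big"
      have "distinct ?big" using p(3) by simp
      then have "distinct [x, y]" using xy distinct_nthsI unfolding subseq_conv_nths by metis
      moreover have "\<not> x < y"
      proof
        assume "x < y"
        have "subseq ([x, y] @ ([1] @ [v])) \<pi>"
          unfolding \<pi>' using xy one by (intro list_emb_append_mono) auto
        then have "subseq [x, y, 1, v] \<pi>" by simp
        moreover have "v < x" "1 < v" using subseq_set[OF xy] False p(5) by auto
        ultimately have "occurs [3, 4, 1, 2] \<pi>" unfolding occurs_3412 using \<open>x < y\<close> by blast
        then show False using less.prems(4) by contradiction
      qed
      ultimately show "y < x" by auto
    qed
    moreover have "set ?big = {Suc v..v + (Suc (length xs) - v)}" using p(2,6) by simp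
    ultimately have big: "?big = map (\<lambda>x. x + v) (decreasing (Suc (length xs) - v))"
      by (rule decreasing_unique)
    have small: "is_perm ?small" using p(1,3) len by (simp add: is_perm_iff)
    have "occurs \<tau> \<pi>" if "occurs \<tau> ?small" for \<tau>
      using that unfolding \<pi> by (rule occurs_mono) (auto intro: subseq_rev_drop_many)
    moreover have "length ?small < length \<pi>" using len p(6) \<pi> by simp
    moreover have "?small \<noteq> []" using one by auto
    ultimately obtain s where s: "?small = perm132 s"
      using less.hyps[of ?small] small less.prems by blast
    have "Suc (length (perm132 s)) = v" using len p(5) s by simp
    then have "\<pi> = perm132 (High (Suc (length xs) - v) # s)"
      unfolding perm132_High using \<pi>' s big by simp
    then show ?thesis by blast
  qed
qed

text \<open>Here avoiding 312 puts the entries below \<open>v\<close> first, and an ascent among the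
  entries above \<open>v\<close>, preceded by 1 and followed by \<open>v\<close>, would be a copy of
  1342.\<close>

lemma perm312_surj:
  "is_perm \<pi> \<Longrightarrow> \<pi> \<noteq> [] \<Longrightarrow> \<not> occurs [3, 1, 2] \<pi> \<Longrightarrow> \<not> occurs [1, 3, 4, 2] \<pi> \<Longrightarrow> \<exists>s. \<pi> = perm312 s"
proof (induction "length \<pi>" arbitrary: \<pi> rule: less_induct)
  case less
  obtain xs v where \<pi>: "\<pi> = xs @ [v]" using less.prems(2) by (cases \<pi> rule: rev_cases) auto
  note p = perm_last[OF less.prems(1)[unfolded \<pi>]]
  let ?small = "filter (\<lambda>x. x < v) xs" and ?big = "filter (\<lambda>x. v < x) xs"
  show ?case
  proof (cases "v = 1")
    case True
    then obtain \<sigma> where \<sigma>: "is_perm \<sigma>" "xs = map (\<lambda>x. x + 1) \<sigma>" "\<pi> = skew_sum \<sigma> [1]"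
      using perm_last_1[of xs] less.prems(1) \<pi> by auto
    show ?thesis
    proof (cases "\<sigma> = []")
      case True
      then have "\<pi> = perm312 []" using \<sigma> by (simp add: skew_sum_def)
      then show ?thesis by blast
    next
      case False
      have "occurs \<tau> \<pi>" if "occurs \<tau> \<sigma>" for \<tau>
      proof -
        have "occurs \<tau> xs" unfolding \<sigma>(2) using that occurs_map[OF strict_mono_shift] by blast
        then show ?thesis unfolding \<pi> by (rule occurs_mono) (simp add: subseq_rev_drop_many)
      qed
      moreover have "length \<sigma> < length \<pi>" by (simp add: \<sigma>(3) skew_sum_def)
      ultimately have "\<exists>s. \<sigma> = perm312 s"
        using less.hyps[of \<sigma>] \<sigma>(1) False less.prems(3,4) by blast
      then show ?thesis using \<sigma>(3) by (metis perm312.simps(2))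
    qed
  next
    case False
    have "xs = ?small @ ?big"
    proof (rule filter_partition)
      fix a b assume ab: "subseq [a, b] xs"
      show "\<not> (b < v \<and> v < a)"
      proof
        assume "b < v \<and> v < a"
        moreover have "subseq ([a, b] @ [v]) (xs @ [v])" using ab by (simp only: subseq_append)
        ultimately show False using less.prems(3) unfolding \<pi> occurs_312 by auto
      qed
    qed (use p(4) in \<open>metis linorder_neqE_nat less_asym\<close>)
    then have \<pi>': "\<pi> = ?small @ (?big @ [v])" unfolding \<pi> by simp
    have len: "length ?small = v - 1"
      using p(1) distinct_card[of ?small] p(3) by simp
    have "1 \<in> set ?small" unfolding p(1) using p(5) False by auto
    then have one: "subseq [1] ?small" by (simp only: subseq_singleton_left)
    have "sorted_wrt (>) ?big"
    proof (rule decreasingI)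
      fix x y assume xy: "subseq [x, y] ?big"
      have "distinct ?big" using p(3) by simp
      then have "distinct [x, y]" using xy distinct_nthsI unfolding subseq_conv_nths by metis
      moreover have "\<not> x < y"
      proof
        assume "x < y"
        have "subseq ([1] @ ([x, y] @ [v])) \<pi>"
          unfolding \<pi>' using xy one by (intro list_emb_append_mono) auto
        then have "subseq [1, x, y, v] \<pi>" by simp
        moreover have "v < x" "1 < v" using subseq_set[OF xy] False p(5) by auto
        ultimately have "occurs [1, 3, 4, 2] \<pi>" unfolding occurs_1342 using \<open>x < y\<close> by blast
        then show False using less.prems(4) by contradiction
      qed
      ultimately show "y < x" by auto
    qed
    \<comment> \<open>The last entry \<open>v\<close> is the lowest point of the decreasing block,
      which therefore sits above \<open>v - 1\<close> and has one point more than
      \<open>?big\<close>.\<close>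
    then have "sorted_wrt (>) (?big @ [v])" by (auto simp: sorted_wrt_append)
    moreover have "{Suc (v - 1)..(v - 1) + Suc (Suc (length xs) - v)} = insert v {Suc v..Suc (length xs)}"
      using p(5,6) by auto
    then have "set (?big @ [v]) = {Suc (v - 1)..(v - 1) + Suc (Suc (length xs) - v)}"
      by (simp only: set_append p(2)) simp
    ultimately have big: "?big @ [v] = map (\<lambda>x. x + (v - 1)) (decreasing (Suc (Suc (length xs) - v)))"
      by (rule decreasing_unique)
    have small: "is_perm ?small" using p(1,3) len by (simp add: is_perm_iff)
    have "occurs \<tau> \<pi>" if "occurs \<tau> ?small" for \<tau>
      using that unfolding \<pi> by (rule occurs_mono) (auto intro: subseq_rev_drop_many)
    moreover have "length ?small < length \<pi>" using len p(6) \<pi> by simp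
    moreover have "?small \<noteq> []" using one by auto
    ultimately obtain s where s: "?small = perm312 s"
      using less.hyps[of ?small] small less.prems by blast
    have "length (perm312 s) = v - 1" using len s by simp
    then have "\<pi> = perm312 (High (Suc (length xs) - v) # s)"
      unfolding perm312_High using \<pi>' s big by simp
    then show ?thesis by blast
  qed
qed

lemma length_perm132:
  "length (perm132 (Low # s)) = Suc (length (perm132 s))" "length (perm132 (High k # s)) = length (perm132 s) + Suc k"
  by (simp_all add: skew_sum_def direct_sum_def)

lemma perm132_nonempty: "0 < length (perm132 s)"
  by (cases s rule: perm132.cases) (simp_all add: length_perm132 del: perm132.simps(2,3))

lemma last_perm132: "last (perm132 (Low # s)) = 1" "last (perm132 (High k # s)) = Suc (length (perm132 s))"
  by (simp_all add: skew_sum_def direct_sum_def)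

text \<open>The last entry identifies the outermost step: it is 1 after \<open>Low\<close> and, by
  nonemptiness, larger after \<open>High k\<close>. In the latter case it gives the length of the
  inner permutation, and the total length then gives \<open>k\<close>.\<close>

lemma perm132_inj: "perm132 s = perm132 t \<Longrightarrow> s = t"
proof (induction s arbitrary: t rule: perm132.induct)
  case 1
  then have "length (perm132 t) = 1" by (metis length_Cons list.size(3) One_nat_def perm132.simps(1))
  then show ?case
    using perm132_nonempty by (cases t rule: perm132.cases) (simp_all add: length_perm132 del: perm132.simps(2,3))
next
  case (2 s)
  show ?case
  proof (cases t rule: perm132.cases)
    case 1
    then show ?thesis using arg_cong[OF 2(2), of length] perm132_nonempty[of s] by (simp add: length_perm132 del: perm132.simps(2,3))
  next
    case (2 t')
    then have "perm132 s = perm132 t'" using "2.prems" by (simp add: skew_sum_def)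
    then show ?thesis using "2.IH" 2 by simp
  next
    case (3 k t')
    then show ?thesis using arg_cong[OF 2(2), of last] perm132_nonempty[of t'] by (simp add: last_perm132 del: perm132.simps(2,3))
  qed
next
  case (3 k s)
  show ?case
  proof (cases t rule: perm132.cases)
    case 1
    then show ?thesis using arg_cong[OF 3(2), of length] perm132_nonempty[of s] by (simp add: length_perm132 del: perm132.simps(2,3))
  next
    case (2 t')
    then show ?thesis using arg_cong[OF 3(2), of last] perm132_nonempty[of s] by (simp add: last_perm132 del: perm132.simps(2,3))
  next
    case (3 l t')
    have e: "perm132 (High k # s) = perm132 (High l # t')" using "3.prems" 3 by simp
    then have l: "length (perm132 s) = length (perm132 t')"
      by (metis last_perm132(2) nat.inject)
    moreover have "k = l" using arg_cong[OF e, of length] l by (simp only: length_perm132)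
    ultimately have "perm132 s = perm132 t'" using e unfolding perm132_High by simp
    then show ?thesis using "3.IH" \<open>k = l\<close> 3 by simp
  qed
qed

lemma last_decreasing: "decreasing (Suc k) \<noteq> []" "last (decreasing (Suc k)) = 1"
  by (simp_all add: decreasing_def last_rev del: upt_Suc)

lemma length_perm312:
  "length (perm312 (Low # s)) = Suc (length (perm312 s))" "length (perm312 (High k # s)) = length (perm312 s) + Suc k"
  by (simp_all add: skew_sum_def direct_sum_def)

lemma perm312_nonempty: "0 < length (perm312 s)"
  by (cases s rule: perm312.cases) (simp_all add: length_perm312 del: perm312.simps(2,3))

lemma last_perm312: "last (perm312 (Low # s)) = 1" "last (perm312 (High k # s)) = Suc (length (perm312 s))"
  by (simp_all add: skew_sum_def direct_sum_def last_map last_decreasing)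

lemma perm312_inj: "perm312 s = perm312 t \<Longrightarrow> s = t"
proof (induction s arbitrary: t rule: perm312.induct)
  case 1
  then have "length (perm312 t) = 1" by (metis length_Cons list.size(3) One_nat_def perm312.simps(1))
  then show ?case
    using perm312_nonempty by (cases t rule: perm312.cases) (simp_all add: length_perm312 del: perm312.simps(2,3))
next
  case (2 s)
  show ?case
  proof (cases t rule: perm312.cases)
    case 1
    then show ?thesis using arg_cong[OF 2(2), of length] perm312_nonempty[of s] by (simp add: length_perm312 del: perm312.simps(2,3))
  next
    case (2 t')
    then have "perm312 s = perm312 t'" using "2.prems" by (simp add: skew_sum_def)
    then show ?thesis using "2.IH" 2 by simp
  next
    case (3 k t')
    then show ?thesis using arg_cong[OF 2(2), of last] perm312_nonempty[of t'] by (simp add: last_perm312 del: perm312.simps(2,3))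
  qed
next
  case (3 k s)
  show ?case
  proof (cases t rule: perm312.cases)
    case 1
    then show ?thesis using arg_cong[OF 3(2), of length] perm312_nonempty[of s] by (simp add: length_perm312 del: perm312.simps(2,3))
  next
    case (2 t')
    then show ?thesis using arg_cong[OF 3(2), of last] perm312_nonempty[of s] by (simp add: last_perm312 del: perm312.simps(2,3))
  next
    case (3 l t')
    have e: "perm312 (High k # s) = perm312 (High l # t')" using "3.prems" 3 by simp
    then have l: "length (perm312 s) = length (perm312 t')"
      by (metis last_perm312(2) nat.inject)
    moreover have "k = l" using arg_cong[OF e, of length] l by (simp only: length_perm312)
    ultimately have "perm312 s = perm312 t'" using e unfolding perm312_High by simp
    then show ?thesis using "3.IH" \<open>k = l\<close> 3 by simp
  qed
qed

section \<open>The admissible patterns\<close>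

text \<open>A skew sum is taken only on top of a direct sum with nonempty \<open>Y\<close>, because
  the arguments about decreasing runs need an ascent before the last letter. The pattern 21 has none
  and is a base case.\<close>

inductive alternating :: "perm \<Rightarrow> bool" where
  "alternating [1]"
| "alternating [2, 1]"
| "alternating Y \<Longrightarrow> alternating (direct_sum Y [1])"
| "alternating Y \<Longrightarrow> alternating (skew_sum (direct_sum Y [1]) [1])"

lemma is_perm_21: "is_perm [2, 1]"
  by (auto simp: is_perm_iff)

lemma alternating_perm: "alternating X \<Longrightarrow> is_perm X"
  by (induction rule: alternating.induct)
     (use is_perm_single is_perm_21 in \<open>auto intro!: is_perm_direct_sum is_perm_skew_sum simp del: One_nat_def\<close>)

lemma alternating_nonempty: "alternating X \<Longrightarrow> X \<noteq> []"
  by (induction rule: alternating.induct) (auto simp: direct_sum_def skew_sum_def)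

lemma occurs_21_iff_not_sorted: "occurs [2, 1] xs \<longleftrightarrow> \<not> sorted xs"
proof
  assume "occurs [2, 1] xs"
  then obtain a b where "subseq [a, b] xs" "b < a" unfolding occurs_21 by blast
  then have "sorted xs \<Longrightarrow> sorted [a, b]" by (metis subseq_conv_nths sorted_nths)
  then show "\<not> sorted xs" using \<open>b < a\<close> by auto
next
  show "\<not> sorted xs \<Longrightarrow> occurs [2, 1] xs"
  proof (induction xs)
    case (Cons x xs)
    then consider "\<not> sorted xs" | y where "y \<in> set xs" "y < x" by fastforce
    then show ?case
    proof cases
      case 1
      then show ?thesis using Cons.IH occurs_mono[of _ xs "x # xs"] by auto
    next
      case 2
      then have "subseq [x, y] (x # xs)" by (simp add: subseq_singleton_left)
      then show ?thesis using 2 unfolding occurs_21 by blast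
    qed
  qed simp
qed

lemma occurs_length: "occurs \<tau> xs \<Longrightarrow> length \<tau> \<le> length xs"
  unfolding occurs_def similar_def using list_emb_length by metis

lemma perm_less: "is_perm \<pi> \<Longrightarrow> \<forall>x\<in>set \<pi>. x < Suc (length \<pi>)"
  using perm_le by fastforce

text \<open>On either side a \<open>Low\<close> step strips a final minimum from the pattern and
  ignores a pattern ending in its maximum; a \<open>High\<close> step does the reverse. Hence the
  induction is over all patterns at once. For 21 containment means not being sorted: this always
  holds after \<open>Low\<close>, and after \<open>High k\<close> unless \<open>k = 0\<close> and
  the inner permutation is sorted.\<close>

lemma contains_perm132_iff_perm312:
  "alternating X \<Longrightarrow> contains (perm132 s) X \<longleftrightarrow> contains (perm312 s) X"
  unfolding contains_iff_occurs
proof (induction s arbitrary: X)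
  case Nil
  then show ?case by simp
next
  case (Cons w s)
  let ?p = "perm132 s" and ?q = "perm312 s"
  show ?case
  proof (cases w)
    case Low
    have min: "\<forall>x\<in>set (map (\<lambda>x. x + 1) p). 1 < x" if "is_perm p" for p
      using perm_le[OF that] by fastforce
    have eq: "perm132 (w # s) = map (\<lambda>x. x + 1) ?p @ [1]" "perm312 (w # s) = map (\<lambda>x. x + 1) ?q @ [1]"
      unfolding Low perm132.simps perm312.simps skew_sum_1 by (rule refl)+
    show ?thesis
      using Cons.prems
    proof (cases rule: alternating.cases)
      case 1
      show ?thesis unfolding 1 eq occurs_1 by simp
    next
      case 2
      have "\<not> sorted (map (\<lambda>x. x + 1) p @ [1])" if "is_perm p" "p \<noteq> []" for p
        using min[OF that(1)] that(2) by (cases p) (auto simp: sorted_append)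
      then show ?thesis
        unfolding 2 eq occurs_21_iff_not_sorted
        using is_perm_perm132[of s] is_perm_perm312[of s] perm132_nonempty[of s] perm312_nonempty[of s] by blast
    next
      case (3 Y)
      note Y = alternating_perm[OF 3(2)] alternating_nonempty[OF 3(2)]
      show ?thesis
        using Cons.IH[OF Cons.prems]
        unfolding eq 3(1) occurs_direct_snoc_min[OF Y min[OF is_perm_perm132]]
          occurs_direct_snoc_min[OF Y min[OF is_perm_perm312]] occurs_map[OF strict_mono_shift] .
    next
      case (4 Y)
      then have "alternating (direct_sum Y [1])" by (intro alternating.intros)
      note Y = alternating_perm[OF this] Cons.IH[OF this]
      show ?thesis
        unfolding eq 4(1) occurs_skew_snoc_min[OF Y(1) min[OF is_perm_perm132]]
          occurs_skew_snoc_min[OF Y(1) min[OF is_perm_perm312]] occurs_map[OF strict_mono_shift] by (rule Y)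
    qed
  next
    case (High k)
    let ?D = "map (\<lambda>x. x + Suc (length ?p)) (decreasing k)"
    let ?E = "map (\<lambda>x. x + length ?q) (decreasing (Suc k))"
    have eq: "perm132 (w # s) = ?D @ (?p @ [Suc (length ?p)])" "perm312 (w # s) = ?q @ ?E"
      unfolding High by (rule perm132_High, rule perm312_High)
    note max = perm_less[OF is_perm_perm132[of s]]
    have D: "\<forall>d\<in>set ?D. \<forall>q\<in>set (?p @ [Suc (length ?p)]). q < d"
      using max decreasing_shift(2)[of _ "Suc (length ?p)" k] by fastforce
    have E: "\<forall>d\<in>set ?E. \<forall>q\<in>set ?q. q < d"
      using perm_less[OF is_perm_perm312[of s]] decreasing_shift(2)[of _ "length ?q" "Suc k"]
      by (meson less_Suc_eq_le le_less_trans)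
    have E': "?E \<noteq> []" using last_decreasing(1) by simp
    show ?thesis
      using Cons.prems
    proof (cases rule: alternating.cases)
      case 1
      show ?thesis unfolding 1 eq occurs_1 using E' by simp
    next
      case 2
      have "sorted (perm132 (w # s)) \<longleftrightarrow> k = 0 \<and> sorted ?p"
      proof (cases k)
        case 0
        then show ?thesis unfolding eq using max by (auto simp: sorted_append decreasing_def intro: less_imp_le)
      next
        case (Suc j)
        then have "last (decreasing k) \<in> set (decreasing k)" using last_decreasing(1) last_in_set by blast
        then obtain d where "d \<in> set ?D" by auto
        then have "\<not> sorted (perm132 (w # s))"
          unfolding eq using D by (fastforce simp: sorted_append)
        then show ?thesis using Suc by simp
      qed
      moreover have "sorted (perm312 (w # s)) \<longleftrightarrow> k = 0 \<and> sorted ?q"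
      proof (cases k)
        case 0
        then have "?E = [Suc (length ?q)]" by (simp add: decreasing_def)
        then show ?thesis unfolding eq using perm_less[OF is_perm_perm312[of s]] 0
          by (auto simp: sorted_append intro: less_imp_le)
      next
        case (Suc j)
        then have "\<not> sorted ?E" by (simp add: decreasing_def sorted_append)
        then show ?thesis unfolding eq using Suc by (simp only: sorted_append) simp
      qed
      moreover have "sorted ?p \<longleftrightarrow> sorted ?q"
        using Cons.IH[OF alternating.intros(2)] unfolding occurs_21_iff_not_sorted by blast
      ultimately show ?thesis unfolding 2 occurs_21_iff_not_sorted by blast
    next
      case (3 Y)
      note Y = alternating_perm[OF 3(2)] alternating_nonempty[OF 3(2)]
      show ?thesis
        using Cons.IH[OF 3(2)]
        unfolding eq 3(1) occurs_direct_decreasing_append[OF Y decreasing_shift(1) D]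
          occurs_direct_snoc_max[OF Y(1) max]
          occurs_direct_append_decreasing[OF Y decreasing_shift(1) E E'] .
    next
      case (4 Y)
      note Y = alternating_perm[OF 4(2)] alternating_nonempty[OF 4(2)]
      have "alternating (direct_sum Y [1])" using 4 by (intro alternating.intros)
      note Y1 = alternating_perm[OF this] alternating_nonempty[OF this]
      show ?thesis
        using Cons.IH[OF Cons.prems]
        unfolding eq 4(1) occurs_skew_decreasing_append[OF Y decreasing_shift(1) D]
          occurs_skew_snoc_max[OF Y1 max]
          occurs_skew_append_decreasing[OF Y decreasing_shift(1) E] .
    qed
  qed
qed

text \<open>This places the alternating patterns in the domain of \<open>swl\<close>.\<close>

lemma alternating_avoids_132: "alternating X \<Longrightarrow> \<not> occurs [1, 3, 2] X"
proof (induction rule: alternating.induct)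
  case (3 Y)
  then show ?case
    using occurs_132_snoc perm_less[OF alternating_perm[OF 3(1)]] unfolding direct_sum_1 by blast
next
  case (4 Y)
  then have Y: "\<not> occurs [1, 3, 2] (direct_sum Y [1])"
    using occurs_132_snoc perm_less[OF alternating_perm[OF 4(1)]] unfolding direct_sum_1 by blast
  have "is_perm (direct_sum Y [1])" by (rule is_perm_direct_sum[OF alternating_perm[OF 4(1)] is_perm_single])
  from perm_le[OF this] have "\<forall>x\<in>set (map (\<lambda>x. x + 1) (direct_sum Y [1])). 1 < x" by fastforce
  then show ?case
    unfolding skew_sum_1[of "direct_sum Y [1]"]
    using Y occurs_132_snoc[of "map (\<lambda>x. x + 1) (direct_sum Y [1])" 1] occurs_map[OF strict_mono_shift] by blast
qed (auto dest: occurs_length)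

section \<open>Rotation and the patterns \<open>chi_tilde\<close>\<close>

lemma perm_inverse_nth:
  assumes "is_perm \<pi>" "i < length \<pi>"
  shows "perm_inverse \<pi> ! (\<pi> ! i - 1) = Suc i"
proof -
  have v: "1 \<le> \<pi> ! i" "\<pi> ! i \<le> length \<pi>" using perm_le[OF assms(1)] assms(2) by auto
  have "inv_into {1..length \<pi>} (entry \<pi>) (entry \<pi> (Suc i)) = Suc i"
    using entry_bij[OF assms(1)] assms(2) by (intro inv_into_f_f) (auto simp: bij_betw_def)
  then show ?thesis using entry_perm_inverse[of "\<pi> ! i" \<pi>] v by (simp add: entry_def)
qed

lemma perm_inverse_eqI:
  assumes p: "is_perm \<pi>" and len: "length \<kappa> = length \<pi>"
    and inv: "\<And>i. i < length \<pi> \<Longrightarrow> \<kappa> ! (\<pi> ! i - 1) = Suc i"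
  shows "perm_inverse \<pi> = \<kappa>"
proof (rule nth_equalityI)
  fix j assume "j < length (perm_inverse \<pi>)"
  then have "Suc j \<in> set \<pi>" using p by (simp add: is_perm_iff)
  then obtain i where "i < length \<pi>" "\<pi> ! i = Suc j" by (metis in_set_conv_nth)
  then show "perm_inverse \<pi> ! j = \<kappa> ! j"
    using inv[of i] perm_inverse_nth[OF p, of i] by simp
qed (simp add: len)

lemma is_perm_perm_inverse: "is_perm \<pi> \<Longrightarrow> is_perm (perm_inverse \<pi>)"
proof -
  assume "is_perm \<pi>"
  then have "bij_betw (inv_into {1..length \<pi>} (entry \<pi>)) {1..length \<pi>} {1..length \<pi>}"
    by (intro bij_betw_inv_into entry_bij)
  then show ?thesis
    unfolding is_perm_iff length_perm_inverse
    by (simp add: perm_inverse_def distinct_map bij_betw_def atLeastLessThanSuc_atLeastAtMost del: upt_Suc)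
qed

lemma perm_inverse_direct_sum_1:
  assumes "is_perm \<pi>"
  shows "perm_inverse (direct_sum \<pi> [1]) = direct_sum (perm_inverse \<pi>) [1]"
proof (rule perm_inverse_eqI)
  show "is_perm (direct_sum \<pi> [1])" by (rule is_perm_direct_sum[OF assms is_perm_single])
  show "length (direct_sum (perm_inverse \<pi>) [1]) = length (direct_sum \<pi> [1])"
    by (simp add: direct_sum_def)
  fix i assume i: "i < length (direct_sum \<pi> [1])"
  show "direct_sum (perm_inverse \<pi>) [1] ! (direct_sum \<pi> [1] ! i - 1) = Suc i"
  proof (cases "i < length \<pi>")
    case True
    then have "\<pi> ! i - 1 < length \<pi>" using perm_le[OF assms, of "\<pi> ! i"] by fastforce
    then show ?thesis using True perm_inverse_nth[OF assms True] unfolding direct_sum_1 by (simp add: nth_append)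
  next
    case False
    then have "i = length \<pi>" using i by (simp add: direct_sum_def)
    then show ?thesis unfolding direct_sum_1 by (simp add: nth_append)
  qed
qed

lemma perm_inverse_skew_sum_1:
  assumes "is_perm \<pi>"
  shows "perm_inverse (skew_sum [1] \<pi>) = skew_sum (perm_inverse \<pi>) [1]"
proof (rule perm_inverse_eqI)
  have e: "skew_sum [1] \<pi> = Suc (length \<pi>) # \<pi>" by (simp add: skew_sum_def)
  show "is_perm (skew_sum [1] \<pi>)" by (rule is_perm_skew_sum[OF is_perm_single assms])
  show "length (skew_sum (perm_inverse \<pi>) [1]) = length (skew_sum [1] \<pi>)"
    by (simp add: skew_sum_def)
  fix i assume i: "i < length (skew_sum [1] \<pi>)"
  show "skew_sum (perm_inverse \<pi>) [1] ! (skew_sum [1] \<pi> ! i - 1) = Suc i"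
  proof (cases i)
    case 0
    then show ?thesis unfolding e skew_sum_1 by (simp add: nth_append)
  next
    case (Suc j)
    then have j: "j < length \<pi>" using i unfolding e by simp
    then have "\<pi> ! j - 1 < length \<pi>" using perm_le[OF assms, of "\<pi> ! j"] by fastforce
    then show ?thesis using Suc perm_inverse_nth[OF assms j] unfolding e skew_sum_1 by (simp add: nth_append)
  qed
qed

lemma is_perm_rev: "is_perm (rev \<pi>) \<longleftrightarrow> is_perm \<pi>"
  by (simp add: is_perm_iff)

text \<open>A clockwise quarter turn takes a top left corner point to the top right, and in the next
  lemma a top right one to the bottom right. Every point added by \<open>chi\<close> thus becomes a
  last letter in \<open>chi_tilde\<close>.\<close>

lemma rot_inv_skew_sum_1: "is_perm \<pi> \<Longrightarrow> rot_inv (skew_sum [1] \<pi>) = direct_sum (rot_inv \<pi>) [1]"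
  using perm_inverse_direct_sum_1[of "rev \<pi>"]
  by (simp add: rot_inv_def is_perm_rev) (simp add: skew_sum_def direct_sum_def)

lemma rot_inv_direct_sum_1: "is_perm \<pi> \<Longrightarrow> rot_inv (direct_sum \<pi> [1]) = skew_sum (rot_inv \<pi>) [1]"
  using perm_inverse_skew_sum_1[of "rev \<pi>"]
  by (simp add: rot_inv_def is_perm_rev) (simp add: skew_sum_def direct_sum_def)

lemma chi_0: "chi 0 \<pi> = \<pi>"
  by (simp add: chi_def)

lemma chi_Suc: "chi (Suc m) \<pi> = (if even m then skew_sum [1] (chi m \<pi>) else direct_sum (chi m \<pi>) [1])"
proof -
  have "length (filter odd xs) + length (filter even xs) = length xs" for xs :: "nat list"
    using sum_length_filter_compl[of even xs] by (simp add: add.commute)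
  then have "length (chi m \<pi>) = length \<pi> + m" by (simp add: chi_def)
  then show ?thesis by (simp add: chi_def skew_sum_def direct_sum_def)
qed

lemma is_perm_chi: "is_perm \<pi> \<Longrightarrow> is_perm (chi m \<pi>)"
  by (induction m)
     (auto simp: chi_0 chi_Suc is_perm_direct_sum is_perm_skew_sum is_perm_single simp del: One_nat_def)

lemma is_perm_rot: "is_perm \<pi> \<Longrightarrow> is_perm (rot \<pi>)"
  by (simp add: rot_def is_perm_rev is_perm_perm_inverse)

lemma chi_tilde_0: "is_perm \<pi> \<Longrightarrow> chi_tilde 0 \<pi> = \<pi>"
  by (simp add: chi_tilde_def chi_0 rot_inv_rot)

lemma chi_tilde_Suc:
  "is_perm \<pi> \<Longrightarrow> chi_tilde (Suc m) \<pi> =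
    (if even m then direct_sum (chi_tilde m \<pi>) [1] else skew_sum (chi_tilde m \<pi>) [1])"
  by (simp add: chi_tilde_def chi_Suc rot_inv_skew_sum_1 rot_inv_direct_sum_1 is_perm_chi is_perm_rot
      del: One_nat_def)

lemma alternating_chi_tilde:
  assumes "alternating \<pi>"
  shows "alternating (chi_tilde m \<pi>)"
proof -
  note p = alternating_perm[OF assms]
  \<comment> \<open>The induction advances by two, since a skew sum matches a rule only together
    with the direct sum just before it.\<close>
  have e: "alternating (chi_tilde (2 * k) \<pi>)" for k
    by (induction k) (use assms p in \<open>auto simp: chi_tilde_0 chi_tilde_Suc intro: alternating.intros simp del: One_nat_def\<close>)
  then have "alternating (chi_tilde (Suc (2 * k)) \<pi>)" for k
    using p by (simp add: chi_tilde_Suc alternating.intros(3) del: One_nat_def)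
  then show ?thesis using e by (cases "even m") (auto elim!: evenE oddE)
qed

lemma contains_chi_tilde: "is_perm \<pi> \<Longrightarrow> contains (chi_tilde m \<pi>) \<pi>"
proof (induction m)
  case 0
  then show ?case using similar_refl by (auto simp: chi_tilde_0 contains_iff_occurs occurs_def)
next
  case (Suc m)
  let ?c = "chi_tilde m \<pi>"
  have "occurs \<pi> ?c" using Suc by (simp add: contains_iff_occurs)
  then have "occurs \<pi> (?c @ [Suc (length ?c)])" "occurs \<pi> (map (\<lambda>x. x + 1) ?c)"
    unfolding occurs_map[OF strict_mono_shift] by (auto elim: occurs_mono simp: subseq_rev_drop_many)
  moreover from this(2) have "occurs \<pi> (map (\<lambda>x. x + 1) ?c @ [1])"
    by (rule occurs_mono) (simp only: subseq_rev_drop_many subseq_order.refl)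
  ultimately have "occurs \<pi> (direct_sum ?c [1])" "occurs \<pi> (skew_sum ?c [1])"
    unfolding direct_sum_1 skew_sum_1 by blast+
  then show ?case using Suc.prems by (simp add: contains_iff_occurs chi_tilde_Suc del: One_nat_def)
qed

text \<open>The decomposition of \<open>swu\<close> with empty \<open>R\<close>; the next lemma is
  the case of empty \<open>L\<close>. Since \<open>swu\<close> commutes with both operations that
  build \<open>chi\<close>, it fixes \<open>chi m \<pi>\<close> whenever it fixes the core
  \<open>\<pi>\<close>.\<close>

lemma swu_direct_sum_1: "is_perm \<pi> \<Longrightarrow> swu (direct_sum \<pi> [1]) = direct_sum (swu \<pi>) [1]"
  using swu_decomposition[of \<pi> "[]"] by (simp add: swu_Nil skew_sum_def is_perm_iff)

lemma swu_skew_sum_1: "is_perm \<pi> \<Longrightarrow> swu (skew_sum [1] \<pi>) = skew_sum [1] (swu \<pi>)"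
  using swu_decomposition[of "[]" \<pi>] by (simp add: swu_Nil direct_sum_def is_perm_iff)

lemma swu_chi: "is_perm \<pi> \<Longrightarrow> swu \<pi> = \<pi> \<Longrightarrow> swu (chi m \<pi>) = chi m \<pi>"
  by (induction m) (auto simp: chi_0 chi_Suc swu_direct_sum_1 swu_skew_sum_1 is_perm_chi simp del: One_nat_def)

lemma swu_1: "swu [1] = [1]"
  using swu_direct_sum_1[of "[]"] by (simp add: swu_Nil direct_sum_def is_perm_iff)

lemma swu_12: "swu [1, 2] = [1, 2]"
proof -
  have "direct_sum [1] [1] = [1, 2]" by (simp add: direct_sum_def)
  then show ?thesis using swu_direct_sum_1[OF is_perm_single] swu_1 by simp
qed

lemma rot_1: "rot [1] = [1]"
proof -
  have "perm_inverse [1] = [1]" by (rule perm_inverse_eqI[OF is_perm_single]) simp_all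
  then show ?thesis by (simp add: rot_def)
qed

lemma rot_21: "rot [2, 1] = [1, 2]"
proof -
  have "perm_inverse [2, 1] = [2, 1]"
    by (rule perm_inverse_eqI[OF is_perm_21]) (auto simp: less_Suc_eq)
  then show ?thesis by (simp add: rot_def)
qed

lemma swl_chi_tilde:
  assumes "alternating \<pi>" "swu (rot \<pi>) = rot \<pi>"
  shows "swl (chi_tilde m \<pi>) = Some (chi_tilde m \<pi>)"
proof -
  have r: "is_perm (rot \<pi>)" by (rule is_perm_rot[OF alternating_perm[OF assms(1)]])
  have a: "alternating (chi_tilde m \<pi>)" by (rule alternating_chi_tilde[OF assms(1)])
  have "chi_tilde m \<pi> \<in> Av {[1, 3, 2]}"
    using alternating_perm[OF a] alternating_avoids_132[OF a] by (simp add: Av_def contains_iff_occurs)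
  moreover have "rot (chi_tilde m \<pi>) = chi m (rot \<pi>)"
    unfolding chi_tilde_def by (rule rot_rot_inv[OF is_perm_chi[OF r]])
  ultimately show ?thesis
    using swu_chi[OF r assms(2)] by (simp add: swl_def chi_tilde_def)
qed

lemma contains_132_chi_tilde_2431: "contains (chi_tilde m [2, 4, 3, 1]) [1, 3, 2]"
proof (rule contains_trans)
  have "is_perm [2, 4, 3, 1]" by (auto simp: is_perm_iff)
  then show "contains (chi_tilde m [2, 4, 3, 1]) [2, 4, 3, 1]" by (rule contains_chi_tilde)
  have "subseq [2, 4, 3] [2, 4, 3, 1 :: nat]" by simp
  then show "contains [2, 4, 3, 1] [1, 3, 2]"
    unfolding contains_iff_occurs occurs_132 by (intro exI[of _ 2] exI[of _ 4] exI[of _ 3]) simp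
qed

lemma pattern_family_cases:
  assumes "\<tau> \<in> pattern_family"
  shows "alternating \<tau> \<and> swl \<tau> = Some \<tau> \<or> contains \<tau> [1, 3, 2] \<and> swl \<tau> = None"
proof -
  obtain m where "\<tau> = chi_tilde m [1] \<or> \<tau> = chi_tilde m [2, 1] \<or> \<tau> = chi_tilde m [2, 4, 3, 1]"
    using assms by (auto simp: pattern_family_def)
  moreover have "alternating (chi_tilde m [1]) \<and> swl (chi_tilde m [1]) = Some (chi_tilde m [1])"
    using swl_chi_tilde[of "[1]"] alternating_chi_tilde[of "[1]"] alternating.intros(1) rot_1 swu_1 by metis
  moreover have "alternating (chi_tilde m [2, 1]) \<and> swl (chi_tilde m [2, 1]) = Some (chi_tilde m [2, 1])"
    using swl_chi_tilde[of "[2, 1]"] alternating_chi_tilde[of "[2, 1]"] alternating.intros(2) rot_21 swu_12 by metis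
  moreover have "swl \<tau> = None" if "contains \<tau> [1, 3, 2]" using that by (simp add: swl_def Av_def)
  ultimately show ?thesis using contains_132_chi_tilde_2431 by metis
qed

section \<open>Matching configurations and classes\<close>

text \<open>Equal multisets of labels mean label fibers of equal size; the matching is built by
  removing one pair with a common label at a time.\<close>

lemma image_mset_eq_bij:
  assumes "finite S" "finite T" "image_mset t (mset_set S) = image_mset u (mset_set T)"
  shows "\<exists>f. bij_betw f S T \<and> (\<forall>x\<in>S. u (f x) = t x)"
  using assms
proof (induction S arbitrary: T rule: finite_induct)
  case empty
  then show ?case by (auto simp: bij_betw_def mset_set_empty_iff)
next
  case (insert a S)
  have "t a \<in># image_mset u (mset_set T)" using insert by (simp flip: insert.prems(2))
  then obtain b where b: "b \<in> T" "u b = t a" using insert.prems(1) by auto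
  have "mset_set T = add_mset b (mset_set (T - {b}))" using insert.prems(1) b by (simp add: mset_set.remove)
  then have "image_mset t (mset_set S) = image_mset u (mset_set (T - {b}))"
    using insert b by simp
  then obtain f where f: "bij_betw f S (T - {b})" "\<forall>x\<in>S. u (f x) = t x"
    using insert.IH[of "T - {b}"] insert.prems(1) by auto
  have "bij_betw (f(a := b)) S (T - {b})"
    using f(1) insert.hyps(2) by (metis bij_betw_cong fun_upd_other)
  then have "bij_betw (f(a := b)) (S \<union> {a}) (T - {b} \<union> {b})"
    using insert.hyps(2) by (intro bij_betw_combine) auto
  moreover have "S \<union> {a} = insert a S" "T - {b} \<union> {b} = T" using b by auto
  ultimately have "bij_betw (f(a := b)) (insert a S) T" by simp
  moreover have "\<forall>x\<in>insert a S. u ((f(a := b)) x) = t x" using f(2) b(2) insert.hyps(2) by auto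
  ultimately show ?case by blast
qed

text \<open>Both scans equal \<open>runs (rev s) [1]\<close>, so the multisets of types agree. The
  sorted type depends only on the multiset of the parts.\<close>

lemma VHC_bij:
  "\<exists>f. bij_betw f {H. valid_hook_configuration (perm132 s) H} {H. valid_hook_configuration (perm312 s) H} \<and>
    (\<forall>H. valid_hook_configuration (perm132 s) H \<longrightarrow>
      config_type (perm312 s, f H) = config_type (perm132 s, H))"
proof -
  note p = is_perm_perm132[of s] is_perm_perm312[of s]
  have "\<exists>f. bij_betw f {H. valid_hook_configuration (perm132 s) H} {H. valid_hook_configuration (perm312 s) H} \<and>
    (\<forall>H\<in>{H. valid_hook_configuration (perm132 s) H}.
      mset (induced_composition (perm312 s, f H)) = mset (induced_composition (perm132 s, H)))"
    by (rule image_mset_eq_bij[OF VHC_types(2)[OF p(1)] VHC_types(2)[OF p(2)]])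
       (simp add: VHC_types(1)[OF p(1)] VHC_types(1)[OF p(2)] scan_perm132 scan_perm312)
  moreover have "config_type c = config_type d" if "mset (induced_composition c) = mset (induced_composition d)" for c d
    using that unfolding config_type_def by (metis sorted_list_of_multiset_mset)
  ultimately show ?thesis by (metis (mono_tags, lifting) mem_Collect_eq)
qed

lemma strongly_fertility_Wilf_equivalentI:
  assumes "bij_betw g C C'"
    and "\<And>\<pi>. \<pi> \<in> C \<Longrightarrow> bij_betw (h \<pi>) {H. valid_hook_configuration \<pi> H} {H. valid_hook_configuration (g \<pi>) H}"
    and "\<And>\<pi> H. \<pi> \<in> C \<Longrightarrow> valid_hook_configuration \<pi> H \<Longrightarrow> config_type (g \<pi>, h \<pi> H) = config_type (\<pi>, H)"
  shows "strongly_fertility_Wilf_equivalent C C'"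
proof -
  let ?V = "\<lambda>\<pi>. {H. valid_hook_configuration \<pi> H}"
  let ?f = "\<lambda>(\<pi>, H). (g \<pi>, h \<pi> H)"
  have V: "VHC X = Sigma X ?V" for X by (auto simp: VHC_def)
  have "inj_on ?f (VHC C)"
  proof (rule inj_onI, clarify)
    fix \<pi> H \<rho> K assume "(\<pi>, H) \<in> VHC C" "(\<rho>, K) \<in> VHC C" "g \<pi> = g \<rho>" "h \<pi> H = h \<rho> K"
    then show "\<pi> = \<rho> \<and> H = K"
      using assms(1) assms(2)[of \<pi>] unfolding V bij_betw_def inj_on_def by auto
  qed
  moreover have "?f ` VHC C = VHC C'"
  proof (intro set_eqI iffI)
    fix c assume "c \<in> ?f ` VHC C"
    then obtain \<pi> H where c: "c = (g \<pi>, h \<pi> H)" "\<pi> \<in> C" "H \<in> ?V \<pi>" unfolding V by auto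
    then have "g \<pi> \<in> C'" "h \<pi> H \<in> ?V (g \<pi>)"
      using bij_betw_apply[OF assms(1)] bij_betw_apply[OF assms(2)] by blast+
    then show "c \<in> VHC C'" unfolding V c by blast
  next
    fix c assume "c \<in> VHC C'"
    then obtain \<rho> K where c: "c = (\<rho>, K)" "\<rho> \<in> C'" "K \<in> ?V \<rho>" unfolding V by auto
    then obtain \<pi> where p: "\<pi> \<in> C" "\<rho> = g \<pi>" using assms(1) unfolding bij_betw_def by blast
    then obtain H where "H \<in> ?V \<pi>" "K = h \<pi> H"
      using assms(2)[OF p(1)] c(3) unfolding bij_betw_def by blast
    then show "c \<in> ?f ` VHC C" unfolding V using c p by force
  qed
  moreover have "\<forall>c\<in>VHC C. config_type (?f c) = config_type c"
    using assms(3) by (auto simp: VHC_def)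
  ultimately show ?thesis unfolding strongly_fertility_Wilf_equivalent_def bij_betw_def by blast
qed

lemma Av_1: "Av ({[1, 3, 2], [3, 4, 1, 2]} \<union> T) =
    {\<pi>. (\<pi> = [] \<or> (\<exists>s. \<pi> = perm132 s)) \<and> (\<forall>\<tau>\<in>T. \<not> contains \<pi> \<tau>)}" (is "?L = ?R")
proof (intro set_eqI iffI)
  fix \<pi> assume "\<pi> \<in> ?L"
  then show "\<pi> \<in> ?R" using perm132_surj[of \<pi>] by (auto simp: Av_def contains_iff_occurs)
next
  fix \<pi> assume "\<pi> \<in> ?R"
  moreover have "\<not> occurs [1, 3, 2] []" "\<not> occurs [3, 4, 1, 2] []" by (auto dest: occurs_length)
  ultimately show "\<pi> \<in> ?L" using is_perm_perm132 perm132_avoids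
    by (auto simp: Av_def contains_iff_occurs is_perm_iff[of "[]"])
qed

lemma Av_2: "Av ({[3, 1, 2], [1, 3, 4, 2]} \<union> T) =
    {\<pi>. (\<pi> = [] \<or> (\<exists>s. \<pi> = perm312 s)) \<and> (\<forall>\<tau>\<in>T. \<not> contains \<pi> \<tau>)}" (is "?L = ?R")
proof (intro set_eqI iffI)
  fix \<pi> assume "\<pi> \<in> ?L"
  then show "\<pi> \<in> ?R" using perm312_surj[of \<pi>] by (auto simp: Av_def contains_iff_occurs)
next
  fix \<pi> assume "\<pi> \<in> ?R"
  moreover have "\<not> occurs [3, 1, 2] []" "\<not> occurs [1, 3, 4, 2] []" by (auto dest: occurs_length)
  ultimately show "\<pi> \<in> ?L" using is_perm_perm312 perm312_avoids
    by (auto simp: Av_def contains_iff_occurs is_perm_iff[of "[]"])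
qed

lemma alternating_strongly_fertility_Wilf_equivalent:
  assumes "\<And>\<tau>. \<tau> \<in> T \<Longrightarrow> alternating \<tau>"
  shows "strongly_fertility_Wilf_equivalent
    (Av ({[1, 3, 2], [3, 4, 1, 2]} \<union> T)) (Av ({[3, 1, 2], [1, 3, 4, 2]} \<union> T))"
proof -
  define steps where "steps \<pi> = (THE s. \<pi> = perm132 s)" for \<pi>
  \<comment> \<open>The empty permutation has no word and is matched with itself.\<close>
  define g where "g \<pi> = (if \<pi> = [] then [] else perm312 (steps \<pi>))" for \<pi>
  have ne: "perm132 s \<noteq> []" "perm312 s \<noteq> []" for s using perm132_nonempty[of s] perm312_nonempty[of s] by auto
  have "steps (perm132 s) = s" for s unfolding steps_def using perm132_inj by (intro the_equality) auto
  then have g: "g [] = []" "g (perm132 s) = perm312 s" for s by (simp_all add: g_def ne)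
  obtain k where k: "\<And>s. bij_betw (k s) {H. valid_hook_configuration (perm132 s) H} {H. valid_hook_configuration (perm312 s) H}"
    "\<And>s H. valid_hook_configuration (perm132 s) H \<Longrightarrow> config_type (perm312 s, k s H) = config_type (perm132 s, H)"
    using VHC_bij by metis
  define h where "h \<pi> = (if \<pi> = [] then id else k (steps \<pi>))" for \<pi>
  have h: "h [] = id" "h (perm132 s) = k s" for s using \<open>\<And>s. steps (perm132 s) = s\<close> by (simp_all add: h_def ne)
  have c: "contains (perm132 s) \<tau> \<longleftrightarrow> contains (perm312 s) \<tau>" if "\<tau> \<in> T" for s \<tau>
    using contains_perm132_iff_perm312 assms[OF that] by blast
  show ?thesis
    unfolding Av_1 Av_2
  proof (rule strongly_fertility_Wilf_equivalentI[of g _ _ h])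
    show "bij_betw g {\<pi>. (\<pi> = [] \<or> (\<exists>s. \<pi> = perm132 s)) \<and> (\<forall>\<tau>\<in>T. \<not> contains \<pi> \<tau>)}
        {\<pi>. (\<pi> = [] \<or> (\<exists>s. \<pi> = perm312 s)) \<and> (\<forall>\<tau>\<in>T. \<not> contains \<pi> \<tau>)}" (is "bij_betw g ?C ?C'")
      unfolding bij_betw_def
    proof
      show "inj_on g ?C"
      proof (rule inj_onI)
        fix \<pi> \<rho> assume "\<pi> \<in> ?C" "\<rho> \<in> ?C" "g \<pi> = g \<rho>"
        then show "\<pi> = \<rho>" by (auto simp: g ne ne[symmetric] dest: perm312_inj)
      qed
      show "g ` ?C = ?C'"
      proof (intro set_eqI iffI)
        fix \<rho> assume "\<rho> \<in> g ` ?C"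
        then show "\<rho> \<in> ?C'" using c by (auto simp: g)
      next
        fix \<rho> assume \<rho>: "\<rho> \<in> ?C'"
        then consider "\<rho> = []" | s where "\<rho> = perm312 s" by blast
        then show "\<rho> \<in> g ` ?C"
        proof cases
          case 1
          then show ?thesis using \<rho> g(1) by (intro image_eqI[of _ _ "[]"]) auto
        next
          case 2
          then show ?thesis using \<rho> c g(2) by (intro image_eqI[of _ _ "perm132 s"]) auto
        qed
      qed
    qed
  next
    fix \<pi> assume "\<pi> \<in> {\<pi>. (\<pi> = [] \<or> (\<exists>s. \<pi> = perm132 s)) \<and> (\<forall>\<tau>\<in>T. \<not> contains \<pi> \<tau>)}"
    then consider "\<pi> = []" | s where "\<pi> = perm132 s" by blast
    note cs = this
    from cs show "bij_betw (h \<pi>) {H. valid_hook_configuration \<pi> H} {H. valid_hook_configuration (g \<pi>) H}"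
      by cases (simp_all add: g h k(1))
    fix H assume "valid_hook_configuration \<pi> H"
    with cs show "config_type (g \<pi>, h \<pi> H) = config_type (\<pi>, H)"
      by cases (simp_all add: g h k(2))
  qed
qed

theorem theorem5p13:
  fixes I :: "nat set" and \<tau> :: "nat \<Rightarrow> perm" and \<tau>' :: "nat \<Rightarrow> perm option"
  assumes "\<And>i. i \<in> I \<Longrightarrow> \<tau> i \<in> pattern_family"
    and "\<And>i. i \<in> I \<Longrightarrow> \<tau>' i = swl (\<tau> i)"
  shows "strongly_fertility_Wilf_equivalent
           (Av ({[1,3,2], [3,4,1,2]} \<union> \<tau> ` I))
           (Av ({[3,1,2], [1,3,4,2]} \<union> {\<sigma>. \<exists>i\<in>I. \<tau>' i = Some \<sigma>}))"
proof -
  let ?T = "{\<sigma>. \<exists>i\<in>I. \<tau>' i = Some \<sigma>}"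
  have cs: "alternating (\<tau> i) \<and> \<tau>' i = Some (\<tau> i) \<or> contains (\<tau> i) [1, 3, 2] \<and> \<tau>' i = None" if "i \<in> I" for i
    using pattern_family_cases[OF assms(1)[OF that]] assms(2)[OF that] by simp
  have alt: "alternating \<sigma>" if "\<sigma> \<in> ?T" for \<sigma> using that cs by fastforce
  \<comment> \<open>Below 132-avoidance the two sets of patterns impose the same condition, so the
    first class may be written with \<open>?T\<close>. This reduces the claim to two classes that
    share one set of alternating patterns.\<close>
  have "(\<forall>\<sigma>\<in>\<tau> ` I. \<not> contains \<pi> \<sigma>) \<longleftrightarrow> (\<forall>\<sigma>\<in>?T. \<not> contains \<pi> \<sigma>)" if "\<not> contains \<pi> [1, 3, 2]" for \<pi>
  proof
    assume a: "\<forall>\<sigma>\<in>\<tau> ` I. \<not> contains \<pi> \<sigma>"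
    show "\<forall>\<sigma>\<in>?T. \<not> contains \<pi> \<sigma>"
    proof
      fix \<sigma> assume "\<sigma> \<in> ?T"
      then obtain i where "i \<in> I" "\<tau>' i = Some \<sigma>" by blast
      then show "\<not> contains \<pi> \<sigma>" using cs[of i] a by auto
    qed
  next
    assume a: "\<forall>\<sigma>\<in>?T. \<not> contains \<pi> \<sigma>"
    show "\<forall>\<sigma>\<in>\<tau> ` I. \<not> contains \<pi> \<sigma>"
    proof
      fix \<sigma> assume "\<sigma> \<in> \<tau> ` I"
      then obtain i where i: "i \<in> I" "\<sigma> = \<tau> i" by blast
      then show "\<not> contains \<pi> \<sigma>" using cs[OF i(1)] a contains_trans[of \<pi> \<sigma> "[1, 3, 2]"] that by blast
    qed
  qed
  then have eq: "Av ({[1,3,2], [3,4,1,2]} \<union> \<tau> ` I) = Av ({[1,3,2], [3,4,1,2]} \<union> ?T)"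
    unfolding Av_def ball_Un by blast
  show ?thesis unfolding eq by (rule alternating_strongly_fertility_Wilf_equivalent) (rule alt)
qed

end
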